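(* Let $X$ be an infinite dimensional complex Banach space and let $T \in L(X)$. The following conditions are equivalent: (i) $T$ is Drazin invertible; (ii) $0 \notin \mathrm{int}\, \sigma_{desc}(T)$ and there exists $(M,N) \in Red(T)$ such that $T_M$ is bounded below and $T_N$ is nilpotent; (iii) $0 \notin \mathrm{int}\, \sigma_{desc}(T)$ and there exists $(M,N) \in Red(T)$ such that $T_M$ is upper semi-Weyl and $T_N$ is nilpotent; (iv) $0 \notin \mathrm{int}\, \sigma_{LD}(T)$ and there exists $(M,N) \in Red(T)$ such that $T_M$ is surjective and $T_N$ is nilpotent; (v) $0 \notin \mathrm{int}\, \sigma_{LD}(T)$ and there exists $(M,N) \in Red(T)$ such that $T_M$ is lower semi-Weyl and $T_N$ is nilpotent.
   Context: $L(X)$ is the algebra of bounded linear operators on $X$. A subspace $M$ of $X$ is $T$-invariant if $T(M)\subset M$, and then $T_M: M\to M$ is the restriction $T_Mx=Tx$. We write $(M,N)\in Red(T)$ if $M,N$ are closed $T$-invariant subspaces of $X$ with $X=M\oplus N$ (the trivial cases $M=\{0\}$ or $N=\{0\}$ are allowed). For a bounded operator $S$ on a complex Banach space, $N(S)$ and $R(S)$ are the null space and range, $\alpha(S)=\dim N(S)$, $\beta(S)=\mathrm{codim}\, R(S)$. The ascent $p(S)$ is the smallest integer $p\ge 0$ with $N(S^p)=N(S^{p+1})$ ($\infty$ if none exists); the descent $q(S)$ is the smallest integer $q\ge 0$ with $R(S^q)=R(S^{q+1})$ ($\infty$ if none exists). $S$ is Drazin invertible if $p(S)=q(S)<\infty$.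 $S$ is left Drazin invertible if $p=p(S)<\infty$ and $R(S^{p+1})$ is closed. $S$ is bounded below if it is injective with closed range. $S$ is upper semi-Fredholm if $R(S)$ is closed and $\alpha(S)<\infty$; lower semi-Fredholm if $R(S)$ is closed and $\beta(S)<\infty$; in either case $\mathrm{ind}(S)=\alpha(S)-\beta(S)$. $S$ is upper semi-Weyl if it is upper semi-Fredholm with $\mathrm{ind}(S)\le 0$, and lower semi-Weyl if it is lower semi-Fredholm with $\mathrm{ind}(S)\ge 0$. $\sigma_{desc}(T)=\{\lambda\in\mathbb{C}: q(T-\lambda I)=\infty\}$ and $\sigma_{LD}(T)=\{\lambda\in\mathbb{C}: T-\lambda I \text{ is not left Drazin invertible}\}$. For $F\subset\mathbb{C}$, $\mathrm{int}\,F$ is the interior of $F$ in $\mathbb{C}$. *)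

theory Defs
  imports "HOL-Analysis.Analysis" "HOL-Library.Extended_Nat" "HOL-Library.Extended_Real"
begin

section \<open>Complex Banach spaces\<close>

text \<open>HOL-Analysis only has real normed spaces. The type class below adds a complex scalar
  multiplication compatible with the real one; together with completeness this is a complex
  Banach space.\<close>

class complex_normed_vector = real_normed_vector +
  fixes scaleC :: "complex \<Rightarrow> 'a \<Rightarrow> 'a"  (infixr \<open>*\<^sub>C\<close> 75)
  assumes scaleC_add_right: "a *\<^sub>C (x + y) = a *\<^sub>C x + a *\<^sub>C y"
    and scaleC_add_left: "(a + b) *\<^sub>C x = a *\<^sub>C x + b *\<^sub>C x"
    and scaleC_scaleC: "a *\<^sub>C (b *\<^sub>C x) = (a * b) *\<^sub>C x"
    and scaleC_one: "1 *\<^sub>C x = x"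
    and scaleR_scaleC: "r *\<^sub>R x = complex_of_real r *\<^sub>C x"
    and norm_scaleC: "norm (a *\<^sub>C x) = cmod a * norm x"

class complex_banach = complex_normed_vector + complete_space

subclass (in complex_banach) banach ..

global_interpretation complex_vector:
  vector_space "scaleC :: complex \<Rightarrow> 'a \<Rightarrow> 'a :: complex_normed_vector"
  defines csubspace = complex_vector.subspace
    and cspan = complex_vector.span
    and cdim = complex_vector.dim
  by unfold_locales
    (simp_all add: scaleC_add_right scaleC_add_left scaleC_scaleC scaleC_one)

text \<open>The library dimension of an infinite-dimensional space is \<open>0\<close> by convention; \<open>ecdim\<close> takes
  the value \<open>\<infinity>\<close> there.\<close>

definition finite_cdim :: "'a :: complex_normed_vector set \<Rightarrow> bool" where
  "finite_cdim V \<longleftrightarrow> (\<exists>B. finite B \<and> V \<subseteq> cspan B)"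

definition ecdim :: "'a :: complex_normed_vector set \<Rightarrow> enat" where
  "ecdim V = (if finite_cdim V then enat (cdim V) else \<infinity>)"

definition direct_sum :: "'a :: ab_group_add set \<Rightarrow> 'a set \<Rightarrow> 'a set \<Rightarrow> bool" where
  "direct_sum V M N \<longleftrightarrow> V = {m + n | m n. m \<in> M \<and> n \<in> N} \<and> M \<inter> N = {0}"

text \<open>The codimension of a subspace \<open>W\<close> of \<open>V\<close> is the dimension of an algebraic complement of
  \<open>W\<close> in \<open>V\<close>, which is isomorphic to \<open>V / W\<close>. All complements have the same dimension (proved
  below), so the infimum just selects that common value.\<close>

definition ecodim :: "'a :: complex_normed_vector set \<Rightarrow> 'a set \<Rightarrow> enat" where
  "ecodim V W = Inf {ecdim C | C. csubspace C \<and> direct_sum V W C}"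

lemma direct_sum_memI: "direct_sum V M N \<Longrightarrow> m \<in> M \<Longrightarrow> n \<in> N \<Longrightarrow> m + n \<in> V"
  by (auto simp: direct_sum_def)

lemma ecdim_complement_le:
  assumes W: "csubspace W" and C: "csubspace C" and C': "csubspace C'"
    and d: "direct_sum V W C" and d': "direct_sum V W C'"
  shows "ecdim C \<le> ecdim C'"
proof (cases "finite_cdim C'")
  case True
  then obtain B0 where B0: "finite B0" "C' \<subseteq> cspan B0" by (auto simp: finite_cdim_def)
  obtain B where B: "B \<subseteq> C'" "complex_vector.independent B" "C' \<subseteq> cspan B" "card B = cdim C'"
    using complex_vector.basis_exists by blast
  have finB: "finite B"
    using complex_vector.independent_span_bound[OF B0(1) B(2)] B(1) B0(2) by auto
  have W0: "0 \<in> W" by (rule complex_vector.subspace_0[OF W])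
  have C0: "0 \<in> C'" by (rule complex_vector.subspace_0[OF C'])
  have "\<exists>g. b - g \<in> W \<and> g \<in> C" if "b \<in> B" for b
  proof -
    have "0 + b \<in> V" using direct_sum_memI[OF d' W0] that B(1) by blast
    then obtain w c where "w \<in> W" "c \<in> C" "b = w + c"
      using d unfolding direct_sum_def by auto
    then show ?thesis by (intro exI[of _ c]) auto
  qed
  then have "\<exists>g. \<forall>b\<in>B. b - g b \<in> W \<and> g b \<in> C" by (intro bchoice) blast
  then obtain g where g: "\<And>b. b \<in> B \<Longrightarrow> b - g b \<in> W" "\<And>b. b \<in> B \<Longrightarrow> g b \<in> C" by blast
  have key: "\<exists>z \<in> cspan (g ` B). c - z \<in> W" if "c \<in> cspan B" for c
    using that
  proof (induction rule: complex_vector.span_induct_alt)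
    case base
    show ?case using W0 complex_vector.span_zero by force
  next
    case (step a b y)
    then obtain z where z: "z \<in> cspan (g ` B)" "y - z \<in> W" by auto
    have "g b \<in> cspan (g ` B)" using step by (intro complex_vector.span_base) simp
    then have "a *\<^sub>C g b + z \<in> cspan (g ` B)"
      using z by (intro complex_vector.span_add complex_vector.span_scale)
    moreover have "a *\<^sub>C (b - g b) + (y - z) \<in> W"
      using step z g W by (intro complex_vector.subspace_add complex_vector.subspace_scale) auto
    moreover have "a *\<^sub>C (b - g b) + (y - z) = a *\<^sub>C b + y - (a *\<^sub>C g b + z)"
      by (simp add: complex_vector.scale_right_diff_distrib)
    ultimately show ?case by (intro bexI[of _ "a *\<^sub>C g b + z"]) simp_all
  qed
  have sub: "C \<subseteq> cspan (g ` B)"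
  proof
    fix c assume c: "c \<in> C"
    have "0 + c \<in> V" by (rule direct_sum_memI[OF d W0 c])
    then obtain w c' where wc: "w \<in> W" "c' \<in> C'" "c = w + c'"
      using d' unfolding direct_sum_def by auto
    then obtain z where z: "z \<in> cspan (g ` B)" "c' - z \<in> W"
      using key[of c'] B(3) by (auto simp: subset_eq)
    have "w + (c' - z) \<in> W" using wc z W by (intro complex_vector.subspace_add)
    then have 1: "c - z \<in> W" using wc by (simp add: algebra_simps)
    have "cspan (g ` B) \<subseteq> C" using g(2) C by (intro complex_vector.span_minimal) auto
    then have "c - z \<in> C" using c z C by (intro complex_vector.subspace_diff) auto
    moreover have "W \<inter> C = {0}" using d by (simp add: direct_sum_def)
    ultimately have "c - z = 0" using 1 by blast
    then have "c = z" by simp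
    then show "c \<in> cspan (g ` B)" using z by simp
  qed
  have "cdim C \<le> card (g ` B)"
    using sub finB by (intro complex_vector.dim_le_card) auto
  also have "\<dots> \<le> cdim C'" using card_image_le[OF finB] B(4) by simp
  finally show ?thesis using True sub finB by (auto simp: ecdim_def finite_cdim_def intro!: exI[of _ "g ` B"])
qed (auto simp: ecdim_def)

lemma ecodim_eq:
  assumes "csubspace W" "csubspace C" "direct_sum V W C"
  shows "ecodim V W = ecdim C"
  unfolding ecodim_def
  using assms by (intro antisym Inf_lower Inf_greatest) (auto intro: ecdim_complement_le)

section \<open>Operators and their restrictions\<close>

definition bounded_clinear :: "('a :: complex_normed_vector \<Rightarrow> 'a) \<Rightarrow> bool" where
  "bounded_clinear T \<longleftrightarrow> bounded_linear T \<and> (\<forall>c x. T (c *\<^sub>C x) = c *\<^sub>C T x)"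

definition invariant_subspace :: "('a :: complex_normed_vector \<Rightarrow> 'a) \<Rightarrow> 'a set \<Rightarrow> bool" where
  "invariant_subspace T M \<longleftrightarrow> csubspace M \<and> T ` M \<subseteq> M"

definition Red :: "('a :: complex_normed_vector \<Rightarrow> 'a) \<Rightarrow> ('a set \<times> 'a set) set" where
  "Red T = {(M, N). closed M \<and> closed N \<and> invariant_subspace T M \<and> invariant_subspace T N \<and>
              direct_sum UNIV M N}"

text \<open>A property with suffix \<open>_on M\<close>, applied to \<open>T\<close>, is that property of the restriction
  \<open>T\<^sub>M : M \<rightarrow> M\<close>. It is meant for closed invariant subspaces \<open>M\<close>: then \<open>M\<close> is itself a Banach
  space, powers of \<open>T\<^sub>M\<close> are restrictions of powers of \<open>T\<close>, and closedness in \<open>M\<close> and in the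
  whole space agree. The choice \<open>M = UNIV\<close> gives the operator \<open>T\<close> itself.\<close>

definition null_space_on :: "'a :: complex_normed_vector set \<Rightarrow> ('a \<Rightarrow> 'a) \<Rightarrow> 'a set" where
  "null_space_on M T = {x \<in> M. T x = 0}"

definition range_on :: "'a :: complex_normed_vector set \<Rightarrow> ('a \<Rightarrow> 'a) \<Rightarrow> 'a set" where
  "range_on M T = T ` M"

definition nullity_on :: "'a :: complex_normed_vector set \<Rightarrow> ('a \<Rightarrow> 'a) \<Rightarrow> enat" where
  "nullity_on M T = ecdim (null_space_on M T)"

definition deficiency_on :: "'a :: complex_normed_vector set \<Rightarrow> ('a \<Rightarrow> 'a) \<Rightarrow> enat" where
  "deficiency_on M T = ecodim M (range_on M T)"

definition bounded_below_on :: "'a :: complex_normed_vector set \<Rightarrow> ('a \<Rightarrow> 'a) \<Rightarrow> bool" where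
  "bounded_below_on M T \<longleftrightarrow> inj_on T M \<and> closed (range_on M T)"

definition surjective_on :: "'a :: complex_normed_vector set \<Rightarrow> ('a \<Rightarrow> 'a) \<Rightarrow> bool" where
  "surjective_on M T \<longleftrightarrow> range_on M T = M"

definition nilpotent_on :: "'a :: complex_normed_vector set \<Rightarrow> ('a \<Rightarrow> 'a) \<Rightarrow> bool" where
  "nilpotent_on M T \<longleftrightarrow> (\<exists>n. \<forall>x \<in> M. (T ^^ n) x = 0)"

definition upper_semi_Fredholm_on :: "'a :: complex_normed_vector set \<Rightarrow> ('a \<Rightarrow> 'a) \<Rightarrow> bool" where
  "upper_semi_Fredholm_on M T \<longleftrightarrow> closed (range_on M T) \<and> nullity_on M T < \<infinity>"

definition lower_semi_Fredholm_on :: "'a :: complex_normed_vector set \<Rightarrow> ('a \<Rightarrow> 'a) \<Rightarrow> bool" where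
  "lower_semi_Fredholm_on M T \<longleftrightarrow> closed (range_on M T) \<and> deficiency_on M T < \<infinity>"

text \<open>The index takes values in \<open>\<int> \<union> {-\<infinity>, \<infinity>}\<close>; it is only used for semi-Fredholm operators, where
  the two terms are not both infinite.\<close>

definition index_on :: "'a :: complex_normed_vector set \<Rightarrow> ('a \<Rightarrow> 'a) \<Rightarrow> ereal" where
  "index_on M T = ereal_of_enat (nullity_on M T) - ereal_of_enat (deficiency_on M T)"

definition upper_semi_Weyl_on :: "'a :: complex_normed_vector set \<Rightarrow> ('a \<Rightarrow> 'a) \<Rightarrow> bool" where
  "upper_semi_Weyl_on M T \<longleftrightarrow> upper_semi_Fredholm_on M T \<and> index_on M T \<le> 0"

definition lower_semi_Weyl_on :: "'a :: complex_normed_vector set \<Rightarrow> ('a \<Rightarrow> 'a) \<Rightarrow> bool" where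
  "lower_semi_Weyl_on M T \<longleftrightarrow> lower_semi_Fredholm_on M T \<and> index_on M T \<ge> 0"

section \<open>Ascent, descent and Drazin invertibility\<close>

text \<open>The infimum of the empty set in \<^typ>\<open>enat\<close> is \<open>\<infinity>\<close>.\<close>

definition ascent :: "('a :: complex_normed_vector \<Rightarrow> 'a) \<Rightarrow> enat" where
  "ascent T = Inf {enat p | p. null_space_on UNIV (T ^^ p) = null_space_on UNIV (T ^^ (p + 1))}"

definition descent :: "('a :: complex_normed_vector \<Rightarrow> 'a) \<Rightarrow> enat" where
  "descent T = Inf {enat q | q. range_on UNIV (T ^^ q) = range_on UNIV (T ^^ (q + 1))}"

definition Drazin_invertible :: "('a :: complex_normed_vector \<Rightarrow> 'a) \<Rightarrow> bool" where
  "Drazin_invertible T \<longleftrightarrow> ascent T = descent T \<and> descent T < \<infinity>"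

definition left_Drazin_invertible :: "('a :: complex_normed_vector \<Rightarrow> 'a) \<Rightarrow> bool" where
  "left_Drazin_invertible T \<longleftrightarrow>
     (\<exists>p. ascent T = enat p \<and> closed (range_on UNIV (T ^^ (p + 1))))"

definition descent_spectrum :: "('a :: complex_normed_vector \<Rightarrow> 'a) \<Rightarrow> complex set" where
  "descent_spectrum T = {z. descent (\<lambda>x. T x - z *\<^sub>C x) = \<infinity>}"

definition left_Drazin_spectrum :: "('a :: complex_normed_vector \<Rightarrow> 'a) \<Rightarrow> complex set" where
  "left_Drazin_spectrum T = {z. \<not> left_Drazin_invertible (\<lambda>x. T x - z *\<^sub>C x)}"

end

theory Submission
  imports Defs
begin

text \<open>
  \<^bold>\<open>Idea of the proof.\<close> Drazin invertibility means that the kernels and the ranges of the powers of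
  \<open>T\<close> become constant at a common exponent \<open>p\<close>. Then \<open>X = R(T\<^sup>p) \<oplus> N(T\<^sup>p)\<close>, and \<open>T\<close> is invertible on the
  first summand and nilpotent on the second (\<open>Drazin_decomposition\<close>). So all four decompositions exist
  at once, and \<open>T - \<mu>\<close> is invertible for every small \<open>\<mu> \<noteq> 0\<close> (\<open>Drazin_punctured_neighbourhood\<close>), which
  keeps \<open>0\<close> out of the interior of both spectra.

  Conversely, bounded below implies upper semi-Weyl and surjective implies lower semi-Weyl, so only
  the two Weyl conditions have to be treated. If \<open>P\<close> is the projection onto \<open>M\<close> along \<open>N\<close>, the operator
  \<open>S = T P + (I - P)\<close> on the whole space has the kernel and the deficiency of \<open>T\<^sub>M\<close>, it has
  finite ascent and descent only if \<open>T\<close> has, and \<open>S - \<mu>\<close> inherits finite ascent or descent from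
  \<open>T - \<mu>\<close> if \<open>\<mu> \<noteq> 1\<close>. This removes the subspaces from the problem.

  Let \<open>S\<close> be upper semi-Weyl. Since \<open>\<alpha>(S) \<le> \<beta>(S)\<close>, some bounded \<open>F\<close> of finite rank maps \<open>N(S)\<close>
  injectively into a complement of \<open>R(S)\<close>, and \<open>A = S + F\<close> is bounded below. So \<open>A - \<mu>\<close> is bounded
  below for all small \<open>\<mu>\<close>, with a uniform bound. By assumption some small \<open>\<mu>\<close> makes the descent of
  \<open>S - \<mu> = (A - \<mu>) - F\<close> finite. An injective operator with a finite rank perturbation of finite
  descent is surjective (\<open>perturb_injective_range_stable\<close>, a statement of pure linear algebra that
  stands in for index theory); hence \<open>A - \<mu>\<close> is invertible, and by uniformity so is
  \<open>A\<close>. The lower case is dual: \<open>A\<close> is surjective, some \<open>A - \<mu>\<close> is injective, and \<open>A\<close> is injective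
  because a nontrivial kernel of a surjective operator survives small shifts (\<open>kernel_persists\<close>).

  In both cases \<open>S = A - F\<close> with \<open>A\<close> invertible and \<open>F\<close> of finite rank, and \<open>S - \<mu>\<close> is Drazin invertible
  for arbitrarily small \<open>\<mu>\<close>; thus \<open>S - \<mu>\<close> is injective for arbitrarily small \<open>\<mu>\<close>. Let \<open>Z\<close> be the
  intersection of the ranges \<open>R(S\<^sup>n)\<close>. It is closed, \<open>S\<close> maps it onto itself, and by \<open>kernel_persists\<close>
  on \<open>Z\<close> the kernel of \<open>S\<close> meets \<open>Z\<close> only in \<open>0\<close>. As the kernel has finite dimension it already
  misses some \<open>R(S\<^sup>n)\<close>, so the ascent of \<open>S\<close> is finite, and then so is the descent
  (\<open>Drazin_at_limit\<close>).

  The functional analysis behind this consists of the open mapping theorem relative to a closed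
  subspace (\<open>bounded_preimages\<close>), the Hahn-Banach theorem in the form of norming functionals
  (\<open>norming_functional\<close>), and their usual consequences for finite-dimensional subspaces.
\<close>

section \<open>Linear maps and finite dimension\<close>

abbreviation lin :: "('a :: complex_normed_vector \<Rightarrow> 'a) \<Rightarrow> bool" where
  "lin f \<equiv> Vector_Spaces.linear scaleC scaleC f"

lemma linI:
  "(\<And>x y. f (x + y) = f x + f y) \<Longrightarrow> (\<And>c x. f (scaleC c x) = scaleC c (f x)) \<Longrightarrow> lin f"
  unfolding Vector_Spaces.linear_iff by (auto intro: complex_vector.vector_space_axioms)

lemma lin_simps:
  assumes "lin f"
  shows lin_add: "f (x + y) = f x + f y" and lin_scale: "f (scaleC c x) = scaleC c (f x)"
    and lin_diff: "f (x - y) = f x - f y" and lin_zero: "f 0 = 0"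
proof -
  interpret f: Vector_Spaces.linear scaleC scaleC f by fact
  show "f (x + y) = f x + f y" "f (scaleC c x) = scaleC c (f x)" "f (x - y) = f x - f y" "f 0 = 0"
    by (simp_all add: f.add f.scale f.diff)
qed

lemma lin_id: "lin (\<lambda>x. x)"
  by (rule linI) simp_all

lemma lin_compose: "lin f \<Longrightarrow> lin g \<Longrightarrow> lin (\<lambda>x. f (g x))"
  by (rule linI) (simp_all add: lin_simps)

lemma lin_plus: "lin f \<Longrightarrow> lin g \<Longrightarrow> lin (\<lambda>x. f x + g x)"
  by (rule linI) (simp_all add: lin_simps algebra_simps complex_vector.scale_right_distrib)

lemma lin_minus: "lin f \<Longrightarrow> lin g \<Longrightarrow> lin (\<lambda>x. f x - g x)"
  by (rule linI) (simp_all add: lin_simps algebra_simps complex_vector.scale_right_diff_distrib)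

lemma lin_funpow: "lin f \<Longrightarrow> lin (f ^^ n)"
  by (induction n) (auto intro!: linI simp: lin_simps)

lemma subspace_kernel: "lin f \<Longrightarrow> csubspace {x. f x = 0}"
  by (auto simp: complex_vector.subspace_def lin_simps)

lemma subspace_lin_image: "lin f \<Longrightarrow> csubspace V \<Longrightarrow> csubspace (f ` V)"
  unfolding complex_vector.subspace_def
  by (auto simp: image_iff lin_zero) (metis lin_zero, metis lin_add, metis lin_scale)

lemma lin_image_span: "lin f \<Longrightarrow> f ` cspan B = cspan (f ` B)"
proof -
  assume f: "lin f"
  interpret vector_space_pair scaleC scaleC by unfold_locales
  show ?thesis using linear_span_image[OF f, of B] by (simp add: cspan_def)
qed

lemma left_inverse_on:
  assumes "lin f" "csubspace V" "inj_on f V"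
  obtains g where "lin g" "range g \<subseteq> V" "\<And>v. v \<in> V \<Longrightarrow> g (f v) = v"
proof -
  interpret vector_space_pair scaleC scaleC by unfold_locales
  show thesis using linear_exists_left_inverse_on[OF assms[unfolded csubspace_def]] that by metis
qed

lemma right_inverse:
  assumes "lin f" "csubspace V"
  obtains g where "lin g" "range g \<subseteq> V" "\<And>v. v \<in> f ` V \<Longrightarrow> f (g v) = v"
proof -
  interpret vector_space_pair scaleC scaleC by unfold_locales
  show thesis using linear_exists_right_inverse_on[OF assms[unfolded csubspace_def]] that by metis
qed

lemma fin_dim_subset: "U \<subseteq> V \<Longrightarrow> finite_cdim V \<Longrightarrow> finite_cdim U"
  unfolding finite_cdim_def by blast

lemma fin_dim_image:
  assumes "lin f" "finite_cdim V" shows "finite_cdim (f ` V)"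
proof -
  obtain B where "finite B" "V \<subseteq> cspan B" using assms(2) unfolding finite_cdim_def by blast
  then have "finite (f ` B)" "f ` V \<subseteq> cspan (f ` B)"
    by (auto simp flip: lin_image_span[OF assms(1)])
  then show ?thesis unfolding finite_cdim_def by blast
qed

lemma fin_dim_sum:
  assumes "finite_cdim U" "finite_cdim V" "\<And>w. w \<in> W \<Longrightarrow> \<exists>u\<in>U. \<exists>v\<in>V. w = u + v"
  shows "finite_cdim W"
proof -
  obtain B C where "finite B" "U \<subseteq> cspan B" "finite C" "V \<subseteq> cspan C"
    using assms(1,2) unfolding finite_cdim_def by blast
  moreover have "cspan B \<subseteq> cspan (B \<union> C)" "cspan C \<subseteq> cspan (B \<union> C)"
    by (simp_all add: complex_vector.span_mono)
  ultimately have "finite (B \<union> C) \<and> W \<subseteq> cspan (B \<union> C)"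
    using assms(3) by (blast intro: complex_vector.span_add)
  then show ?thesis unfolding finite_cdim_def by blast
qed

lemma fin_dim_inj_image:
  assumes "lin f" "csubspace V" "inj_on f V" "finite_cdim (f ` V)"
  shows "finite_cdim V"
proof -
  obtain g where g: "lin g" "\<And>v. v \<in> V \<Longrightarrow> g (f v) = v"
    using left_inverse_on[OF assms(1-3)] by metis
  have "V \<subseteq> g ` (f ` V)" using g(2) by (force simp: image_image)
  then show ?thesis using fin_dim_image[OF g(1) assms(4)] by (rule fin_dim_subset)
qed

lemma fin_dim_basis:
  assumes "finite_cdim V"
  obtains B where "finite B" "B \<subseteq> V" "complex_vector.independent B" "V \<subseteq> cspan B" "card B = cdim V"
proof -
  obtain C where C: "finite C" "V \<subseteq> cspan C" using assms unfolding finite_cdim_def by blast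
  obtain B where B: "B \<subseteq> V" "complex_vector.independent B" "V \<subseteq> cspan B" "card B = cdim V"
    using complex_vector.basis_exists by blast
  have "finite B" using complex_vector.independent_span_bound[OF C(1) B(2)] B(1) C(2) by auto
  then show thesis using B by (rule that)
qed

lemma dim_image_le_fin: assumes "lin f" "finite_cdim V" shows "cdim (f ` V) \<le> cdim V"
proof -
  obtain B where B: "finite B" "V \<subseteq> cspan B" "card B = cdim V"
    using fin_dim_basis[OF assms(2)] by metis
  have "f ` V \<subseteq> cspan (f ` B)" using B(2) by (auto simp flip: lin_image_span[OF assms(1)])
  then have "cdim (f ` V) \<le> card (f ` B)" using B(1) by (intro complex_vector.dim_le_card) auto
  then show ?thesis using card_image_le[OF B(1), of f] B(3) by simp
qed

text \<open>Dimension detects equality only if the larger space is finite-dimensional, because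
  \<^const>\<open>cdim\<close> is \<open>0\<close> on every infinite-dimensional space.\<close>

lemma subspace_eq_if_dim_ge:
  assumes "csubspace U" "U \<subseteq> W" "finite_cdim W" "cdim W \<le> cdim U"
  shows "U = W"
proof (rule ccontr)
  assume "U \<noteq> W"
  then obtain w where w: "w \<in> W" "w \<notin> U" using assms(2) by blast
  obtain B where B: "finite B" "B \<subseteq> U" "complex_vector.independent B" "U \<subseteq> cspan B" "card B = cdim U"
    using fin_dim_basis[OF fin_dim_subset[OF assms(2,3)]] .
  obtain C where C: "finite C" "W \<subseteq> cspan C" "card C = cdim W"
    using fin_dim_basis[OF assms(3)] by metis
  have "cspan B \<subseteq> U" using B(2) assms(1) by (rule complex_vector.span_minimal)
  then have "w \<notin> cspan B" using w by blast
  then have "complex_vector.independent (insert w B)" using B(3) by (rule complex_vector.independent_insertI)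
  moreover have "insert w B \<subseteq> cspan C" using B(2) C(2) w assms(2) by blast
  ultimately have "card (insert w B) \<le> card C"
    using complex_vector.independent_span_bound[OF C(1)] by blast
  moreover have "w \<notin> B" using w B(2) by blast
  ultimately show False using B C assms(4) by simp
qed

text \<open>A linear right inverse of \<open>f\<close> is injective, so its image in \<open>L\<close> has full dimension; being all of
  \<open>L\<close>, it shows that the right inverse is a left inverse too.\<close>

lemma surj_on_fin_dim_imp_inj_on:
  assumes f: "lin f" and L: "csubspace L" "finite_cdim L" and surj: "f ` L = L"
  shows "inj_on f L"
proof -
  obtain g where g: "lin g" "range g \<subseteq> L" "\<And>v. v \<in> f ` L \<Longrightarrow> f (g v) = v"
    using right_inverse[OF f L(1)] by metis
  have gL: "g ` L \<subseteq> L" using g(2) by blast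
  have "L = f ` (g ` L)" using g(3) surj by (simp add: image_image)
  then have "cdim L \<le> cdim (g ` L)"
    using dim_image_le_fin[OF f fin_dim_subset[OF gL L(2)]] by simp
  then have "g ` L = L"
    using subspace_eq_if_dim_ge[OF subspace_lin_image[OF g(1) L(1)] gL L(2)] by simp
  then show ?thesis using g(3) surj by (metis inj_on_inverseI imageE)
qed

definition fin_rank :: "('a::complex_normed_vector \<Rightarrow> 'a::complex_normed_vector) \<Rightarrow> bool" where
  "fin_rank F \<longleftrightarrow> lin F \<and> finite_cdim (range F)"

lemma fin_rank_plus: "fin_rank F \<Longrightarrow> fin_rank G \<Longrightarrow> fin_rank (\<lambda>x. F x + G x)"
  unfolding fin_rank_def by (auto intro: lin_plus fin_dim_sum)

lemma fin_rank_neg: "fin_rank F \<Longrightarrow> fin_rank (\<lambda>x. - F x)"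
proof -
  assume F: "fin_rank F"
  have neg: "lin (\<lambda>x. - x)" by (rule linI) simp_all
  from F have "finite_cdim ((\<lambda>x. - x) ` range F)"
    unfolding fin_rank_def by (intro fin_dim_image[OF neg]) simp
  then show "fin_rank (\<lambda>x. - F x)"
    using F lin_compose[OF neg, of F] by (simp add: fin_rank_def image_image)
qed

lemma fin_rank_minus: "fin_rank F \<Longrightarrow> fin_rank G \<Longrightarrow> fin_rank (\<lambda>x. F x - G x)"
  using fin_rank_plus[of F, OF _ fin_rank_neg[of G]] by simp

lemma fin_rank_left: "lin A \<Longrightarrow> fin_rank F \<Longrightarrow> fin_rank (\<lambda>x. A (F x))"
  using fin_dim_image[of A "range F"] by (auto simp: fin_rank_def lin_compose image_image)

lemma fin_rank_right: "lin A \<Longrightarrow> fin_rank F \<Longrightarrow> fin_rank (\<lambda>x. F (A x))"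
  unfolding fin_rank_def by (auto intro: lin_compose fin_dim_subset[of _ "range F"])

lemma fin_rank_perturb_funpow:
  assumes A: "lin A" and F: "fin_rank F"
  shows "\<exists>G. fin_rank G \<and> ((\<lambda>x. A x + F x) ^^ n) = (\<lambda>x. (A ^^ n) x + G x)"
proof (induction n)
  case 0
  have "fin_rank (\<lambda>x. 0)" unfolding fin_rank_def finite_cdim_def by (auto intro!: linI exI[of _ "{}"])
  then show ?case by (intro exI[of _ "\<lambda>x. 0"]) (auto simp: id_def)
next
  case (Suc n)
  let ?V = "\<lambda>x. A x + F x"
  obtain G where G: "fin_rank G" "?V ^^ n = (\<lambda>x. (A ^^ n) x + G x)" using Suc by blast
  have V: "lin ?V" using A F by (auto intro: lin_plus simp: fin_rank_def)
  have "fin_rank (\<lambda>x. A (G x) + F ((?V ^^ n) x))"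
    by (rule fin_rank_plus[OF fin_rank_left[OF A G(1)] fin_rank_right[OF lin_funpow[OF V] F]])
  moreover have "(?V ^^ Suc n) = (\<lambda>x. (A ^^ Suc n) x + (A (G x) + F ((?V ^^ n) x)))"
    by (rule ext) (simp add: G(2) lin_add[OF A] algebra_simps)
  ultimately show ?case by blast
qed

text \<open>Everything happens on the finite-dimensional space \<open>R(G)\<close>: it is mapped onto itself, and it contains
  the kernel of \<open>I + G\<close>.\<close>

lemma surj_id_plus_fin_rank_imp_inj:
  assumes G: "fin_rank G" and surj: "surj (\<lambda>x. x + G x)"
  shows "inj (\<lambda>x. x + G x)"
proof -
  let ?f = "\<lambda>x. x + G x" and ?L = "range G"
  have linG: "lin G" and L: "csubspace ?L" "finite_cdim ?L"
    using G subspace_lin_image[of G UNIV] by (auto simp: fin_rank_def)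
  have f: "lin ?f" by (intro lin_plus lin_id linG)
  have "?f ` ?L = ?L"
  proof
    show "?f ` ?L \<subseteq> ?L" using L(1) by (auto simp: complex_vector.subspace_add)
    show "?L \<subseteq> ?f ` ?L"
    proof
      fix y assume y: "y \<in> ?L"
      obtain x where x: "y = x + G x" using surj by (metis surjD)
      have "y - G x \<in> ?L" by (intro complex_vector.subspace_diff L(1) y rangeI)
      then have "x \<in> ?L" using x by simp
      then show "y \<in> ?f ` ?L" using x by blast
    qed
  qed
  then have inj: "inj_on ?f ?L" using surj_on_fin_dim_imp_inj_on[OF f L] by blast
  show ?thesis
  proof (rule injI)
    fix x y assume "x + G x = y + G y"
    then have "(x + G x) - (y + G y) = 0" by simp
    then have eq: "x - y + G (x - y) = 0" by (simp add: lin_diff[OF linG] add_diff_add)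
    then have "x - y = - G (x - y)" by (rule eq_neg_iff_add_eq_0[THEN iffD2])
    also have "\<dots> = G (y - x)" by (simp add: lin_diff[OF linG])
    finally have "x - y = G (y - x)" .
    then have mem: "x - y \<in> ?L" by blast
    have "?f (x - y) = ?f 0" unfolding eq lin_zero[OF linG] by simp
    then have "x - y = 0" using mem complex_vector.subspace_0[OF L(1)] by (rule inj_onD[OF inj])
    then show "x = y" by simp
  qed
qed

text \<open>The index is invariant under finite rank perturbations; here it is \<open>\<le> 0\<close> on one side and \<open>\<ge> 0\<close> on the
  other, so both operators have index \<open>0\<close>. The index itself can be avoided: if \<open>B\<close> is a left inverse
  of \<open>A\<close>, then \<open>B P = I + B (P - A)\<close> is surjective, hence injective by the previous lemma. So \<open>P\<close> is
  injective, and \<open>B\<close> is injective because \<open>P\<close> is surjective, which makes \<open>B\<close> a two-sided inverse of \<open>A\<close>.\<close>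

lemma inj_surj_fin_rank_apart:
  assumes A: "lin A" "inj A" and P: "lin P" "surj P" and D: "fin_rank (\<lambda>x. P x - A x)"
  shows "surj A" "inj P"
proof -
  obtain B where B: "lin B" "\<And>x. B (A x) = x"
    using left_inverse_on[OF A(1) complex_vector.subspace_UNIV A(2)] UNIV_I by metis
  let ?G = "\<lambda>x. B (P x - A x)"
  have G: "fin_rank ?G" by (rule fin_rank_left[OF B(1) D])
  have BP: "x + ?G x = B (P x)" for x by (simp add: lin_diff[OF B(1)] B(2))
  have "surj (\<lambda>x. x + ?G x)"
    unfolding BP by (rule surjI[of _ "\<lambda>y. inv P (A y)"]) (simp add: surj_f_inv_f[OF P(2)] B(2))
  then have inj: "inj (\<lambda>x. B (P x))" using surj_id_plus_fin_rank_imp_inj[OF G] by (simp add: BP)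
  then show "inj P" by (auto simp: inj_def)
  show "surj A"
  proof (rule surjI)
    fix y
    obtain x where x: "y - A (B y) = P x" using P(2) by (metis surjD)
    have "B (P x) = 0" unfolding x[symmetric] by (simp add: lin_diff[OF B(1)] B(2))
    also have "\<dots> = B (P 0)" by (simp add: lin_zero[OF P(1)] lin_zero[OF B(1)])
    finally have "x = 0" by (rule injD[OF inj])
    then show "A (B y) = y" using x by (simp add: lin_zero[OF P(1)])
  qed
qed

section \<open>Ascent, descent and finite rank perturbations\<close>

text \<open>The ascent (descent) of \<open>V\<close> is at most \<open>p\<close> iff \<open>V\<close> is kernel stable (range stable) at \<open>p\<close>. Only the
  nontrivial inclusion is recorded.\<close>

definition kernel_stable :: "('a :: complex_normed_vector \<Rightarrow> 'a) \<Rightarrow> nat \<Rightarrow> bool" where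
  "kernel_stable V p \<longleftrightarrow> (\<forall>x. (V ^^ Suc p) x = 0 \<longrightarrow> (V ^^ p) x = 0)"

definition range_stable :: "('a :: complex_normed_vector \<Rightarrow> 'a) \<Rightarrow> nat \<Rightarrow> bool" where
  "range_stable V q \<longleftrightarrow> (\<forall>x. \<exists>u. (V ^^ q) x = (V ^^ Suc q) u)"

lemma kernel_stable_add: "kernel_stable V p \<Longrightarrow> (V ^^ (p + k)) x = 0 \<Longrightarrow> (V ^^ p) x = 0"
proof (induction k arbitrary: x)
  case (Suc k)
  have "(V ^^ (p + k)) (V x) = 0" using Suc.prems(2) by (simp flip: funpow_Suc_right[THEN fun_cong, simplified])
  then have "(V ^^ p) (V x) = 0" using Suc by blast
  then have "(V ^^ Suc p) x = 0" by (simp add: funpow_swap1)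
  then show ?case using Suc.prems(1) by (simp add: kernel_stable_def)
qed simp

lemma range_stable_add: "range_stable V q \<Longrightarrow> \<exists>u. (V ^^ q) x = (V ^^ (q + k)) u"
proof (induction k)
  case (Suc k)
  then obtain u where u: "(V ^^ q) x = (V ^^ (q + k)) u" by blast
  obtain w where w: "(V ^^ q) u = (V ^^ Suc q) w" using Suc.prems by (auto simp: range_stable_def)
  have "(V ^^ (q + k)) u = (V ^^ k) ((V ^^ q) u)" by (simp add: add.commute funpow_add)
  also have "\<dots> = (V ^^ (k + Suc q)) w" unfolding w by (simp add: funpow_add funpow_swap1)
  finally show ?case using u by (auto simp: add.commute)
qed auto

lemma kernel_stable_mono: "kernel_stable V p \<Longrightarrow> p \<le> p' \<Longrightarrow> kernel_stable V p'"
proof -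
  assume p: "kernel_stable V p" and le: "p \<le> p'"
  have z: "(V ^^ k) x = 0" if x: "(V ^^ Suc k) x = 0" and k: "k \<ge> p" for k x
  proof -
    obtain d where d: "k = p + d" using k le_Suc_ex by blast
    have "(V ^^ Suc p) ((V ^^ d) x) = 0" using x unfolding d
      by (metis add_Suc comp_apply funpow_add)
    then have "(V ^^ p) ((V ^^ d) x) = 0" using p by (simp add: kernel_stable_def)
    then show ?thesis unfolding d by (simp add: funpow_add)
  qed
  show ?thesis using z le by (simp add: kernel_stable_def del: funpow.simps)
qed

lemma range_stable_mono: "range_stable V q \<Longrightarrow> q \<le> q' \<Longrightarrow> range_stable V q'"
proof -
  assume q: "range_stable V q" and le: "q \<le> q'"
  then obtain d where d: "q' = d + q" by (metis add.commute le_Suc_ex)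
  have "\<exists>u. (V ^^ q') x = (V ^^ Suc q') u" for x
  proof -
    obtain u where "(V ^^ q) x = (V ^^ Suc q) u" using q by (auto simp: range_stable_def)
    then have "(V ^^ d) ((V ^^ q) x) = (V ^^ d) ((V ^^ Suc q) u)" by simp
    then show ?thesis unfolding d by (metis add_Suc_right comp_apply funpow_add)
  qed
  then show ?thesis by (simp add: range_stable_def)
qed

text \<open>This and the next lemma say that ascent and descent agree as soon as both are finite.\<close>

lemma kernel_stable_if_range_stable:
  assumes V: "lin V" and p: "kernel_stable V p" and q: "range_stable V q"
  shows "kernel_stable V q"
  unfolding kernel_stable_def
proof (intro allI impI)
  fix x assume x: "(V ^^ Suc q) x = 0"
  obtain u where u: "(V ^^ q) x = (V ^^ (q + p)) u" using range_stable_add[OF q] by blast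
  have "(V ^^ (p + Suc q)) u = V ((V ^^ (q + p)) u)" by (simp add: add.commute)
  also have "\<dots> = 0" using x by (simp add: u)
  finally have "(V ^^ p) u = 0" by (rule kernel_stable_add[OF p])
  then show "(V ^^ q) x = 0" unfolding u by (simp add: funpow_add lin_zero[OF lin_funpow[OF V]])
qed

lemma range_stable_if_kernel_stable:
  assumes V: "lin V" and p: "kernel_stable V p" and q: "range_stable V q"
  shows "range_stable V p"
  unfolding range_stable_def
proof
  fix x
  obtain u where u: "(V ^^ q) x = (V ^^ Suc q) u" using q by (auto simp: range_stable_def)
  have "(V ^^ q) (x - V u) = 0"
    using u by (simp add: lin_diff[OF lin_funpow[OF V]] funpow_swap1)
  then have "(V ^^ (p + q)) (x - V u) = 0" by (simp add: funpow_add lin_zero[OF lin_funpow[OF V]])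
  then have "(V ^^ p) (x - V u) = 0" by (rule kernel_stable_add[OF p])
  then have "(V ^^ p) x = (V ^^ Suc p) u"
    by (simp add: lin_diff[OF lin_funpow[OF V]] funpow_swap1)
  then show "\<exists>u. (V ^^ p) x = (V ^^ Suc p) u" by blast
qed

lemma projection_with_kernel:
  assumes W: "csubspace W"
  obtains Q where "lin Q" "\<And>x. Q x = 0 \<longleftrightarrow> x \<in> W" "\<And>x. Q (Q x) = Q x"
proof -
  obtain g where g: "lin g" "range g \<subseteq> W" "\<And>v. v \<in> W \<Longrightarrow> g v = v"
    using left_inverse_on[OF lin_id W] by (metis inj_on_id2)
  let ?Q = "\<lambda>x. x - g x"
  have mem: "g x \<in> W" for x using g(2) by blast
  show thesis
  proof (rule that)
    show "lin ?Q" by (intro lin_minus lin_id g(1))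
    show "?Q x = 0 \<longleftrightarrow> x \<in> W" for x using g(3)[of x] mem[of x] by auto
    show "?Q (?Q x) = ?Q x" for x by (simp add: lin_diff[OF g(1)] g(3)[OF mem])
  qed
qed

text \<open>Passing to the quotient by \<open>W\<close> is injective on \<open>N\<close>; a linear left inverse of that restriction gives
  the projection.\<close>

lemma projection_killing:
  assumes N: "csubspace N" and W: "csubspace W" and disj: "N \<inter> W \<subseteq> {0}"
  obtains P where "lin P" "range P \<subseteq> N" "\<And>x. x \<in> N \<Longrightarrow> P x = x" "\<And>x. x \<in> W \<Longrightarrow> P x = 0"
proof -
  obtain Q where Q: "lin Q" "\<And>x. Q x = 0 \<longleftrightarrow> x \<in> W" using projection_with_kernel[OF W] by metis
  have "inj_on Q N"
  proof (rule inj_onI)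
    fix x y assume *: "x \<in> N" "y \<in> N" "Q x = Q y"
    then have "Q (x - y) = 0" by (simp add: lin_diff[OF Q(1)])
    moreover have "x - y \<in> N" using * N by (simp add: complex_vector.subspace_diff)
    ultimately show "x = y" using disj Q(2) by auto
  qed
  then obtain g where g: "lin g" "range g \<subseteq> N" "\<And>v. v \<in> N \<Longrightarrow> g (Q v) = v"
    using left_inverse_on[OF Q(1) N] by metis
  show thesis
  proof (rule that[of "\<lambda>x. g (Q x)"])
    show "lin (\<lambda>x. g (Q x))" by (rule lin_compose[OF g(1) Q(1)])
    show "range (\<lambda>x. g (Q x)) \<subseteq> N" using g(2) by auto
    show "g (Q x) = x" if "x \<in> N" for x using g(3) that .
    show "g (Q x) = 0" if "x \<in> W" for x using Q(2)[of x] that lin_zero[OF g(1)] by simp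
  qed
qed

lemma finite_nullity_perturb_injective:
  assumes A: "lin A" "inj A" and F: "fin_rank F"
  shows "finite_cdim {x. A x + F x = 0}"
proof (rule fin_dim_inj_image[OF A(1)])
  have AF: "lin (\<lambda>x. A x + F x)" using A F by (auto intro: lin_plus simp: fin_rank_def)
  show "csubspace {x. A x + F x = 0}" by (rule subspace_kernel[OF AF])
  show "inj_on A {x. A x + F x = 0}" using A(2) by (rule inj_on_subset) simp
  have "A ` {x. A x + F x = 0} \<subseteq> range (\<lambda>x. - F x)"
    by (auto simp: image_iff eq_neg_iff_add_eq_0)
  then show "finite_cdim (A ` {x. A x + F x = 0})"
    using fin_rank_neg[OF F] by (auto simp: fin_rank_def intro: fin_dim_subset)
qed

text \<open>Let \<open>V = A + F\<close> and \<open>R = R(V\<^sup>q)\<close>, so that \<open>V R = R\<close>. Range stability gives \<open>X = R + N(V\<^sup>q)\<close>, and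
  \<open>N(V\<^sup>q)\<close> has finite dimension because \<open>V\<^sup>q\<close> is a finite rank perturbation of the injective \<open>A\<^sup>q\<close>. So
  \<open>R\<close> has finite codimension. If \<open>Q\<close> is a projection with kernel \<open>R\<close>, then \<open>V (I - Q) + Q\<close> is a
  finite rank perturbation of \<open>A\<close>, and it is surjective since it maps \<open>R\<close> onto \<open>R\<close> and fixes the
  complement \<open>R(Q)\<close>.\<close>

lemma perturb_injective_range_stable:
  assumes A: "lin A" "inj A" and F: "fin_rank F" and q: "range_stable (\<lambda>x. A x + F x) q"
  shows "surj A" "kernel_stable (\<lambda>x. A x + F x) q"
proof -
  let ?V = "\<lambda>x. A x + F x"
  let ?R = "range (?V ^^ q)"
  have V: "lin ?V" using A F by (auto intro: lin_plus simp: fin_rank_def)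
  have Vn: "lin (?V ^^ n)" for n by (rule lin_funpow[OF V])
  obtain G where G: "fin_rank G" "(?V ^^ q) = (\<lambda>x. (A ^^ q) x + G x)"
    using fin_rank_perturb_funpow[OF A(1) F] by blast
  have finN: "finite_cdim {x. (?V ^^ q) x = 0}"
    unfolding G(2) by (rule finite_nullity_perturb_injective[OF lin_funpow[OF A(1)] inj_fn[OF A(2)] G(1)])
  have R: "csubspace ?R" by (rule subspace_lin_image[OF Vn]) simp
  obtain Q where Q: "lin Q" "\<And>x. Q x = 0 \<longleftrightarrow> x \<in> ?R" "\<And>x. Q (Q x) = Q x"
    using projection_with_kernel[OF R] by metis
  have "range Q \<subseteq> Q ` {x. (?V ^^ q) x = 0}"
  proof
    fix y assume "y \<in> range Q"
    then obtain x where x: "y = Q x" by blast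
    obtain u where u: "(?V ^^ q) x = (?V ^^ (q + q)) u" using range_stable_add[OF q] by blast
    then have "(?V ^^ q) (x - (?V ^^ q) u) = 0" by (simp add: lin_diff[OF Vn] funpow_add)
    moreover have "Q (x - (?V ^^ q) u) = y" using Q(2)[of "(?V ^^ q) u"] by (simp add: lin_diff[OF Q(1)] x)
    ultimately show "y \<in> Q ` {x. (?V ^^ q) x = 0}" by blast
  qed
  then have Qfin: "fin_rank Q"
    using Q(1) fin_dim_image[OF Q(1) finN] by (auto simp: fin_rank_def intro: fin_dim_subset)
  let ?P = "\<lambda>x. ?V (x - Q x) + Q x"
  have P: "lin ?P" by (intro lin_plus lin_compose[OF V] lin_minus lin_id Q(1))
  have "?P x - A x = F x + (Q x - ?V (Q x))" for x by (simp add: lin_diff[OF V])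
  moreover have "fin_rank (\<lambda>x. F x + (Q x - ?V (Q x)))"
    by (intro fin_rank_plus[OF F] fin_rank_minus[OF Qfin] fin_rank_left[OF V Qfin])
  ultimately have D: "fin_rank (\<lambda>x. ?P x - A x)" by (simp only:)
  have "\<exists>x. ?P x = y" for y
  proof -
    have "Q (y - Q y) = 0" by (simp add: lin_diff[OF Q(1)] Q(3))
    then obtain x where "y - Q y = (?V ^^ q) x" using Q(2) by blast
    then obtain u where u: "y - Q y = ?V ((?V ^^ q) u)" using q by (force simp: range_stable_def)
    have "Q ((?V ^^ q) u) = 0" using Q(2) by blast
    then have "?P ((?V ^^ q) u + Q y) = ?V ((?V ^^ q) u) + Q y"
      by (simp only: lin_add[OF Q(1)] Q(3)) simp
    also have "\<dots> = y" by (simp flip: u)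
    finally show ?thesis by blast
  qed
  then have "surj ?P" unfolding surj_def by metis
  note Z = inj_surj_fin_rank_apart[OF A P this D]
  show "surj A" by (rule Z(1))
  show "kernel_stable ?V q"
    unfolding kernel_stable_def
  proof (intro allI impI)
    fix x assume "(?V ^^ Suc q) x = 0"
    moreover have "Q ((?V ^^ q) x) = 0" using Q(2) by blast
    ultimately have "?P ((?V ^^ q) x) = ?P 0" by (simp add: lin_zero[OF Q(1)] lin_zero[OF V, simplified])
    then show "(?V ^^ q) x = 0" by (rule injD[OF Z(2)])
  qed
qed

text \<open>Dual to the previous lemma. Let \<open>V = A + F\<close> and \<open>N = N(V\<^sup>p)\<close>. Kernel stability gives
  \<open>N \<inter> R(V\<^sup>p) = 0\<close>, and \<open>R(V\<^sup>p)\<close> has finite codimension because \<open>A\<^sup>p\<close> is surjective. So \<open>N\<close> has finite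
  dimension. If \<open>P\<close> is a projection onto \<open>N\<close>, then \<open>P + (I - P) V\<close> is a finite rank perturbation of
  \<open>A\<close>, and it is injective since \<open>V x \<in> N\<close> forces \<open>x \<in> N\<close>.\<close>

lemma perturb_surjective_kernel_stable:
  assumes A: "lin A" "surj A" and F: "fin_rank F" and p: "kernel_stable (\<lambda>x. A x + F x) p"
  shows "inj A" "range_stable (\<lambda>x. A x + F x) p"
proof -
  let ?V = "\<lambda>x. A x + F x"
  let ?N = "{x. (?V ^^ p) x = 0}"
  have V: "lin ?V" using A F by (auto intro: lin_plus simp: fin_rank_def)
  have Vn: "lin (?V ^^ n)" for n by (rule lin_funpow[OF V])
  obtain G where G: "fin_rank G" "(?V ^^ p) = (\<lambda>x. (A ^^ p) x + G x)"
    using fin_rank_perturb_funpow[OF A(1) F] by blast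
  have N: "csubspace ?N" by (rule subspace_kernel[OF Vn])
  have R: "csubspace (range (?V ^^ p))" by (rule subspace_lin_image[OF Vn]) simp
  have disj: "?N \<inter> range (?V ^^ p) \<subseteq> {0}"
  proof
    fix y assume "y \<in> ?N \<inter> range (?V ^^ p)"
    then obtain x where x: "y = (?V ^^ p) x" "(?V ^^ p) y = 0" by blast
    then have "(?V ^^ (p + p)) x = 0" by (simp add: funpow_add)
    then show "y \<in> {0}" using kernel_stable_add[OF p] x(1) by simp
  qed
  obtain P where P: "lin P" "range P \<subseteq> ?N" "\<And>x. x \<in> ?N \<Longrightarrow> P x = x" "\<And>x. x \<in> range (?V ^^ p) \<Longrightarrow> P x = 0"
    by (rule projection_killing[OF N R disj], rule that)
  have "range P \<subseteq> P ` range (\<lambda>x. - G x)"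
  proof
    fix y assume "y \<in> range P"
    then obtain x where x: "y = P x" by blast
    obtain u where u: "x = (A ^^ p) u" using surj_fn[OF A(2)] by (metis surjD)
    have "x = (?V ^^ p) u + - G u" by (simp add: u G(2))
    then have "P x = P (- G u)" by (simp only: lin_add[OF P(1)] P(4)[OF rangeI]) simp
    then show "y \<in> P ` range (\<lambda>x. - G x)" using x by blast
  qed
  then have Pfin: "fin_rank P"
    using P(1) fin_dim_image[OF P(1), of "range (\<lambda>x. - G x)"] fin_rank_neg[OF G(1)]
    by (auto simp: fin_rank_def intro: fin_dim_subset)
  let ?S = "\<lambda>x. P x + (?V x - P (?V x))"
  have S: "lin ?S" by (intro lin_plus lin_minus P(1) lin_compose[OF P(1)] V)
  have "A x - ?S x = P (?V x) - (P x + F x)" for x by simp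
  moreover have "fin_rank (\<lambda>x. P (?V x) - (P x + F x))"
    by (intro fin_rank_minus fin_rank_plus Pfin F fin_rank_right[OF V Pfin])
  ultimately have D: "fin_rank (\<lambda>x. A x - ?S x)" by (simp only:)
  have "inj ?S"
  proof -
    have "x = 0" if "?S x = 0" for x
    proof -
      have PP: "P (P x) = P x" for x using P(2,3) by blast
      have "P x = P (?S x)" by (simp add: lin_add[OF P(1)] lin_diff[OF P(1)] PP)
      also have "\<dots> = 0" using that lin_zero[OF P(1)] by simp
      finally have Px: "P x = 0" .
      then have "?V x = P (?V x)" using that by simp
      then have "?V x \<in> ?N" using P(2) by (metis rangeI subsetD)
      then have "(?V ^^ Suc p) x = 0" unfolding funpow_Suc_right o_apply by blast
      then have "x \<in> ?N" using p by (simp add: kernel_stable_def)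
      then show "x = 0" using P(3) Px by metis
    qed
    then show ?thesis
      by (intro injI) (metis (no_types, lifting) S lin_diff right_minus_eq)
  qed
  note Z = inj_surj_fin_rank_apart[OF S this A D]
  show "inj A" by (rule Z(2))
  show "range_stable ?V p"
    unfolding range_stable_def
  proof
    fix y
    obtain x where x: "y = ?S x" using surjD[OF Z(1), of y] by (rule exE)
    have "P x - P (?V x) \<in> ?N"
      using P(2) by (intro complex_vector.subspace_diff[OF N]) auto
    then have "(?V ^^ p) y = (?V ^^ p) (?V x)" 
      unfolding x by (simp add: lin_add[OF Vn] lin_diff[OF Vn])
    then show "\<exists>u. (?V ^^ p) y = (?V ^^ Suc p) u" unfolding funpow_Suc_right o_apply by blast
  qed
qed

section \<open>The open mapping theorem\<close>

text \<open>The Baire category argument: \<open>T Z\<close> is complete and is the union of the closures of the images of the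
  balls of radius \<open>n\<close> in \<open>Z\<close>, so one of these closures contains a ball of \<open>T Z\<close>. Differences of points in
  it reach every small \<open>w\<close> up to an arbitrarily small error.\<close>

lemma approximate_preimages:
  fixes T :: "'a :: banach \<Rightarrow> 'b :: banach"
  assumes T: "bounded_linear T" and Z: "subspace Z" and W: "closed (T ` Z)"
  obtains K where "K > 0"
    "\<And>w. w \<in> T ` Z \<Longrightarrow> \<exists>z\<in>Z. norm z \<le> K * norm w \<and> norm (w - T z) \<le> norm w / 2"
proof -
  interpret T: bounded_linear T by fact
  let ?W = "T ` Z"
  have subW: "subspace ?W" using T.linear Z by (rule linear_subspace_image)
  define A where "A n = closure (T ` (Z \<inter> cball 0 (real n)))" for n
  have "\<exists>n. top_of_set ?W interior_of (?W \<inter> A n) \<noteq> {}"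
  proof (rule ccontr)
    assume no: "\<not> ?thesis"
    have "top_of_set ?W interior_of (\<Union> (range (\<lambda>n. ?W \<inter> A n))) = {}"
    proof (rule Baire_category_alt)
      show "completely_metrizable_space (top_of_set ?W) \<or>
          locally_compact_space (top_of_set ?W) \<and> regular_space (top_of_set ?W)"
        using W closed_closedin completely_metrizable_space_closedin
          completely_metrizable_space_euclidean by blast
      fix U assume "U \<in> range (\<lambda>n. ?W \<inter> A n)"
      then obtain n where U: "U = ?W \<inter> A n" by blast
      have "closedin (top_of_set ?W) U"
        unfolding U A_def by (intro closedin_closed_Int) simp
      then show "closedin (top_of_set ?W) U \<and> top_of_set ?W interior_of U = {}"
        using no U by simp
    qed simp
    moreover have "\<Union> (range (\<lambda>n. ?W \<inter> A n)) = ?W"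
    proof -
      have "\<exists>n. T z \<in> A n" if "z \<in> Z" for z
      proof -
        obtain n where "norm z \<le> real n" using real_arch_simple by blast
        then have "T z \<in> T ` (Z \<inter> cball 0 (real n))" using that by simp
        then have "T z \<in> A n" unfolding A_def by (rule closure_subset[THEN subsetD])
        then show ?thesis by blast
      qed
      then show ?thesis by fastforce
    qed
    moreover have "top_of_set ?W interior_of ?W = ?W"
      using interior_of_topspace[of "top_of_set ?W"] by simp
    ultimately have "?W = {}" by simp
    then show False using subspace_0[OF Z] by blast
  qed
  then obtain n w0 where "w0 \<in> top_of_set ?W interior_of (?W \<inter> A n)" by blast
  then obtain U where U: "openin (top_of_set ?W) U" "w0 \<in> U" "U \<subseteq> ?W \<inter> A n"
    by (auto simp: interior_of_def)
  then obtain r where r: "r > 0" "ball w0 r \<inter> ?W \<subseteq> A n"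
    unfolding openin_contains_ball by blast
  have w0: "w0 \<in> ?W" using U by blast
  have near: "\<exists>z\<in>Z. norm z \<le> 2 * real n \<and> norm (w - T z) < e"
    if w: "w \<in> ?W" "norm w < r" and e: "e > 0" for w e
  proof -
    have "w0 + w \<in> ball w0 r \<inter> ?W" "w0 \<in> ball w0 r \<inter> ?W"
      using w w0 r(1) subW by (auto simp: dist_norm subspace_add)
    then have "w0 + w \<in> A n" "w0 \<in> A n" using r(2) by blast+
    moreover have "\<exists>z\<in>Z. norm z \<le> real n \<and> dist (T z) v < e / 2" if "v \<in> A n" for v
    proof -
      have "\<exists>y\<in>T ` (Z \<inter> cball 0 (real n)). dist y v < e / 2"
        using that e by (simp only: A_def closure_approachable half_gt_zero)
      then show ?thesis by auto
    qed
    ultimately obtain z1 z2 where z: "z1 \<in> Z" "norm z1 \<le> real n" "dist (T z1) (w0 + w) < e / 2"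
        "z2 \<in> Z" "norm z2 \<le> real n" "dist (T z2) w0 < e / 2"
      by metis
    have "norm (z1 - z2) \<le> 2 * real n" using norm_triangle_ineq4[of z1 z2] z by linarith
    moreover have "norm (w - T (z1 - z2)) < e"
    proof -
      have "w - T (z1 - z2) = (w0 + w - T z1) - (w0 - T z2)" by (simp add: T.diff)
      then have "norm (w - T (z1 - z2)) \<le> dist (w0 + w) (T z1) + dist w0 (T z2)"
        by (simp only: dist_norm norm_triangle_ineq4)
      then show ?thesis using z(3,6) by (simp add: dist_commute)
    qed
    moreover have "z1 - z2 \<in> Z" using z Z by (simp add: subspace_diff)
    ultimately show ?thesis by blast
  qed
  \<comment> \<open>The summand \<open>1\<close> keeps \<open>K\<close> positive if \<open>n = 0\<close>.\<close>
  define K where "K = 4 * real n / r + 1"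
  show thesis
  proof (rule that)
    show "K > 0" unfolding K_def using r(1) by (simp add: add_nonneg_pos)
    fix w assume w: "w \<in> ?W"
    show "\<exists>z\<in>Z. norm z \<le> K * norm w \<and> norm (w - T z) \<le> norm w / 2"
    proof (cases "w = 0")
      case True
      then show ?thesis using subspace_0[OF Z] by (intro bexI[of _ 0]) (auto simp: T.zero)
    next
      case False
      \<comment> \<open>Rescaling to norm \<open>r / 2\<close> brings \<open>w\<close> into the range of \<open>near\<close>.\<close>
      define c where "c = r / (2 * norm w)"
      have c: "c > 0" using False r(1) by (simp add: c_def)
      have "norm (c *\<^sub>R w) < r" using False r(1) by (simp add: c_def)
      moreover have "c *\<^sub>R w \<in> ?W" using w subW by (simp add: subspace_scale)
      moreover have "r / 4 > 0" using r(1) by simp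
      ultimately obtain z where z: "z \<in> Z" "norm z \<le> 2 * real n" "norm (c *\<^sub>R w - T z) < r / 4"
        using near by blast
      have "norm ((1 / c) *\<^sub>R z) \<le> (1 / c) * (2 * real n)" using z(2) c by (simp add: divide_right_mono)
      also have "\<dots> = (4 * real n / r) * norm w" using r(1) False by (simp add: c_def)
      also have "\<dots> \<le> K * norm w" by (intro mult_right_mono) (simp_all add: K_def)
      finally have 1: "norm ((1 / c) *\<^sub>R z) \<le> K * norm w" .
      have "w - T ((1 / c) *\<^sub>R z) = (1 / c) *\<^sub>R (c *\<^sub>R w - T z)"
        using c by (simp add: T.scaleR scaleR_right_diff_distrib)
      then have "norm (w - T ((1 / c) *\<^sub>R z)) = (1 / c) * norm (c *\<^sub>R w - T z)" using c by simp
      also have "\<dots> \<le> (1 / c) * (r / 4)" using z(3) c by (intro mult_left_mono) auto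
      also have "\<dots> = norm w / 2" using r(1) False by (simp add: c_def)
      finally have "norm (w - T ((1 / c) *\<^sub>R z)) \<le> norm w / 2" .
      then show ?thesis using 1 z(1) Z by (intro bexI[of _ "(1 / c) *\<^sub>R z"]) (auto simp: subspace_scale)
    qed
  qed
qed

text \<open>The open mapping theorem for the restriction of \<open>T\<close> to a closed subspace: the errors of successive
  approximate preimages halve, so their sum converges to an exact preimage.\<close>

lemma bounded_preimages:
  fixes T :: "'a :: banach \<Rightarrow> 'b :: banach"
  assumes T: "bounded_linear T" and Z: "subspace Z" "closed Z" and W: "closed (T ` Z)"
  obtains C where "C > 0" "\<And>w. w \<in> T ` Z \<Longrightarrow> \<exists>z\<in>Z. T z = w \<and> norm z \<le> C * norm w"
proof -
  interpret T: bounded_linear T by fact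
  let ?W = "T ` Z"
  have subW: "subspace ?W" using T.linear Z(1) by (rule linear_subspace_image)
  obtain K where K: "K > 0"
    "\<And>w. w \<in> ?W \<Longrightarrow> \<exists>z\<in>Z. norm z \<le> K * norm w \<and> norm (w - T z) \<le> norm w / 2"
    using approximate_preimages[OF T Z(1) W] by metis
  then have "\<forall>w\<in>?W. \<exists>z. z \<in> Z \<and> norm z \<le> K * norm w \<and> norm (w - T z) \<le> norm w / 2" by blast
  then obtain h where h: "\<And>w. w \<in> ?W \<Longrightarrow> h w \<in> Z" "\<And>w. w \<in> ?W \<Longrightarrow> norm (h w) \<le> K * norm w"
      "\<And>w. w \<in> ?W \<Longrightarrow> norm (w - T (h w)) \<le> norm w / 2"
    by metis
  show thesis
  proof (rule that[of "2 * K"])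
    show "2 * K > 0" using K(1) by simp
    fix w assume w: "w \<in> ?W"
    define r where "r k = ((\<lambda>v. v - T (h v)) ^^ k) w" for k
    have rSuc: "r (Suc k) = r k - T (h (r k))" for k by (simp add: r_def)
    have rW: "r k \<in> ?W" for k
    proof (induction k)
      case (Suc k)
      then show ?case unfolding rSuc using h(1) subW by (intro subspace_diff) auto
    qed (simp add: r_def w)
    have rn: "norm (r k) \<le> (1/2) ^ k * norm w" for k
    proof (induction k)
      case (Suc k)
      then show ?case using h(3)[OF rW, of k] by (simp add: rSuc)
    qed (simp add: r_def)
    have hn: "norm (h (r k)) \<le> K * norm w * (1/2) ^ k" for k
    proof -
      have "norm (h (r k)) \<le> K * norm (r k)" by (rule h(2)[OF rW])
      also have "\<dots> \<le> K * ((1/2) ^ k * norm w)" using rn K(1) by (intro mult_left_mono) auto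
      finally show ?thesis by (simp add: mult_ac)
    qed
    have geo: "summable (\<lambda>k. K * norm w * (1/2) ^ k)" by (intro summable_mult summable_geometric) simp
    have sn: "summable (\<lambda>k. norm (h (r k)))"
      by (rule summable_comparison_test[OF _ geo]) (use hn in auto)
    then have s: "summable (\<lambda>k. h (r k))" by (rule summable_norm_cancel)
    let ?z = "\<Sum>k. h (r k)"
    have lim: "(\<lambda>n. \<Sum>k<n. h (r k)) \<longlonglongrightarrow> ?z" using s by (rule summable_LIMSEQ)
    have "\<forall>n. (\<Sum>k<n. h (r k)) \<in> Z" using h(1)[OF rW] Z(1) by (intro allI subspace_sum) auto
    then have "?z \<in> Z" using lim Z(2) by (metis closed_sequentially)
    moreover have "T ?z = w"
    proof -
      have "(\<lambda>k. T (h (r k))) sums T ?z" using s by (intro T.sums summable_sums)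
      then have "(\<lambda>k. r k - r (Suc k)) sums T ?z" by (simp add: rSuc)
      moreover have "r \<longlonglongrightarrow> 0"
      proof (rule Lim_null_comparison)
        show "\<forall>\<^sub>F k in sequentially. norm (r k) \<le> (1/2) ^ k * norm w" using rn by simp
        show "(\<lambda>k. (1/2) ^ k * norm w) \<longlonglongrightarrow> 0"
          by (intro tendsto_mult_left_zero LIMSEQ_realpow_zero) auto
      qed
      then have "(\<lambda>k. r k - r (Suc k)) sums (r 0 - 0)" by (rule telescope_sums')
      ultimately show ?thesis using sums_unique2 by (fastforce simp: r_def)
    qed
    moreover have "norm ?z \<le> 2 * K * norm w"
    proof -
      have "norm ?z \<le> (\<Sum>k. norm (h (r k)))" by (rule summable_norm[OF sn])
      also have "\<dots> \<le> (\<Sum>k. K * norm w * (1/2) ^ k)" by (rule suminf_le[OF _ sn geo]) (rule hn)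
      also have "\<dots> = 2 * K * norm w" by (simp add: suminf_mult suminf_geometric)
      finally show ?thesis .
    qed
    ultimately show "\<exists>z\<in>Z. T z = w \<and> norm z \<le> 2 * K * norm w" by blast
  qed
qed

text \<open>An operator range with a closed algebraic complement \<open>E\<close> is closed. Lift \<open>s\<^sub>n - y\<close>, which tends to
  \<open>0\<close>, through the surjection \<open>(x, e) \<mapsto> T x + e\<close>: the \<open>E\<close>-component of the lift tends to \<open>0\<close>, but it is minus
  the \<open>E\<close>-component of \<open>y\<close> for every \<open>n\<close>.\<close>

lemma complemented_range_closed:
  fixes T :: "'a :: banach \<Rightarrow> 'a"
  assumes T: "bounded_linear T" and E: "subspace E" "closed E"
    and disj: "range T \<inter> E \<subseteq> {0}" and sum: "\<And>y. \<exists>x. \<exists>e\<in>E. y = T x + e"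
  shows "closed (range T)"
proof -
  interpret T: bounded_linear T by fact
  let ?\<Phi> = "\<lambda>(x, e). T x + e"
  let ?Z = "UNIV \<times> E"
  have P: "bounded_linear ?\<Phi>"
    unfolding case_prod_beta
    by (intro bounded_linear_add bounded_linear_compose[OF T] bounded_linear_fst bounded_linear_snd)
  have Z: "subspace ?Z" "closed ?Z" using E by (simp_all add: subspace_Times closed_Times)
  have img: "?\<Phi> ` ?Z = UNIV" using sum by (force simp: image_iff)
  \<comment> \<open>The open mapping theorem lifts null sequences to null sequences.\<close>
  obtain C where C: "\<And>w. \<exists>z\<in>?Z. ?\<Phi> z = w \<and> norm z \<le> C * norm w"
    using bounded_preimages[OF P Z] unfolding img by (metis UNIV_I closed_UNIV)
  show ?thesis
  proof (rule closed_sequential_limits[THEN iffD2], intro allI impI)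
    fix s y assume "(\<forall>n. s n \<in> range T) \<and> s \<longlonglongrightarrow> y"
    then have s: "\<And>n. s n \<in> range T" "s \<longlonglongrightarrow> y" by auto
    obtain x e where y: "e \<in> E" "y = T x + e" using sum by metis
    have "norm e \<le> C * norm (s n - y)" for n
    proof -
      obtain u v where uv: "v \<in> E" "T u + v = s n - y" "norm (u, v) \<le> C * norm (s n - y)"
        using C[of "s n - y"] by auto
      obtain t where t: "s n = T t" using s(1) by blast
      have "T (t - x - u) = e + v" using uv(2) y(2) t by (simp add: T.diff T.add algebra_simps)
      moreover have "e + v \<in> E" using E(1) y(1) uv(1) by (rule subspace_add)
      ultimately have "e + v = 0" using disj by (metis IntI rangeI singletonD subsetD)
      then have "norm e = norm v" by (metis add_eq_0_iff norm_minus_cancel)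
      then show ?thesis using uv(3) norm_snd_le[of v u] by simp
    qed
    moreover have "(\<lambda>n. C * norm (s n - y)) \<longlonglongrightarrow> 0"
      using s(2) by (intro tendsto_mult_right_zero tendsto_norm_zero) (simp add: LIM_zero)
    ultimately have "norm e \<le> 0" by (meson LIMSEQ_le_const)
    then show "y \<in> range T" using y by simp
  qed
qed

section \<open>The Hahn-Banach theorem\<close>

text \<open>The Hahn-Banach theorem is proved by finding a minimal sublinear functional below the norm: such a
  functional is linear. In contrast to extending linear functionals step by step, all functionals
  involved are defined on the whole space.\<close>

definition sublinear :: "('a :: real_normed_vector \<Rightarrow> real) \<Rightarrow> bool" where
  "sublinear p \<longleftrightarrow> (\<forall>x y. p (x + y) \<le> p x + p y) \<and> (\<forall>c x. c > 0 \<longrightarrow> p (c *\<^sub>R x) \<le> c * p x)"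

lemma sublinear_zero: assumes "sublinear p" shows "p 0 = 0"
proof -
  have "p 0 \<le> (1/2) * p 0" "p 0 \<le> 2 * p 0"
    using assms[unfolded sublinear_def] by (metis half_gt_zero_iff scale_zero_right zero_less_one, metis scale_zero_right zero_less_numeral)
  then show ?thesis by linarith
qed

lemma sublinear_scale:
  assumes p: "sublinear p" and c: "c \<ge> 0" shows "p (c *\<^sub>R x) = c * p x"
proof (cases "c = 0")
  case False
  then have c: "c > 0" using c by simp
  have le: "p (b *\<^sub>R y) \<le> b * p y" if "b > 0" for b y using p that by (simp add: sublinear_def)
  have "p ((1/c) *\<^sub>R (c *\<^sub>R x)) \<le> (1/c) * p (c *\<^sub>R x)" using c by (intro le) simp
  then have "c * p x \<le> p (c *\<^sub>R x)" using c by (simp add: field_simps)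
  then show ?thesis using le[OF c, of x] by simp
qed (simp add: sublinear_zero[OF p])

text \<open>The functional \<open>q(x) = inf\<^bsub>t \<ge> 0\<^esub> (p(x + t a) - t p(a))\<close> is the largest sublinear one below \<open>p\<close> that
  satisfies the last inequality, which is half of additivity in the direction \<open>a\<close>. A minimal \<open>p\<close>
  must coincide with it.\<close>

lemma sublinear_shear:
  assumes p: "sublinear p"
  obtains q where "sublinear q" "\<And>x. q x \<le> p x" "\<And>x. q x \<le> p (x + a) - p a"
proof -
  have add: "p (x + y) \<le> p x + p y" for x y using p by (simp add: sublinear_def)
  define q where "q x = (INF t\<in>{0..}. p (x + t *\<^sub>R a) - t * p a)" for x
  have bdd: "bdd_below ((\<lambda>t. p (x + t *\<^sub>R a) - t * p a) ` {0..})" for x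
  proof (rule bdd_belowI2)
    fix t :: real assume "t \<in> {0..}"
    then have "t * p a = p (t *\<^sub>R a)" using sublinear_scale[OF p] by simp
    also have "\<dots> \<le> p (x + t *\<^sub>R a) + p (- x)" using add[of "x + t *\<^sub>R a" "- x"] by simp
    finally show "- p (- x) \<le> p (x + t *\<^sub>R a) - t * p a" by simp
  qed
  have q_le: "q x \<le> p (x + t *\<^sub>R a) - t * p a" if "t \<ge> 0" for x t
    unfolding q_def by (rule cINF_lower[OF bdd]) (use that in simp)
  have q_ge: "m \<le> q x" if "\<And>t. t \<ge> 0 \<Longrightarrow> m \<le> p (x + t *\<^sub>R a) - t * p a" for m x
    unfolding q_def by (rule cINF_greatest) (use that in auto)
  show thesis
  proof (rule that)
    show "q x \<le> p x" for x using q_le[of 0 x] by simp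
    show "q x \<le> p (x + a) - p a" for x using q_le[of 1 x] by simp
    have "q (x + y) \<le> q x + q y" for x y
    proof -
      have 1: "q (x + y) - (p (y + s *\<^sub>R a) - s * p a) \<le> q x" if s: "s \<ge> 0" for s
      proof (rule q_ge)
        fix t :: real assume t: "t \<ge> 0"
        have "q (x + y) \<le> p (x + y + (t + s) *\<^sub>R a) - (t + s) * p a" using s t by (intro q_le) simp
        moreover have "x + y + (t + s) *\<^sub>R a = (x + t *\<^sub>R a) + (y + s *\<^sub>R a)"
          by (simp add: scaleR_left_distrib)
        moreover note add[of "x + t *\<^sub>R a" "y + s *\<^sub>R a"]
        ultimately show "q (x + y) - (p (y + s *\<^sub>R a) - s * p a) \<le> p (x + t *\<^sub>R a) - t * p a"
          by (simp add: distrib_right)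
      qed
      have "q (x + y) - q x \<le> q y"
      proof (rule q_ge)
        fix s :: real assume "s \<ge> 0"
        from 1[OF this] show "q (x + y) - q x \<le> p (y + s *\<^sub>R a) - s * p a" by linarith
      qed
      then show ?thesis by simp
    qed
    moreover have "q (c *\<^sub>R x) \<le> c * q x" if c: "c > 0" for c x
    proof -
      have "q (c *\<^sub>R x) / c \<le> q x"
      proof (rule q_ge)
        fix t :: real assume t: "t \<ge> 0"
        have "q (c *\<^sub>R x) \<le> p (c *\<^sub>R x + (c * t) *\<^sub>R a) - c * t * p a" using c t by (intro q_le) simp
        also have "c *\<^sub>R x + (c * t) *\<^sub>R a = c *\<^sub>R (x + t *\<^sub>R a)" by (simp add: scaleR_right_distrib)
        also have "p \<dots> = c * p (x + t *\<^sub>R a)" using c by (intro sublinear_scale[OF p]) simp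
        finally show "q (c *\<^sub>R x) / c \<le> p (x + t *\<^sub>R a) - t * p a" using c by (simp add: field_simps)
      qed
      then show ?thesis using c by (simp add: field_simps)
    qed
    ultimately show "sublinear q" by (simp add: sublinear_def)
  qed
qed

lemma sublinear_chain_Inf:
  fixes C :: "('a :: real_normed_vector \<Rightarrow> real) set"
  assumes ne: "C \<noteq> {}" and sub: "\<forall>f\<in>C. sublinear f"
    and bound: "\<forall>f\<in>C. \<forall>x. f x \<le> norm x"
    and chain: "\<forall>f\<in>C. \<forall>g\<in>C. f \<le> g \<or> g \<le> f"
  shows "sublinear (\<lambda>x. INF f\<in>C. f x)" "\<And>f x. f \<in> C \<Longrightarrow> (INF f\<in>C. f x) \<le> f x"
proof -
  have bdd: "bdd_below ((\<lambda>f. f x) ` C)" for x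
  proof (rule bdd_belowI2)
    fix f assume f: "f \<in> C"
    have "f (x + - x) \<le> f x + f (- x)" using sub[rule_format, OF f] unfolding sublinear_def by blast
    then show "- norm x \<le> f x" using bound[rule_format, OF f, of "- x"] sublinear_zero[OF sub[rule_format, OF f]] by simp
  qed
  show le: "(INF f\<in>C. f x) \<le> f x" if "f \<in> C" for f x
    by (rule cINF_lower[OF bdd that])
  have ge: "m \<le> (INF f\<in>C. f x)" if "\<And>f. f \<in> C \<Longrightarrow> m \<le> f x" for m x
    by (rule cINF_greatest[OF ne that])
  let ?u = "\<lambda>x. INF f\<in>C. f x"
  have "?u (x + y) \<le> ?u x + ?u y" for x y
  proof -
    have 1: "?u (x + y) \<le> f x + g y" if fg: "f \<in> C" "g \<in> C" for f g
    proof -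
      obtain h where h: "h \<in> C" "h \<le> f" "h \<le> g" using chain[rule_format, OF fg] fg by auto
      have "?u (x + y) \<le> h (x + y)" by (rule le[OF h(1)])
      also have "\<dots> \<le> h x + h y" using sub[rule_format, OF h(1)] by (simp add: sublinear_def)
      also have "\<dots> \<le> f x + g y" using h by (intro add_mono) (auto simp: le_fun_def)
      finally show ?thesis .
    qed
    have "?u (x + y) - g y \<le> ?u x" if g: "g \<in> C" for g
    proof (rule ge)
      fix f assume "f \<in> C"
      from 1[OF this g] show "?u (x + y) - g y \<le> f x" by linarith
    qed
    then have 2: "?u (x + y) - ?u x \<le> g y" if "g \<in> C" for g using that by (simp add: algebra_simps)
    have "?u (x + y) - ?u x \<le> ?u y" by (rule ge) (rule 2)
    then show ?thesis by simp
  qed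
  moreover have "?u (c *\<^sub>R x) \<le> c * ?u x" if c: "c > 0" for c x
  proof -
    have "?u (c *\<^sub>R x) / c \<le> ?u x"
    proof (rule ge)
      fix f assume f: "f \<in> C"
      have "?u (c *\<^sub>R x) \<le> f (c *\<^sub>R x)" by (rule le[OF f])
      also have "\<dots> \<le> c * f x" using sub[rule_format, OF f] c by (simp add: sublinear_def)
      finally show "?u (c *\<^sub>R x) / c \<le> f x" using c by (simp add: field_simps)
    qed
    then show ?thesis using c by (simp add: field_simps)
  qed
  ultimately show "sublinear ?u" by (simp add: sublinear_def)
qed

text \<open>The starting point below which Zorn's lemma is applied is the norm sheared along \<open>a\<close>; every
  linear functional below it takes the value \<open>norm a\<close> at \<open>a\<close>.\<close>

lemma norming_functional:
  fixes a :: "'a :: real_normed_vector"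
  obtains f where "bounded_linear f" "f a = norm a"
proof -
  have norm_sub: "sublinear (norm :: 'a \<Rightarrow> real)" by (auto simp: sublinear_def norm_triangle_ineq)
  obtain q0 where q0: "sublinear q0" "\<And>x. q0 x \<le> norm x" "\<And>x. q0 x \<le> norm (x + a) - norm a"
    using sublinear_shear[OF norm_sub, of a] by metis
  define S where "S = {p. sublinear p \<and> (\<forall>x. p x \<le> q0 x)}"
  have q0S: "q0 \<in> S" using q0(1) by (simp add: S_def)
  have Sn: "p x \<le> norm x" if "p \<in> S" for p x
    using that q0(2)[of x] unfolding S_def by (auto intro: order_trans)
  have "\<exists>m\<in>S. \<forall>p\<in>S. p \<le> m \<longrightarrow> p = m"
  proof (rule predicate_Zorn[of S "\<lambda>f g. g \<le> f"])
    show "partial_order_on S (relation_of (\<lambda>f g. g \<le> f) S)"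
      by (rule partial_order_on_relation_ofI) auto
    fix C assume C: "C \<in> Chains (relation_of (\<lambda>f g. g \<le> f) S)"
    then have CS: "C \<subseteq> S" and ch: "\<forall>f\<in>C. \<forall>g\<in>C. f \<le> g \<or> g \<le> f"
      by (auto simp: Chains_def relation_of_def)
    show "\<exists>u\<in>S. \<forall>f\<in>C. u \<le> f"
    proof (cases "C = {}")
      case True
      then show ?thesis using q0S by blast
    next
      case False
      have sub: "\<forall>f\<in>C. sublinear f" using CS by (auto simp: S_def)
      have bd: "\<forall>f\<in>C. \<forall>x. f x \<le> norm x" using CS Sn by blast
      note inf = sublinear_chain_Inf[OF False sub bd ch]
      obtain f0 where f0: "f0 \<in> C" using False by blast
      have "(INF f\<in>C. f x) \<le> q0 x" for x
        using inf(2)[OF f0, of x] f0 CS by (auto simp: S_def intro: order_trans)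
      then have "(\<lambda>x. INF f\<in>C. f x) \<in> S" using inf(1) by (simp add: S_def)
      moreover have "\<forall>f\<in>C. (\<lambda>x. INF f\<in>C. f x) \<le> f" using inf(2) by (simp add: le_fun_def)
      ultimately show ?thesis by blast
    qed
  qed
  then obtain f where f: "f \<in> S" and min: "\<And>p. p \<in> S \<Longrightarrow> p \<le> f \<Longrightarrow> p = f" by blast
  have sf: "sublinear f" using f by (simp add: S_def)
  have add: "f (x + y) = f x + f y" for x y
  proof -
    obtain q where q: "sublinear q" "\<And>x. q x \<le> f x" "\<And>x. q x \<le> f (x + y) - f y"
      using sublinear_shear[OF sf, of y] by metis
    have "q \<in> S" using q(1,2) f unfolding S_def by (auto intro: order_trans)
    then have "q = f" using q(2) by (intro min le_funI)
    then have "f x \<le> f (x + y) - f y" using q(3) by metis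
    moreover have "f (x + y) \<le> f x + f y" using sf by (simp add: sublinear_def)
    ultimately show ?thesis by simp
  qed
  have neg: "f (- x) = - f x" for x using add[of x "- x"] sublinear_zero[OF sf] by simp
  have scale: "f (c *\<^sub>R x) = c * f x" for c x
  proof (cases "c \<ge> 0")
    case False
    then have "f ((- c) *\<^sub>R x) = - c * f x" using sublinear_scale[OF sf, of "- c"] by simp
    then show ?thesis using neg[of "c *\<^sub>R x"] by simp
  qed (rule sublinear_scale[OF sf])
  have ub: "\<bar>f x\<bar> \<le> norm x" for x
    using Sn[OF f, of x] Sn[OF f, of "- x"] by (simp add: neg abs_le_iff)
  show thesis
  proof (rule that)
    show "bounded_linear f"
      by (rule bounded_linear_intro[of _ 1]) (simp_all add: add scale ub)
    have "f (- a) \<le> q0 (- a)" using f by (simp add: S_def)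
    also have "\<dots> \<le> - norm a" using q0(3)[of "- a"] by simp
    finally have "norm a \<le> f a" by (simp add: neg)
    then show "f a = norm a" using ub[of a] by simp
  qed
qed

text \<open>The usual complexification \<open>f(x) - i f(i x)\<close> of a real functional.\<close>

lemma complex_norming_functional:
  fixes a :: "'a :: complex_normed_vector"
  assumes "a \<noteq> 0"
  obtains h :: "'a \<Rightarrow> complex" where "bounded_linear h" "\<And>c x. h (c *\<^sub>C x) = c * h x" "h a = 1"
proof -
  obtain f where f: "bounded_linear f" "f a = norm a" using norming_functional by blast
  interpret f: bounded_linear f by fact
  have mi: "bounded_linear (\<lambda>x :: 'a. \<i> *\<^sub>C x)"
    by (rule bounded_linear_intro[of _ 1])
      (simp_all add: scaleC_add_right scaleR_scaleC scaleC_scaleC norm_scaleC mult.commute)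
  define h where "h x = complex_of_real (f x) - \<i> * complex_of_real (f (\<i> *\<^sub>C x))" for x
  have bh: "bounded_linear h" unfolding h_def
    by (intro bounded_linear_sub bounded_linear_const_mult bounded_linear_compose[OF bounded_linear_of_real]
        f(1) bounded_linear_compose[OF f(1) mi])
  have hc: "h (c *\<^sub>C x) = c * h x" for c x
  proof -
    have c: "c *\<^sub>C x = Re c *\<^sub>R x + Im c *\<^sub>R (\<i> *\<^sub>C x)"
      unfolding scaleR_scaleC scaleC_scaleC scaleC_add_left[symmetric]
      by (metis complex_eq mult.commute)
    have ic: "\<i> *\<^sub>C (c *\<^sub>C x) = Re c *\<^sub>R (\<i> *\<^sub>C x) - Im c *\<^sub>R x"
    proof -
      have "\<i> * c = complex_of_real (Re c) * \<i> - complex_of_real (Im c)" by (simp add: complex_eq_iff)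
      then show ?thesis unfolding scaleR_scaleC scaleC_scaleC complex_vector.scale_left_diff_distrib[symmetric] by simp
    qed
    show ?thesis unfolding h_def ic unfolding c
      by (simp add: f.add f.diff f.scaleR complex_eq_iff)
  qed
  have "Re (h a) = norm a" by (simp add: h_def f(2))
  then have ha: "h a \<noteq> 0" using assms by (metis norm_eq_zero zero_complex.sel(1))
  show thesis
  proof (rule that)
    show "bounded_linear (\<lambda>x. h x / h a)"
      by (intro bounded_linear_compose[OF bounded_linear_divide bh])
    show "h (c *\<^sub>C x) / h a = c * (h x / h a)" for c x by (simp add: hc)
    show "h a / h a = 1" using ha by simp
  qed
qed

section \<open>Bounded operators of finite rank and closed sums\<close>

lemma csubspace_subspace: "csubspace V \<Longrightarrow> subspace V"
  unfolding complex_vector.subspace_def subspace_def by (simp add: scaleR_scaleC)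

lemma bounded_clinearI:
  "bounded_linear T \<Longrightarrow> (\<And>c x. T (c *\<^sub>C x) = c *\<^sub>C T x) \<Longrightarrow> bounded_clinear T"
  by (simp add: bounded_clinear_def)

lemma bounded_clinear_lin: "bounded_clinear T \<Longrightarrow> lin T"
  unfolding bounded_clinear_def by (auto intro!: linI simp: linear_simps)

lemma bounded_clinear_bounded_linear: "bounded_clinear T \<Longrightarrow> bounded_linear T"
  by (simp add: bounded_clinear_def)

lemma bounded_clinear_plus:
  "bounded_clinear S \<Longrightarrow> bounded_clinear T \<Longrightarrow> bounded_clinear (\<lambda>x. S x + T x)"
  unfolding bounded_clinear_def by (simp add: bounded_linear_add scaleC_add_right)

lemma bounded_clinear_minus:
  "bounded_clinear S \<Longrightarrow> bounded_clinear T \<Longrightarrow> bounded_clinear (\<lambda>x. S x - T x)"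
  unfolding bounded_clinear_def
  by (simp add: bounded_linear_sub complex_vector.scale_right_diff_distrib)

lemma bounded_clinear_compose:
  "bounded_clinear S \<Longrightarrow> bounded_clinear T \<Longrightarrow> bounded_clinear (\<lambda>x. S (T x))"
  unfolding bounded_clinear_def by (simp add: bounded_linear_compose)

lemma bounded_clinear_scaleC: "bounded_clinear (\<lambda>x. c *\<^sub>C x)"
proof (rule bounded_clinearI)
  show "bounded_linear (\<lambda>x. c *\<^sub>C x)"
    by (rule bounded_linear_intro[of _ "cmod c"])
      (simp_all add: scaleC_add_right scaleR_scaleC scaleC_scaleC norm_scaleC mult.commute)
qed (simp add: scaleC_scaleC mult.commute)

lemma bounded_clinear_id: "bounded_clinear (\<lambda>x. x)"
  by (simp add: bounded_clinear_def bounded_linear_ident)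

lemma bounded_clinear_funpow: "bounded_clinear T \<Longrightarrow> bounded_clinear (T ^^ n)"
proof (induction n)
  case 0
  then show ?case using bounded_clinear_id by (simp add: id_def)
next
  case (Suc n)
  then show ?case using bounded_clinear_compose[of T "T ^^ n"] by (simp add: comp_def)
qed

lemma bounded_clinear_shift: "bounded_clinear T \<Longrightarrow> bounded_clinear (\<lambda>x. T x - c *\<^sub>C x)"
  by (intro bounded_clinear_minus bounded_clinear_scaleC)

lemma lin_eq_on_span:
  assumes F: "lin F" and G: "lin G" and eq: "\<And>b. b \<in> B \<Longrightarrow> F b = G b" and x: "x \<in> cspan B"
  shows "F x = G x"
proof -
  have "csubspace {x. F x - G x = 0}" by (rule subspace_kernel[OF lin_minus[OF F G]])
  moreover have "B \<subseteq> {x. F x - G x = 0}" using eq by auto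
  ultimately have "cspan B \<subseteq> {x. F x - G x = 0}" by (intro complex_vector.span_minimal)
  then show ?thesis using x by auto
qed

lemma bounded_clinear_functional_times:
  fixes h :: "'a :: complex_normed_vector \<Rightarrow> complex"
  assumes h: "bounded_linear h" "\<And>c x. h (c *\<^sub>C x) = c * h x"
  shows "bounded_clinear (\<lambda>x. h x *\<^sub>C (y :: 'a))"
proof (rule bounded_clinearI)
  interpret h: bounded_linear h by (rule h(1))
  obtain K where K: "\<And>x. norm (h x) \<le> norm x * K" using h.bounded by blast
  show "bounded_linear (\<lambda>x. h x *\<^sub>C y)"
  proof (rule bounded_linear_intro[of _ "K * norm y"])
    show "h (u + v) *\<^sub>C y = h u *\<^sub>C y + h v *\<^sub>C y" for u v by (simp only: h.add scaleC_add_left)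
    show "h (r *\<^sub>R u) *\<^sub>C y = r *\<^sub>R (h u *\<^sub>C y)" for r u
    proof -
      have "h (r *\<^sub>R u) *\<^sub>C y = (complex_of_real r * h u) *\<^sub>C y"
        by (simp only: h.scaleR scaleR_conv_of_real)
      also have "\<dots> = r *\<^sub>R (h u *\<^sub>C y)" by (simp only: scaleR_scaleC scaleC_scaleC)
      finally show ?thesis .
    qed
    show "norm (h u *\<^sub>C y) \<le> norm u * (K * norm y)" for u
      using mult_right_mono[OF K[of u], of "norm y"] by (simp only: norm_scaleC mult.assoc norm_ge_zero)
  qed
  show "h (c *\<^sub>C x) *\<^sub>C y = c *\<^sub>C (h x *\<^sub>C y)" for c x by (simp only: h(2) scaleC_scaleC)
qed

text \<open>Induction on \<open>B\<close>. The induction hypothesis for the identity provides a bounded projection \<open>P\<close> onto the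
  span of \<open>B\<close>; correcting by a functional of \<open>x - P x\<close> prescribes the value at the new vector
  without affecting the old ones.\<close>

lemma bounded_finite_rank_extension:
  fixes f :: "'a :: complex_normed_vector \<Rightarrow> 'a"
  assumes "finite B" "complex_vector.independent B"
  shows "\<exists>F. bounded_clinear F \<and> range F \<subseteq> cspan (f ` B) \<and> (\<forall>b\<in>B. F b = f b)"
  using assms
proof (induction B arbitrary: f)
  case empty
  have "bounded_clinear (\<lambda>x :: 'a. 0 *\<^sub>C x)" by (rule bounded_clinear_scaleC)
  then show ?case by (intro exI[of _ "\<lambda>x. 0"]) simp
next
  case (insert b B)
  have indB: "complex_vector.independent B" and bB: "b \<notin> cspan B"
    using insert.hyps insert.prems by (auto simp: complex_vector.independent_insert)
  obtain P where P: "bounded_clinear P" "range P \<subseteq> cspan B" "\<forall>b\<in>B. P b = b"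
    using insert.IH[OF indB, of "\<lambda>x. x"] by auto
  obtain F where F: "bounded_clinear F" "range F \<subseteq> cspan (f ` B)" "\<forall>b\<in>B. F b = f b"
    using insert.IH[OF indB, of f] by metis
  have "P b \<in> cspan B" using P(2) by blast
  then have "b - P b \<noteq> 0" using bB by auto
  then obtain h :: "'a \<Rightarrow> complex"
    where h: "bounded_linear h" "\<And>c x. h (c *\<^sub>C x) = c * h x" "h (b - P b) = 1"
    using complex_norming_functional by metis
  let ?F = "\<lambda>x. F x + h (x - P x) *\<^sub>C (f b - F b)"
  have "bounded_clinear ?F"
    using bounded_clinear_compose[OF bounded_clinear_functional_times[OF h(1,2)]
        bounded_clinear_minus[OF bounded_clinear_id P(1)]]
    by (rule bounded_clinear_plus[OF F(1)])
  moreover have "range ?F \<subseteq> cspan (f ` insert b B)"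
  proof -
    have "cspan (f ` B) \<subseteq> cspan (f ` insert b B)" by (rule complex_vector.span_mono) blast
    then have Fx: "F x \<in> cspan (f ` insert b B)" for x using F(2) by blast
    have "f b \<in> cspan (f ` insert b B)" by (rule complex_vector.span_base) simp
    then have "?F x \<in> cspan (f ` insert b B)" for x
      by (intro complex_vector.span_add complex_vector.span_scale complex_vector.span_diff Fx)
    then show ?thesis by blast
  qed
  moreover have "?F b = f b" by (simp only: h(3) scaleC_one) simp
  moreover have "?F x = f x" if "x \<in> B" for x
    using that P(3) F(3) linear_simps(3)[OF h(1)] by simp
  ultimately show ?case by blast
qed

lemma finite_cdim_projection:
  assumes V: "csubspace V" "finite_cdim V"
  obtains P where "bounded_clinear P" "range P \<subseteq> V" "\<And>x. x \<in> V \<Longrightarrow> P x = x"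
proof -
  obtain B where B: "finite B" "B \<subseteq> V" "complex_vector.independent B" "V \<subseteq> cspan B"
    using fin_dim_basis[OF V(2)] by metis
  have span: "cspan B = V" using B(2,4) V(1) by (intro antisym complex_vector.span_minimal)
  obtain P where P: "bounded_clinear P" "range P \<subseteq> cspan B" "\<forall>b\<in>B. P b = b"
    using bounded_finite_rank_extension[OF B(1,3), of "\<lambda>x. x"] by auto
  have "P x = x" if "x \<in> V" for x
    by (rule lin_eq_on_span[OF bounded_clinear_lin[OF P(1)] lin_id, of B]) (use P(3) that span in auto)
  then show thesis using that P(1,2) span by metis
qed

text \<open>The space is the set of fixed points of a bounded projection.\<close>

lemma closed_finite_cdim:
  fixes V :: "'a :: complex_normed_vector set"
  assumes V: "csubspace V" "finite_cdim V"
  shows "closed V"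
proof -
  obtain P where P: "bounded_clinear P" "range P \<subseteq> V" "\<And>x. x \<in> V \<Longrightarrow> P x = x"
    using finite_cdim_projection[OF V] by metis
  have "V = {x. P x = x}" using P(2,3) by (metis (mono_tags, lifting) Collect_cong Collect_mem_eq rangeI subsetD)
  moreover have "closed {x. P x = x}"
    using bounded_clinear_bounded_linear[OF P(1)]
    by (intro closed_Collect_eq linear_continuous_on continuous_on_id)
  ultimately show ?thesis by simp
qed

text \<open>If \<open>b\<close> has distance at least \<open>d > 0\<close> from \<open>W\<close>, then \<open>d |c| \<le> norm (w + c b)\<close>. So the coefficients of a
  convergent sequence in the sum form a Cauchy sequence.\<close>

lemma closed_plus_line:
  fixes W :: "'a :: complex_normed_vector set"
  assumes W: "csubspace W" "closed W"
  shows "closed {w + c *\<^sub>C b | w c. w \<in> W}"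
proof (cases "b \<in> W")
  case True
  have "{w + c *\<^sub>C b | w c. w \<in> W} = W"
  proof (intro equalityI subsetI)
    fix x assume "x \<in> W"
    then have "x = x + 0 *\<^sub>C b \<and> x \<in> W" by simp
    then show "x \<in> {w + c *\<^sub>C b | w c. w \<in> W}" by blast
  qed (use True W(1) in \<open>auto intro: complex_vector.subspace_add complex_vector.subspace_scale\<close>)
  then show ?thesis using W(2) by simp
next
  case False
  then obtain d where d: "d > 0" "ball b d \<subseteq> - W"
    using W(2) open_contains_ball[of "- W"] by (auto simp: open_Compl)
  have far: "cmod c * d \<le> norm (w + c *\<^sub>C b)" if w: "w \<in> W" for w c
  proof (cases "c = 0")
    case c: False
    have "(- (1 / c)) *\<^sub>C w \<in> W" using W(1) w by (rule complex_vector.subspace_scale)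
    then have "d \<le> dist b ((- (1 / c)) *\<^sub>C w)" using d(2) by (metis Compl_iff mem_ball not_less subsetD)
    also have "\<dots> = norm ((1 / c) *\<^sub>C (w + c *\<^sub>C b))"
      using c by (simp add: dist_norm scaleC_add_right scaleC_scaleC scaleC_one add.commute)
    also have "\<dots> = norm (w + c *\<^sub>C b) / cmod c" by (simp add: norm_scaleC norm_divide)
    finally show ?thesis using c by (simp add: field_simps)
  qed simp
  show ?thesis
  proof (rule closed_sequential_limits[THEN iffD2], intro allI impI)
    fix s y assume "(\<forall>n. s n \<in> {w + c *\<^sub>C b | w c. w \<in> W}) \<and> s \<longlonglongrightarrow> y"
    then have mem: "s n \<in> {w + c *\<^sub>C b | w c. w \<in> W}" and lim: "s \<longlonglongrightarrow> y" for n by blast+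
    have "\<forall>n. \<exists>w c. w \<in> W \<and> s n = w + c *\<^sub>C b" using mem by blast
    then obtain w c where wc: "\<And>n. w n \<in> W" "\<And>n. s n = w n + c n *\<^sub>C b" by metis
    have le: "cmod (c m - c n) \<le> dist (s m) (s n) / d" for m n
    proof -
      have mem: "w m - w n \<in> W" by (rule complex_vector.subspace_diff[OF W(1) wc(1) wc(1)])
      have "s m - s n = (w m - w n) + (c m - c n) *\<^sub>C b"
        by (simp add: wc(2) complex_vector.scale_left_diff_distrib)
      then have "cmod (c m - c n) * d \<le> dist (s m) (s n)"
        using far[OF mem, of "c m - c n"] by (simp only: dist_norm)
      then show ?thesis using d(1) by (simp add: field_simps)
    qed
    have "Cauchy c"
    proof (rule metric_CauchyI)
      fix e :: real assume e: "e > 0"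
      then obtain M where M: "\<And>m n. m \<ge> M \<Longrightarrow> n \<ge> M \<Longrightarrow> dist (s m) (s n) < e * d"
        using LIMSEQ_imp_Cauchy[OF lim] d(1) by (metis Cauchy_def mult_pos_pos)
      have "dist (c m) (c n) < e" if "m \<ge> M" "n \<ge> M" for m n
      proof -
        have "dist (s m) (s n) / d < e" using M[OF that] d(1) by (simp add: field_simps)
        then show ?thesis using le[of m n] by (simp only: dist_norm)
      qed
      then show "\<exists>M. \<forall>m\<ge>M. \<forall>n\<ge>M. dist (c m) (c n) < e" by blast
    qed
    then obtain k where k: "c \<longlonglongrightarrow> k" using Cauchy_convergent_iff convergent_def by metis
    have "(\<lambda>n. c n *\<^sub>C b - k *\<^sub>C b) \<longlonglongrightarrow> 0"
    proof (rule tendsto_norm_zero_cancel)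
      have "(\<lambda>n. cmod (c n - k) * norm b) \<longlonglongrightarrow> 0"
        using k by (intro tendsto_mult_left_zero tendsto_norm_zero) (simp add: LIM_zero)
      then show "(\<lambda>n. norm (c n *\<^sub>C b - k *\<^sub>C b)) \<longlonglongrightarrow> 0"
        by (simp add: norm_scaleC flip: complex_vector.scale_left_diff_distrib)
    qed
    then have "(\<lambda>n. s n - c n *\<^sub>C b) \<longlonglongrightarrow> y - k *\<^sub>C b"
      by (intro tendsto_diff lim) (rule LIM_zero_cancel)
    moreover have "\<forall>n. s n - c n *\<^sub>C b \<in> W" using wc by simp
    ultimately have "y - k *\<^sub>C b \<in> W" using W(2) by (metis (no_types, lifting) closed_sequentially)
    then show "y \<in> {w + c *\<^sub>C b | w c. w \<in> W}" by (auto intro!: exI[of _ "y - k *\<^sub>C b"] exI[of _ k])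
  qed
qed

lemma closed_sum_span:
  fixes W :: "'a :: complex_normed_vector set"
  assumes W: "csubspace W" "closed W" and B: "finite B"
  shows "closed {w + e | w e. w \<in> W \<and> e \<in> cspan B}"
  using B
proof (induction B)
  case empty
  have "{w + e | w e. w \<in> W \<and> e \<in> cspan {}} = W" by auto
  then show ?case using W(2) by simp
next
  case (insert b B)
  let ?U = "{w + e | w e. w \<in> W \<and> e \<in> cspan B}"
  have "csubspace ?U" by (rule complex_vector.subspace_sums[OF W(1) complex_vector.subspace_span])
  then have "closed {u + c *\<^sub>C b | u c. u \<in> ?U}" using insert.IH by (rule closed_plus_line)
  moreover have "{w + e | w e. w \<in> W \<and> e \<in> cspan (insert b B)} = {u + c *\<^sub>C b | u c. u \<in> ?U}"
  proof (intro equalityI subsetI)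
    fix x assume "x \<in> {w + e | w e. w \<in> W \<and> e \<in> cspan (insert b B)}"
    then obtain w e k where "w \<in> W" "e - k *\<^sub>C b \<in> cspan B" "x = w + e"
      by (auto simp: complex_vector.span_insert)
    then have "x = (w + (e - k *\<^sub>C b)) + k *\<^sub>C b \<and> w + (e - k *\<^sub>C b) \<in> ?U" by auto
    then show "x \<in> {u + c *\<^sub>C b | u c. u \<in> ?U}" by blast
  next
    fix x assume "x \<in> {u + c *\<^sub>C b | u c. u \<in> ?U}"
    then obtain w e c where x: "w \<in> W" "e \<in> cspan B" "x = (w + e) + c *\<^sub>C b" by blast
    have "\<exists>k. (e + c *\<^sub>C b) - k *\<^sub>C b \<in> cspan B" using x(2) by (intro exI[of _ c]) simp
    then have "e + c *\<^sub>C b \<in> cspan (insert b B)" by (simp only: complex_vector.span_insert mem_Collect_eq)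
    moreover have "x = w + (e + c *\<^sub>C b)" using x(3) by (simp only: add.assoc)
    ultimately show "x \<in> {w + e | w e. w \<in> W \<and> e \<in> cspan (insert b B)}" using x(1) by blast
  qed
  ultimately show ?case by simp
qed

text \<open>A linear projection with kernel \<open>R(T)\<close> maps \<open>G\<close> onto an algebraic complement of \<open>R(T)\<close>, which is
  finite-dimensional and therefore closed.\<close>

lemma closed_range_finite_codim:
  fixes T :: "'a :: complex_banach \<Rightarrow> 'a"
  assumes T: "bounded_clinear T" and G: "finite_cdim G" and sum: "\<And>y. \<exists>x. \<exists>g\<in>G. y = T x + g"
  shows "closed (range T)"
proof -
  have R: "csubspace (range T)" by (rule subspace_lin_image[OF bounded_clinear_lin[OF T]]) simp
  obtain Q where Q: "lin Q" "\<And>x. Q x = 0 \<longleftrightarrow> x \<in> range T" "\<And>x. Q (Q x) = Q x"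
    using projection_with_kernel[OF R] by metis
  have E: "csubspace (range Q)" by (rule subspace_lin_image[OF Q(1)]) simp
  have "range Q \<subseteq> Q ` G"
  proof
    fix y assume "y \<in> range Q"
    then obtain x where x: "y = Q x" by blast
    obtain u g where ug: "g \<in> G" "x = T u + g" using sum by metis
    have "Q (T u) = 0" using Q(2) by blast
    then have "y = Q g" unfolding x ug(2) by (simp add: lin_add[OF Q(1)])
    then show "y \<in> Q ` G" using ug(1) by blast
  qed
  then have fE: "finite_cdim (range Q)" using fin_dim_image[OF Q(1) G] by (rule fin_dim_subset)
  show ?thesis
  proof (rule complemented_range_closed[OF bounded_clinear_bounded_linear[OF T] csubspace_subspace[OF E]])
    show "closed (range Q)" by (rule closed_finite_cdim[OF E fE])
    show "range T \<inter> range Q \<subseteq> {0}"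
    proof
      fix y assume y: "y \<in> range T \<inter> range Q"
      then obtain x where "y = Q x" by blast
      then have "y = Q y" using Q(3) by simp
      also have "Q y = 0" using Q(2) y by blast
      finally show "y \<in> {0}" by simp
    qed
    fix y
    have "Q (y - Q y) = 0" by (simp add: lin_diff[OF Q(1)] Q(3))
    then obtain u where "y - Q y = T u" using Q(2) by blast
    then have "y = T u + Q y" by (simp add: algebra_simps)
    then show "\<exists>x. \<exists>e\<in>range Q. y = T x + e" by blast
  qed
qed

section \<open>Shifting by small scalars\<close>

text \<open>From a backward orbit \<open>A x\<^sub>0 = y\<close>, \<open>A x\<^sub>k\<^sub>+\<^sub>1 = x\<^sub>k\<close> of controlled growth, the series
  \<open>z = \<Sum> \<mu>\<^sup>k x\<^sub>k\<close> solves \<open>(A - \<mu>) z = y\<close>. With arbitrary \<open>y\<close> this shows that surjectivity is stable under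
  small shifts; with \<open>y = 0\<close> and \<open>x\<^sub>0 \<noteq> 0\<close> it produces eigenvectors of \<open>A\<close> for the eigenvalue \<open>\<mu>\<close>, nonzero
  because they stay close to \<open>x\<^sub>0\<close>.\<close>

lemma shifted_preimage_series:
  fixes A :: "'a :: complex_banach \<Rightarrow> 'a"
  assumes A: "bounded_clinear A" and C: "C > 0" and \<mu>: "cmod \<mu> * C < 1"
    and start: "A (x 0) = y" and step: "\<And>k. A (x (Suc k)) = x k"
    and bound: "\<And>k. norm (x (Suc k)) \<le> C * norm (x k)"
  obtains z where "A z - \<mu> *\<^sub>C z = y" "norm (z - x 0) \<le> norm (x 0) * (cmod \<mu> * C) / (1 - cmod \<mu> * C)"
proof -
  interpret A: bounded_linear A by (rule bounded_clinear_bounded_linear[OF A])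
  let ?q = "cmod \<mu> * C"
  let ?f = "\<lambda>k. \<mu> ^ k *\<^sub>C x k"
  have q: "0 \<le> ?q" using C by simp
  have xn: "norm (x k) \<le> C ^ k * norm (x 0)" for k
  proof (induction k)
    case (Suc k)
    have "norm (x (Suc k)) \<le> C * norm (x k)" by (rule bound)
    also have "\<dots> \<le> C * (C ^ k * norm (x 0))" using Suc C by (intro mult_left_mono) auto
    finally show ?case by (simp add: mult_ac)
  qed simp
  have fn: "norm (?f k) \<le> norm (x 0) * ?q ^ k" for k
    using mult_left_mono[OF xn[of k], of "cmod \<mu> ^ k"]
    by (simp add: norm_scaleC norm_power power_mult_distrib mult_ac)
  have geo: "summable (\<lambda>k. norm (x 0) * ?q ^ k)"
    using q \<mu> by (intro summable_mult summable_geometric) simp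
  have sn: "summable (\<lambda>k. norm (?f k))" by (rule summable_comparison_test[OF _ geo]) (use fn in auto)
  then have s: "summable ?f" by (rule summable_norm_cancel)
  let ?z = "\<Sum>k. ?f k"
  have snS: "summable (\<lambda>k. norm (?f (Suc k)))" using sn by (rule summable_Suc_iff[of "\<lambda>k. norm (?f k)", THEN iffD2])
  have sS: "summable (\<lambda>k. ?f (Suc k))" using snS by (rule summable_norm_cancel)
  have z: "?z = x 0 + (\<Sum>k. ?f (Suc k))" using suminf_split_head[OF s] by (simp add: scaleC_one)
  have lz: "\<mu> *\<^sub>C ?z = (\<Sum>k. \<mu> *\<^sub>C ?f k)"
    by (rule bounded_linear.suminf[OF bounded_clinear_bounded_linear[OF bounded_clinear_scaleC] s])
  have step': "A (?f (Suc k)) = \<mu> *\<^sub>C ?f k" for k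
    using lin_scale[OF bounded_clinear_lin[OF A]] by (simp add: step scaleC_scaleC)
  have "A ?z = A (x 0) + (\<Sum>k. A (?f (Suc k)))" unfolding z by (simp only: A.add A.suminf[OF sS])
  also have "\<dots> = y + \<mu> *\<^sub>C ?z" by (simp only: start step' lz)
  finally have 1: "A ?z - \<mu> *\<^sub>C ?z = y" by simp
  have fS: "norm (?f (Suc k)) \<le> (norm (x 0) * ?q) * ?q ^ k" for k
    using fn[of "Suc k"] by (simp add: mult_ac)
  have geoS: "summable (\<lambda>k. (norm (x 0) * ?q) * ?q ^ k)"
    using q \<mu> by (intro summable_mult summable_geometric) simp
  have "norm (?z - x 0) = norm (\<Sum>k. ?f (Suc k))" unfolding z by (simp only: add_diff_cancel_left')
  also have "\<dots> \<le> (\<Sum>k. norm (?f (Suc k)))" by (rule summable_norm[OF snS])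
  also have "\<dots> \<le> (\<Sum>k. (norm (x 0) * ?q) * ?q ^ k)" by (rule suminf_le[OF fS snS geoS])
  also have "\<dots> = norm (x 0) * ?q / (1 - ?q)" using q \<mu> by (subst suminf_mult) (simp_all add: suminf_geometric)
  finally have 2: "norm (?z - x 0) \<le> norm (x 0) * ?q / (1 - ?q)" .
  show thesis by (rule that[OF 1 2])
qed

lemma injective_bounded_below:
  fixes A :: "'a :: complex_banach \<Rightarrow> 'a"
  assumes A: "bounded_clinear A" "inj A" "closed (range A)"
  obtains c where "c > 0" "\<And>x. c * norm x \<le> norm (A x)"
proof -
  obtain C where C: "C > 0" "\<And>w. w \<in> range A \<Longrightarrow> \<exists>z\<in>UNIV. A z = w \<and> norm z \<le> C * norm w"
    using bounded_preimages[OF bounded_clinear_bounded_linear[OF A(1)] subspace_UNIV closed_UNIV A(3)]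
    by metis
  have "norm x \<le> C * norm (A x)" for x
    using C(2)[of "A x"] injD[OF A(2)] by auto
  then show thesis using that[of "1 / C"] C(1) by (simp add: field_simps)
qed

lemma bounded_below_shift:
  fixes A :: "'a :: complex_normed_vector \<Rightarrow> 'a"
  assumes "\<And>x. c * norm x \<le> norm (A x)"
  shows "(c - cmod \<mu>) * norm x \<le> norm (A x - \<mu> *\<^sub>C x)"
  using assms[of x] norm_triangle_ineq2[of "A x" "\<mu> *\<^sub>C x"] by (simp add: norm_scaleC algebra_simps)

lemma inj_if_bounded_below:
  assumes A: "lin A" and c: "c > 0" "\<And>x. c * norm x \<le> norm (A x)"
  shows "inj A"
proof (rule injI)
  fix x y assume "A x = A y"
  then have "A (x - y) = 0" by (simp add: lin_diff[OF A])
  then have "norm (x - y) \<le> 0" using c(2)[of "x - y"] c(1) by (simp add: mult_le_0_iff)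
  then show "x = y" by simp
qed

lemma surj_shift:
  fixes A :: "'a :: complex_banach \<Rightarrow> 'a"
  assumes A: "bounded_clinear A" and C: "C > 0" "\<And>y. \<exists>x. A x = y \<and> norm x \<le> C * norm y"
    and \<mu>: "cmod \<mu> * C < 1"
  shows "surj (\<lambda>x. A x - \<mu> *\<^sub>C x)"
proof -
  obtain g where g: "\<And>y. A (g y) = y" "\<And>y. norm (g y) \<le> C * norm y" using C(2) by metis
  have "\<exists>z. A z - \<mu> *\<^sub>C z = y" for y
  proof -
    have "A ((g ^^ Suc k) (g y)) = (g ^^ k) (g y)" for k by (simp add: g(1))
    moreover have "norm ((g ^^ Suc k) (g y)) \<le> C * norm ((g ^^ k) (g y))" for k by (simp add: g(2))
    moreover have "A ((g ^^ 0) (g y)) = y" by (simp add: g(1))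
    ultimately show ?thesis
      using shifted_preimage_series[OF A C(1) \<mu>, of "\<lambda>k. (g ^^ k) (g y)" y] by blast
  qed
  then show ?thesis unfolding surj_def by metis
qed

lemma surj_near_zero:
  fixes A :: "'a :: complex_banach \<Rightarrow> 'a"
  assumes A: "bounded_clinear A" "surj A"
  obtains \<delta> where "\<delta> > 0" "\<And>\<mu>. cmod \<mu> < \<delta> \<Longrightarrow> surj (\<lambda>x. A x - \<mu> *\<^sub>C x)"
proof -
  obtain C where C: "C > 0" "\<And>w. w \<in> range A \<Longrightarrow> \<exists>z\<in>UNIV. A z = w \<and> norm z \<le> C * norm w"
    using bounded_preimages[OF bounded_clinear_bounded_linear[OF A(1)] subspace_UNIV closed_UNIV] A(2)
    by (metis closed_UNIV)
  have pre: "\<exists>x. A x = y \<and> norm x \<le> C * norm y" for y using C(2)[of y] A(2) by auto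
  show thesis
  proof (rule that[of "1 / C"])
    fix \<mu> :: complex assume "cmod \<mu> < 1 / C"
    then have "cmod \<mu> * C < 1" using C(1) by (simp add: field_simps)
    then show "surj (\<lambda>x. A x - \<mu> *\<^sub>C x)" by (rule surj_shift[OF A(1) C(1) pre])
  qed (use C(1) in simp)
qed

text \<open>The operator \<open>A - \<mu>\<close> is bijective and its inverse has norm at most \<open>1 / (c - |\<mu>|)\<close>. As
  \<open>|\<mu>| < c - |\<mu>|\<close>, it remains surjective when the shift is undone.\<close>

lemma surj_if_shift_surj:
  fixes A :: "'a :: complex_banach \<Rightarrow> 'a"
  assumes A: "bounded_clinear A" and c: "\<And>x. c * norm x \<le> norm (A x)"
    and \<mu>: "cmod \<mu> < c / 2" and surj: "surj (\<lambda>x. A x - \<mu> *\<^sub>C x)"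
  shows "surj A"
proof -
  let ?A = "\<lambda>x. A x - \<mu> *\<^sub>C x" and ?C = "1 / (c - cmod \<mu>)"
  have pos: "c - cmod \<mu> > 0" using \<mu> norm_ge_zero[of \<mu>] by linarith
  have bA: "bounded_clinear ?A" by (rule bounded_clinear_shift[OF A])
  have pre: "\<exists>x. ?A x = y \<and> norm x \<le> ?C * norm y" for y
  proof -
    obtain x where x: "y = ?A x" using surjD[OF surj, of y] by blast
    then have "(c - cmod \<mu>) * norm x \<le> norm y"
      using bounded_below_shift[OF c, of \<mu> x] by (simp only:)
    then have "norm x \<le> ?C * norm y" using pos by (simp add: pos_le_divide_eq mult.commute)
    then show ?thesis using x by blast
  qed
  have C: "?C > 0" using pos by simp
  have small: "cmod (- \<mu>) * ?C < 1" using \<mu> pos by (simp add: field_simps)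
  have "surj (\<lambda>x. ?A x - (- \<mu>) *\<^sub>C x)" by (rule surj_shift[OF bA C pre small])
  then show ?thesis by simp
qed

text \<open>Start a backward orbit at \<open>a\<close> inside \<open>Z\<close>; the preimages can be chosen with geometric growth because
  \<open>Z\<close> is closed and mapped onto itself.\<close>

lemma kernel_persists:
  fixes A :: "'a :: complex_banach \<Rightarrow> 'a"
  assumes A: "bounded_clinear A" and Z: "csubspace Z" "closed Z" "A ` Z = Z"
    and a: "a \<in> Z" "a \<noteq> 0" "A a = 0"
  obtains \<delta> where "\<delta> > 0" "\<And>\<mu>. cmod \<mu> < \<delta> \<Longrightarrow> \<not> inj (\<lambda>x. A x - \<mu> *\<^sub>C x)"
proof -
  have cl: "closed (A ` Z)" using Z by simp
  obtain C where C: "C > 0" "\<And>w. w \<in> A ` Z \<Longrightarrow> \<exists>z\<in>Z. A z = w \<and> norm z \<le> C * norm w"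
    using bounded_preimages[OF bounded_clinear_bounded_linear[OF A(1)] csubspace_subspace[OF Z(1)] Z(2) cl]
    by metis
  have "\<forall>w\<in>Z. \<exists>z. z \<in> Z \<and> A z = w \<and> norm z \<le> C * norm w"
  proof
    fix w assume "w \<in> Z"
    then have "w \<in> A ` Z" using Z(3) by simp
    from C(2)[OF this] show "\<exists>z. z \<in> Z \<and> A z = w \<and> norm z \<le> C * norm w" by (elim bexE) (rule exI, rule conjI)
  qed
  from bchoice[OF this] obtain g
    where "\<forall>w\<in>Z. g w \<in> Z \<and> A (g w) = w \<and> norm (g w) \<le> C * norm w" by (rule exE)
  note g = this[rule_format]
  have gZ: "(g ^^ k) a \<in> Z" for k by (induction k) (simp_all add: a(1) g)
  show thesis
  proof (rule that[of "1 / (2 * C)"])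
    fix \<mu> :: complex assume "cmod \<mu> < 1 / (2 * C)"
    then have q: "cmod \<mu> * C < 1 / 2" using C(1) by (simp add: field_simps)
    then have q1: "cmod \<mu> * C < 1" by simp
    obtain z where z: "A z - \<mu> *\<^sub>C z = 0"
      "norm (z - a) \<le> norm a * (cmod \<mu> * C) / (1 - cmod \<mu> * C)"
      using shifted_preimage_series[OF A C(1) q1, of "\<lambda>k. (g ^^ k) a" 0] a(3) g[OF gZ] by auto
    have "cmod \<mu> * C / (1 - cmod \<mu> * C) < 1" using q by (simp add: field_simps)
    then have "norm a * (cmod \<mu> * C / (1 - cmod \<mu> * C)) < norm a * 1"
      using a(2) by (intro mult_strict_left_mono) auto
    then have "norm (z - a) < norm a" using z(2) by simp
    then have "z \<noteq> 0" by auto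
    moreover have "A z - \<mu> *\<^sub>C z = A 0 - \<mu> *\<^sub>C 0"
      using z(1) lin_zero[OF bounded_clinear_lin[OF A]] by simp
    ultimately show "\<not> inj (\<lambda>x. A x - \<mu> *\<^sub>C x)" unfolding inj_def by blast
  qed (use C(1) in simp)
qed

section \<open>Drazin invertible operators near zero\<close>

lemma bounded_projection:
  fixes M N :: "'a :: complex_banach set"
  assumes M: "csubspace M" "closed M" and N: "csubspace N" "closed N" and MN: "direct_sum UNIV M N"
  obtains P where "bounded_clinear P" "\<And>x. P x \<in> M" "\<And>x. x - P x \<in> N"
    "\<And>x. x \<in> M \<Longrightarrow> P x = x" "\<And>x. x \<in> N \<Longrightarrow> P x = 0"
proof -
  have "\<exists>m. m \<in> M \<and> x - m \<in> N" for x
  proof -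
    have "x \<in> {m + n | m n. m \<in> M \<and> n \<in> N}" using MN by (simp add: direct_sum_def)
    then obtain m n where "x = m + n" "m \<in> M" "n \<in> N" by blast
    then show ?thesis by (intro exI[of _ m]) simp
  qed
  then obtain P where P: "\<And>x. P x \<in> M" "\<And>x. x - P x \<in> N" by metis
  have zero: "x = 0" if "x \<in> M" "x \<in> N" for x using MN that by (auto simp: direct_sum_def)
  have uniq: "P x = m" if "m \<in> M" "x - m \<in> N" for x m
  proof -
    have "P x - m \<in> M" by (rule complex_vector.subspace_diff[OF M(1) P(1) that(1)])
    moreover have "(x - m) - (x - P x) \<in> N" by (rule complex_vector.subspace_diff[OF N(1) that(2) P(2)])
    then have "P x - m \<in> N" by simp
    ultimately show ?thesis using zero by fastforce
  qed
  have add: "P (x + y) = P x + P y" for x y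
  proof (rule uniq)
    show "P x + P y \<in> M" by (rule complex_vector.subspace_add[OF M(1) P(1) P(1)])
    show "x + y - (P x + P y) \<in> N"
      using complex_vector.subspace_add[OF N(1) P(2)[of x] P(2)[of y]] by (simp add: algebra_simps)
  qed
  have scale: "P (c *\<^sub>C x) = c *\<^sub>C P x" for c x
  proof (rule uniq)
    show "c *\<^sub>C P x \<in> M" by (rule complex_vector.subspace_scale[OF M(1) P(1)])
    show "c *\<^sub>C x - c *\<^sub>C P x \<in> N"
      using complex_vector.subspace_scale[OF N(1) P(2)[of x], of c]
      by (simp add: complex_vector.scale_right_diff_distrib)
  qed
  \<comment> \<open>Boundedness is the open mapping theorem for addition on \<open>M \<times> N\<close>.\<close>
  let ?add = "\<lambda>(m, n). m + n"
  have b: "bounded_linear (?add :: 'a \<times> 'a \<Rightarrow> 'a)"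
    unfolding case_prod_beta by (intro bounded_linear_add bounded_linear_fst bounded_linear_snd)
  have Z: "subspace (M \<times> N)" "closed (M \<times> N)"
    using M N by (simp_all add: subspace_Times closed_Times csubspace_subspace)
  have "x \<in> ?add ` (M \<times> N)" for x
    by (rule image_eqI[of _ _ "(P x, x - P x)"]) (use P in auto)
  then have img: "?add ` (M \<times> N) = UNIV" by blast
  obtain C where C: "\<And>w. \<exists>z\<in>M \<times> N. ?add z = w \<and> norm z \<le> C * norm w"
    using bounded_preimages[OF b Z] unfolding img by (metis UNIV_I closed_UNIV)
  have "norm (P x) \<le> norm x * C" for x
  proof -
    obtain m n where mn: "m \<in> M" "n \<in> N" "m + n = x" "norm (m, n) \<le> C * norm x"
      using C[of x] by auto
    have "P x = m" using mn by (intro uniq) auto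
    then show ?thesis using mn(4) norm_fst_le[of m n] by (simp add: mult.commute)
  qed
  then have "bounded_linear P"
    by (intro bounded_linear_intro[of _ C]) (auto simp: add scaleR_scaleC scale)
  then have "bounded_clinear P" using scale by (rule bounded_clinearI)
  moreover have "P x = x" if "x \<in> M" for x
    using that complex_vector.subspace_0[OF N(1)] by (intro uniq) auto
  moreover have "P x = 0" if "x \<in> N" for x
    using that complex_vector.subspace_0[OF M(1)] by (intro uniq) auto
  ultimately show thesis using that P by metis
qed

text \<open>Stability of the ranges makes the sum the whole space, stability of the kernels makes it direct. The
  kernel is closed, and an operator range with a closed complement is closed as well.\<close>

lemma Drazin_decomposition:
  fixes T :: "'a :: complex_banach \<Rightarrow> 'a"
  assumes T: "bounded_clinear T" and k: "kernel_stable T p" "range_stable T p"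
  defines "M \<equiv> range (T ^^ p)" and "N \<equiv> {x. (T ^^ p) x = 0}"
  shows "csubspace M" "closed M" "csubspace N" "closed N" "direct_sum UNIV M N"
    "T ` M = M" "T ` N \<subseteq> N" "inj_on T M"
proof -
  have bTp: "bounded_clinear (T ^^ p)" by (rule bounded_clinear_funpow[OF T])
  note Tp = bounded_clinear_lin[OF bTp]
  show M: "csubspace M" unfolding M_def by (rule subspace_lin_image[OF Tp]) simp
  show N: "csubspace N" unfolding N_def by (rule subspace_kernel[OF Tp])
  show clN: "closed N" unfolding N_def
    using bounded_clinear_bounded_linear[OF bTp]
    by (intro closed_Collect_eq linear_continuous_on continuous_on_const)
  have disj: "M \<inter> N \<subseteq> {0}"
  proof
    fix y assume "y \<in> M \<inter> N"
    then obtain x where x: "y = (T ^^ p) x" "(T ^^ p) y = 0" by (auto simp: M_def N_def)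
    then have "(T ^^ (p + p)) x = 0" by (simp add: funpow_add)
    then show "y \<in> {0}" using kernel_stable_add[OF k(1)] x(1) by simp
  qed
  have sum: "\<exists>u. x - (T ^^ p) u \<in> N" for x
  proof -
    obtain u where "(T ^^ p) x = (T ^^ (p + p)) u" using range_stable_add[OF k(2)] by blast
    then have "x - (T ^^ p) u \<in> N" by (simp add: N_def lin_diff[OF Tp] funpow_add)
    then show ?thesis by blast
  qed
  show "closed M" unfolding M_def
  proof (rule complemented_range_closed[OF bounded_clinear_bounded_linear[OF bTp] csubspace_subspace[OF N] clN])
    show "range (T ^^ p) \<inter> N \<subseteq> {0}" using disj by (simp add: M_def)
    fix y
    obtain u where "y - (T ^^ p) u \<in> N" using sum by blast
    then show "\<exists>x. \<exists>e\<in>N. y = (T ^^ p) x + e"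
      by (intro exI[of _ u] bexI[of _ "y - (T ^^ p) u"]) simp_all
  qed
  show "direct_sum UNIV M N"
    unfolding direct_sum_def
  proof (intro conjI equalityI)
    show "UNIV \<subseteq> {m + n | m n. m \<in> M \<and> n \<in> N}"
    proof
      fix x :: 'a
      obtain u where "x - (T ^^ p) u \<in> N" using sum by blast
      moreover have "x = (T ^^ p) u + (x - (T ^^ p) u)" by simp
      moreover have "(T ^^ p) u \<in> M" by (simp add: M_def)
      ultimately show "x \<in> {m + n | m n. m \<in> M \<and> n \<in> N}" by blast
    qed
    show "{0} \<subseteq> M \<inter> N" using M N by (simp add: complex_vector.subspace_0)
  qed (use disj in auto)
  show "T ` M = M"
  proof
    show "T ` M \<subseteq> M"
    proof
      fix y assume "y \<in> T ` M"
      then obtain x where "y = T ((T ^^ p) x)" by (auto simp: M_def)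
      then have "y = (T ^^ p) (T x)" by (simp add: funpow_swap1)
      then show "y \<in> M" by (simp add: M_def)
    qed
    show "M \<subseteq> T ` M"
    proof
      fix y assume "y \<in> M"
      then obtain x where "y = (T ^^ p) x" by (auto simp: M_def)
      then obtain u where "y = T ((T ^^ p) u)" using k(2) by (auto simp: range_stable_def)
      then show "y \<in> T ` M" by (simp add: M_def)
    qed
  qed
  show "T ` N \<subseteq> N"
    using lin_zero[OF bounded_clinear_lin[OF T]] by (auto simp: N_def) (metis funpow_swap1)
  show "inj_on T M"
  proof (rule inj_onI)
    fix x y assume *: "x \<in> M" "y \<in> M" "T x = T y"
    then have "x - y \<in> M" using M by (intro complex_vector.subspace_diff)
    then obtain u where u: "x - y = (T ^^ p) u" by (auto simp: M_def)
    have "(T ^^ Suc p) u = T (x - y)" by (simp add: u)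
    also have "\<dots> = 0" using * by (simp add: lin_diff[OF bounded_clinear_lin[OF T]])
    finally have "(T ^^ p) u = 0" using k(1) by (simp add: kernel_stable_def)
    then show "x = y" using u by simp
  qed
qed

text \<open>If \<open>P\<close> is a projection commuting with \<open>T\<close>, this is the direct sum of the restriction of \<open>T\<close> to \<open>R(P)\<close>
  and the identity of \<open>N(P)\<close>. It lets statements about the restriction of \<open>T\<close> to a complemented subspace be read off from an operator
  on the whole space.\<close>

definition padded :: "('a :: complex_normed_vector \<Rightarrow> 'a) \<Rightarrow> ('a \<Rightarrow> 'a) \<Rightarrow> 'a \<Rightarrow> 'a" where
  "padded P T x = T (P x) + (x - P x)"

lemma bounded_clinear_padded:
  "bounded_clinear P \<Longrightarrow> bounded_clinear T \<Longrightarrow> bounded_clinear (padded P T)"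
  unfolding padded_def
  by (intro bounded_clinear_plus bounded_clinear_minus bounded_clinear_id bounded_clinear_compose[of T P])

text \<open>The finite Neumann series of \<open>T - \<mu>\<close> at a vector killed by a power of \<open>T\<close>, summed by induction.\<close>

lemma nilpotent_shift_preimage:
  assumes T: "lin T" and \<mu>: "\<mu> \<noteq> 0"
  shows "(T ^^ k) n = 0 \<Longrightarrow> \<exists>u. T u - \<mu> *\<^sub>C u = n"
proof (induction k arbitrary: n)
  case 0
  then show ?case by (intro exI[of _ 0]) (simp add: lin_zero[OF T])
next
  case (Suc k)
  have "(T ^^ k) (T n) = 0" using Suc.prems by (simp add: funpow_swap1)
  then obtain u where u: "T u - \<mu> *\<^sub>C u = T n" using Suc.IH by blast
  have "T ((1 / \<mu>) *\<^sub>C (u - n)) - \<mu> *\<^sub>C ((1 / \<mu>) *\<^sub>C (u - n))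
      = (1 / \<mu>) *\<^sub>C ((T u - \<mu> *\<^sub>C u) - T n + \<mu> *\<^sub>C n)"
    using \<mu> by (simp add: lin_scale[OF T] lin_diff[OF T] complex_vector.scale_right_diff_distrib
        scaleC_add_right scaleC_scaleC scaleC_one)
  also have "\<dots> = n" unfolding u using \<mu> by (simp add: scaleC_scaleC scaleC_one)
  finally show ?case by blast
qed

lemma nilpotent_shift_injective:
  assumes T: "lin T" and \<mu>: "\<mu> \<noteq> 0" and n: "(T ^^ k) n = 0" "T n - \<mu> *\<^sub>C n = 0"
  shows "n = 0"
proof -
  have "(T ^^ j) n = \<mu> ^ j *\<^sub>C n" for j
  proof (induction j)
    case (Suc j)
    have "T n = \<mu> *\<^sub>C n" using n(2) by simp
    then show ?case using Suc by (simp add: lin_scale[OF T] scaleC_scaleC mult.commute)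
  qed (simp add: scaleC_one)
  then show ?thesis using n(1) \<mu> by simp
qed

text \<open>On \<open>R(T\<^sup>p)\<close> the operator \<open>T\<close> is invertible, and invertibility survives small shifts; on \<open>N(T\<^sup>p)\<close> it is
  nilpotent, so that every nonzero shift is invertible.\<close>

lemma Drazin_punctured_neighbourhood:
  fixes T :: "'a :: complex_banach \<Rightarrow> 'a"
  assumes T: "bounded_clinear T" and k: "kernel_stable T p" "range_stable T p"
  obtains \<delta> where "\<delta> > 0"
    "\<And>\<mu>. \<mu> \<noteq> 0 \<Longrightarrow> cmod \<mu> < \<delta> \<Longrightarrow> inj (\<lambda>x. T x - \<mu> *\<^sub>C x) \<and> surj (\<lambda>x. T x - \<mu> *\<^sub>C x)"
proof -
  let ?M = "range (T ^^ p)" and ?N = "{x. (T ^^ p) x = 0}"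
  note lT = bounded_clinear_lin[OF T]
  note dec = Drazin_decomposition[OF T k]
  obtain P where P: "bounded_clinear P" "\<And>x. P x \<in> ?M" "\<And>x. x - P x \<in> ?N"
    "\<And>x. x \<in> ?M \<Longrightarrow> P x = x" "\<And>x. x \<in> ?N \<Longrightarrow> P x = 0"
    by (rule bounded_projection[OF dec(1-5)], rule that)
  note lP = bounded_clinear_lin[OF P(1)]
  let ?S = "padded P T"
  have S: "bounded_clinear ?S" by (rule bounded_clinear_padded[OF P(1) T])
  note lS = bounded_clinear_lin[OF S]
  have TM: "T m \<in> ?M" if "m \<in> ?M" for m using dec(6) that by blast
  have TN: "T n \<in> ?N" if "n \<in> ?N" for n using dec(7) that by blast
  have PS: "P (?S x) = T (P x)" for x
    unfolding padded_def lin_add[OF lP] P(5)[OF P(3)] P(4)[OF TM[OF P(2)]] by simp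
  have "x = 0" if x: "?S x = 0" for x
  proof -
    have "T (P x) = T 0" using PS[of x] x by (simp add: lin_zero[OF lP] lin_zero[OF lT])
    then have "P x = 0" using P(2) complex_vector.subspace_0[OF dec(1)] by (rule inj_onD[OF dec(8)])
    then show "x = 0" using x by (simp add: padded_def lin_zero[OF lT])
  qed
  then have injS: "inj ?S"
    by (intro injI) (metis lin_diff[OF lS] right_minus_eq)
  have "\<exists>x. ?S x = y" for y
  proof -
    obtain m where m: "m \<in> ?M" "P y = T m" using dec(6) P(2)[of y] by blast
    have Pu: "P (m + (y - P y)) = m" unfolding lin_add[OF lP] P(4)[OF m(1)] P(5)[OF P(3)] by simp
    have "?S (m + (y - P y)) = y" unfolding padded_def Pu by (simp flip: m(2))
    then show ?thesis by blast
  qed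
  then have surjS: "surj ?S" unfolding surj_def by metis
  obtain c where c: "c > 0" "\<And>x. c * norm x \<le> norm (?S x)"
    using injective_bounded_below[OF S injS] surjS by auto
  obtain d where d: "d > 0" "\<And>\<mu>. cmod \<mu> < d \<Longrightarrow> surj (\<lambda>x. ?S x - \<mu> *\<^sub>C x)"
    using surj_near_zero[OF S surjS] by metis
  show thesis
  proof (rule that[of "min c d"])
    show "min c d > 0" using c d by simp
    fix \<mu> :: complex assume \<mu>: "\<mu> \<noteq> 0" "cmod \<mu> < min c d"
    let ?V = "\<lambda>x. T x - \<mu> *\<^sub>C x"
    have lV: "lin ?V" by (rule bounded_clinear_lin[OF bounded_clinear_shift[OF T]])
    have "x = 0" if x: "?V x = 0" for x
    proof -
      let ?m = "P x" and ?n = "x - P x"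
      have Vm: "?V ?m \<in> ?M"
        by (rule complex_vector.subspace_diff[OF dec(1) TM[OF P(2)] complex_vector.subspace_scale[OF dec(1) P(2)]])
      have Vn: "?V ?n \<in> ?N"
        by (rule complex_vector.subspace_diff[OF dec(3) TN[OF P(3)] complex_vector.subspace_scale[OF dec(3) P(3)]])
      have "?V x = ?V ?m + ?V ?n" by (simp add: lin_diff[OF lT] complex_vector.scale_right_diff_distrib)
      then have eq: "?V ?m + ?V ?n = 0" using x by simp
      have "P (?V ?m + ?V ?n) = ?V ?m" unfolding lin_add[OF lP] P(4)[OF Vm] P(5)[OF Vn] by simp
      then have m0: "?V ?m = 0" unfolding eq by (simp add: lin_zero[OF lP])
      then have n0: "?V ?n = 0" using eq by simp
      have "?S ?m - \<mu> *\<^sub>C ?m = 0" using m0 by (simp add: padded_def P(4)[OF P(2)])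
      then have "(c - cmod \<mu>) * norm ?m \<le> 0"
        using bounded_below_shift[OF c(2), of \<mu> ?m] by simp
      then have "?m = 0" using \<mu>(2) by (simp add: mult_le_0_iff)
      moreover have "?n = 0" using P(3)[of x] by (intro nilpotent_shift_injective[OF lT \<mu>(1) _ n0]) blast
      ultimately show "x = 0" by simp
    qed
    then have "inj ?V" by (intro injI) (metis (no_types, lifting) lin_diff[OF lV] right_minus_eq)
    moreover have "\<exists>x. ?V x = y" for y
    proof -
      have "surj (\<lambda>x. ?S x - \<mu> *\<^sub>C x)" using \<mu>(2) by (intro d(2)) simp
      from surjD[OF this, of "P y"] obtain x where x: "P y = ?S x - \<mu> *\<^sub>C x" by (rule exE)
      have 1: "?V (P x) = P y"
        using arg_cong[OF x, of P] by (simp add: lin_diff[OF lP] lin_scale[OF lP] PS P(4)[OF P(2)])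
      obtain u where u: "?V u = y - P y"
        using nilpotent_shift_preimage[OF lT \<mu>(1), of p "y - P y"] P(3)[of y] by blast
      have "?V (P x + u) = y" unfolding lin_add[OF lV] 1 u by simp
      then show ?thesis by blast
    qed
    then have "surj ?V" unfolding surj_def by metis
    ultimately show "inj ?V \<and> surj ?V" by blast
  qed
qed

text \<open>For the points \<open>\<mu>\<close> of the assumption, \<open>S - \<mu>\<close> is a finite rank perturbation of the invertible
  \<open>A - \<mu>\<close>, so finite ascent and finite descent are equivalent there and \<open>S - \<mu>\<close> is Drazin
  invertible. Points near \<open>\<mu>\<close> then give injective shifts of \<open>S\<close> close to \<open>0\<close>, which by
  \<open>kernel_persists\<close> excludes a nonzero vector of \<open>N(S)\<close> in all ranges \<open>R(S\<^sup>n)\<close>.\<close>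

lemma Drazin_at_limit:
  fixes A :: "'a :: complex_banach \<Rightarrow> 'a"
  assumes A: "bounded_clinear A" "inj A" "surj A" and F: "bounded_clinear F" "fin_rank F"
    and near: "\<And>\<epsilon>. \<epsilon> > 0 \<Longrightarrow> \<exists>\<mu> k. cmod \<mu> < \<epsilon> \<and>
      (kernel_stable (\<lambda>x. A x + F x - \<mu> *\<^sub>C x) k \<or> range_stable (\<lambda>x. A x + F x - \<mu> *\<^sub>C x) k)"
  obtains k where "kernel_stable (\<lambda>x. A x + F x) k" "range_stable (\<lambda>x. A x + F x) k"
proof -
  let ?S = "\<lambda>x. A x + F x"
  let ?V = "\<lambda>\<mu> x. ?S x - \<mu> *\<^sub>C x"
  let ?N = "{x. ?S x = 0}" and ?R = "\<lambda>n. range (?S ^^ n)"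
  note lA = bounded_clinear_lin[OF A(1)]
  have S: "bounded_clinear ?S" by (rule bounded_clinear_plus[OF A(1) F(1)])
  note lS = bounded_clinear_lin[OF S]
  have lSn: "lin (?S ^^ n)" for n by (rule lin_funpow[OF lS])
  obtain c where c: "c > 0" "\<And>x. c * norm x \<le> norm (A x)"
    using injective_bounded_below[OF A(1,2)] A(3) by auto
  obtain d where d: "d > 0" "\<And>\<mu>. cmod \<mu> < d \<Longrightarrow> surj (\<lambda>x. A x - \<mu> *\<^sub>C x)"
    using surj_near_zero[OF A(1,3)] by metis
  have inj_near: "\<exists>\<mu>. cmod \<mu> < \<epsilon> \<and> inj (?V \<mu>)" if \<epsilon>: "\<epsilon> > 0" for \<epsilon>
  proof -
    have "min \<epsilon> (min c d) > 0" using \<epsilon> c d by simp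
    from near[OF this] obtain \<mu> k where \<mu>: "cmod \<mu> < min \<epsilon> (min c d)" "kernel_stable (?V \<mu>) k \<or> range_stable (?V \<mu>) k"
      by (elim exE conjE)
    let ?A = "\<lambda>x. A x - \<mu> *\<^sub>C x"
    have lA': "lin ?A" by (rule bounded_clinear_lin[OF bounded_clinear_shift[OF A(1)]])
    have surjA: "surj ?A" using \<mu>(1) by (intro d(2)) simp
    have injA: "inj ?A"
      by (rule inj_if_bounded_below[OF lA' _ bounded_below_shift[OF c(2)]]) (use \<mu>(1) in simp)
    have V: "?V \<mu> = (\<lambda>x. ?A x + F x)" by (simp add: fun_eq_iff algebra_simps)
    have "kernel_stable (?V \<mu>) k \<and> range_stable (?V \<mu>) k"
      using \<mu>(2) perturb_injective_range_stable(2)[OF lA' injA F(2), of k]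
        perturb_surjective_kernel_stable(2)[OF lA' surjA F(2), of k] unfolding V by blast
    then have ks: "kernel_stable (?V \<mu>) k" "range_stable (?V \<mu>) k" by blast+
    obtain e where e: "e > 0"
      "\<And>\<nu>. \<nu> \<noteq> 0 \<Longrightarrow> cmod \<nu> < e \<Longrightarrow> inj (\<lambda>x. ?V \<mu> x - \<nu> *\<^sub>C x) \<and> surj (\<lambda>x. ?V \<mu> x - \<nu> *\<^sub>C x)"
      by (rule Drazin_punctured_neighbourhood[OF bounded_clinear_shift[OF S] ks], rule that)
    define r where "r = min e (\<epsilon> - cmod \<mu>) / 2"
    define \<nu> where "\<nu> = complex_of_real r"
    have "cmod \<mu> < \<epsilon>" using \<mu>(1) by simp
    then have r: "r > 0" "r < e" "r < \<epsilon> - cmod \<mu>" using e(1) by (auto simp: r_def min_def)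
    then have "inj (\<lambda>x. ?V \<mu> x - \<nu> *\<^sub>C x)" using e(2)[of \<nu>] by (simp add: \<nu>_def)
    moreover have "(\<lambda>x. ?V \<mu> x - \<nu> *\<^sub>C x) = ?V (\<mu> + \<nu>)" by (simp add: fun_eq_iff scaleC_add_left algebra_simps)
    moreover have "cmod (\<mu> + \<nu>) < \<epsilon>" using norm_triangle_ineq[of \<mu> \<nu>] r by (simp add: \<nu>_def)
    ultimately show ?thesis by metis
  qed
  have R: "csubspace (?R n)" for n by (rule subspace_lin_image[OF lSn]) simp
  have clR: "closed (?R n)" for n
  proof -
    obtain G where G: "fin_rank G" "(?S ^^ n) = (\<lambda>x. (A ^^ n) x + G x)"
      using fin_rank_perturb_funpow[OF lA F(2)] by blast
    show ?thesis
    proof (rule closed_range_finite_codim[OF bounded_clinear_funpow[OF S]])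
      show "finite_cdim (range (\<lambda>x. - G x))" using fin_rank_neg[OF G(1)] by (simp add: fin_rank_def)
      fix y
      obtain u where "y = (A ^^ n) u" using surjD[OF surj_fn[OF A(3), of n], of y] by (rule exE)
      then have "y = (?S ^^ n) u + - G u" by (simp add: G(2))
      then show "\<exists>x. \<exists>g\<in>range (\<lambda>x. - G x). y = (?S ^^ n) x + g" by blast
    qed
  qed
  have Rdec: "?R m \<subseteq> ?R n" if nm: "n \<le> m" for m n
  proof -
    obtain j where j: "m = n + j" using le_Suc_ex[OF nm] by (rule exE)
    show ?thesis unfolding j funpow_add by (rule image_subsetI) (simp only: o_apply rangeI)
  qed
  have N: "csubspace ?N" by (rule subspace_kernel[OF lS])
  have finN: "finite_cdim ?N" by (rule finite_nullity_perturb_injective[OF lA A(2) F(2)])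
  \<comment> \<open>The dimensions of \<open>N(S) \<inter> R(S\<^sup>n)\<close> decrease, so these spaces are eventually constant.\<close>
  define D where "D n = ?N \<inter> ?R n" for n
  have Dsub: "csubspace (D n)" for n unfolding D_def by (rule complex_vector.subspace_inter[OF N R])
  have finD: "finite_cdim (D n)" for n by (rule fin_dim_subset[OF _ finN]) (simp add: D_def)
  obtain n0 where n0: "\<And>n. cdim (D n0) \<le> cdim (D n)"
    using ex_has_least_nat[of "\<lambda>_. True" 0 "\<lambda>n. cdim (D n)"] by blast
  have stab: "D n = D n0" if "n0 \<le> n" for n
  proof (rule subspace_eq_if_dim_ge[OF Dsub _ finD n0])
    show "D n \<subseteq> D n0" unfolding D_def using Rdec[OF that] by blast
  qed
  have "D n0 \<subseteq> {0}"
  proof (rule ccontr)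
    assume "\<not> ?thesis"
    then obtain a where a: "a \<in> D n0" "a \<noteq> 0" by blast
    define Z where "Z = (\<Inter>n. ?R n)"
    have DZ: "D n0 \<subseteq> Z"
    proof -
      have "D n0 \<subseteq> ?R n" for n
      proof (cases "n0 \<le> n")
        case True
        then show ?thesis using stab[OF True] by (auto simp: D_def)
      next
        case False
        then have "?R n0 \<subseteq> ?R n" by (intro Rdec) simp
        then show ?thesis unfolding D_def by blast
      qed
      then show ?thesis unfolding Z_def by blast
    qed
    have subZ: "csubspace Z" unfolding Z_def by (rule complex_vector.subspace_Inter) (use R in blast)
    have clZ: "closed Z" unfolding Z_def by (intro closed_INT ballI clR)
    have "?S ` Z = Z"
    proof
      show "?S ` Z \<subseteq> Z"
      proof
        fix y assume "y \<in> ?S ` Z"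
        then obtain x where x: "x \<in> Z" "y = ?S x" by blast
        have "y \<in> ?R n" for n
        proof -
          obtain u where "x = (?S ^^ n) u" using x(1) by (auto simp: Z_def)
          then have "y = (?S ^^ n) (?S u)" using x(2) funpow_swap1[of ?S n u] by (simp only:)
          then show ?thesis by (simp only: rangeI)
        qed
        then show "y \<in> Z" by (simp add: Z_def)
      qed
      show "Z \<subseteq> ?S ` Z"
      proof
        fix y assume y: "y \<in> Z"
        have pre: "\<exists>x\<in>?R n. y = ?S x" for n
        proof -
          have "y \<in> ?R (Suc n)" using y unfolding Z_def by blast
          then show ?thesis by auto
        qed
        obtain x where x: "x \<in> ?R n0" "y = ?S x" using pre by blast
        have "x \<in> ?R n" for n
        proof (cases "n0 \<le> n")
          case True
          obtain x' where x': "x' \<in> ?R n" "y = ?S x'" using pre by blast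
          have "x - x' \<in> ?R n0"
            using x(1) x'(1) Rdec[OF True] by (intro complex_vector.subspace_diff[OF R]) blast+
          moreover have "?S (x - x') = 0" using lin_diff[OF lS, of x x'] x(2) x'(2) by simp
          ultimately have "x - x' \<in> D n" unfolding stab[OF True] by (simp add: D_def)
          then have "x - x' \<in> ?R n" unfolding D_def by (rule IntD2)
          then have "(x - x') + x' \<in> ?R n" using x'(1) by (rule complex_vector.subspace_add[OF R])
          then show ?thesis by simp
        next
          case False
          then have "?R n0 \<subseteq> ?R n" by (intro Rdec) simp
          then show ?thesis using x(1) by blast
        qed
        then have "x \<in> Z" by (simp add: Z_def)
        then show "y \<in> ?S ` Z" using x(2) by blast
      qed
    qed
    note SZ = this
    have aZ: "a \<in> Z" "?S a = 0" using a(1) DZ by (auto simp: D_def)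
    obtain e where e: "e > 0" "\<And>\<mu>. cmod \<mu> < e \<Longrightarrow> \<not> inj (?V \<mu>)"
      by (rule kernel_persists[OF S subZ clZ SZ aZ(1) a(2) aZ(2)], rule that)
    from inj_near[OF e(1)] show False using e(2) by (elim exE conjE) (rule notE)
  qed
  then have ker: "kernel_stable ?S n0"
    unfolding kernel_stable_def D_def by auto
  show thesis
    using that[OF ker perturb_surjective_kernel_stable(2)[OF lA A(3) F(2) ker]] .
qed

section \<open>Semi-Weyl operators\<close>

text \<open>In this form an inequality between possibly infinite dimensions enters the construction of finite
  rank corrections.\<close>

lemma independent_subset_of_card:
  assumes "enat n \<le> ecdim V"
  obtains C where "C \<subseteq> V" "finite C" "complex_vector.independent C" "card C = n"
proof -
  obtain B where B: "B \<subseteq> V" "complex_vector.independent B" "V \<subseteq> cspan B" "card B = cdim V"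
    using complex_vector.basis_exists by blast
  have "\<exists>C \<subseteq> B. finite C \<and> card C = n"
  proof (cases "finite B")
    case True
    then have "finite_cdim V" using B(3) unfolding finite_cdim_def by blast
    then have "n \<le> card B" using assms B(4) by (simp add: ecdim_def)
    then show ?thesis using True by (meson finite_subset obtain_subset_with_card_n)
  next
    case False
    then show ?thesis using infinite_arbitrarily_large by blast
  qed
  then obtain C where C: "C \<subseteq> B" "finite C" "card C = n" by blast
  show thesis
    using C B(1) complex_vector.independent_mono[OF B(2) C(1)] by (intro that) auto
qed

lemma bounded_finite_rank_matching:
  fixes B C :: "'a :: complex_normed_vector set"
  assumes B: "finite B" "complex_vector.independent B"
    and C: "finite C" "complex_vector.independent C" and card: "card B = card C"
  obtains F G where "bounded_clinear F" "fin_rank F" "\<And>x. F x \<in> cspan C" "\<And>x. x \<in> cspan B \<Longrightarrow> G (F x) = x"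
    "\<And>y. G y \<in> cspan B" "\<And>y. y \<in> cspan C \<Longrightarrow> F (G y) = y"
proof -
  obtain f where f: "bij_betw f B C" using finite_same_card_bij[OF B(1) C(1) card] by blast
  let ?g = "inv_into B f"
  have g: "bij_betw ?g C B" using f by (rule bij_betw_inv_into)
  obtain F where F: "bounded_clinear F" "range F \<subseteq> cspan (f ` B)" "\<forall>b\<in>B. F b = f b"
    using bounded_finite_rank_extension[OF B] by metis
  obtain G where G: "bounded_clinear G" "range G \<subseteq> cspan (?g ` C)" "\<forall>c\<in>C. G c = ?g c"
    using bounded_finite_rank_extension[OF C] by metis
  have im: "f ` B = C" "?g ` C = B" using f g by (simp_all add: bij_betw_def)
  note lF = bounded_clinear_lin[OF F(1)] and lG = bounded_clinear_lin[OF G(1)]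
  have GF: "G (F b) = b" if "b \<in> B" for b
    using that F(3) G(3) im f by (metis bij_betw_inv_into_left image_eqI)
  have FG: "F (G c) = c" if "c \<in> C" for c
    using that F(3) G(3) im f by (metis bij_betw_inv_into_right image_eqI)
  show thesis
  proof (rule that[of F G])
    show "bounded_clinear F" by (rule F(1))
    show "fin_rank F" unfolding fin_rank_def finite_cdim_def using lF F(2) im(1) C(1) by auto
    show "F x \<in> cspan C" for x using F(2) unfolding im(1) by (rule subsetD) (rule rangeI)
    show "G y \<in> cspan B" for y using G(2) unfolding im(2) by (rule subsetD) (rule rangeI)
    show "G (F x) = x" if "x \<in> cspan B" for x
      by (rule lin_eq_on_span[OF lin_compose[OF lG lF] lin_id GF that])
    show "F (G x) = x" if "x \<in> cspan C" for x
      by (rule lin_eq_on_span[OF lin_compose[OF lF lG] lin_id FG that])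
  qed
qed

text \<open>Every codimension is the dimension of an actual complement, see \<open>ecodim_eq\<close>.\<close>

lemma algebraic_complement:
  assumes W: "csubspace W" and M: "csubspace M" and WM: "W \<subseteq> M"
  obtains E where "csubspace E" "E \<subseteq> M" "direct_sum M W E"
proof -
  obtain Q where Q: "lin Q" "\<And>x. Q x = 0 \<longleftrightarrow> x \<in> W" "\<And>x. Q (Q x) = Q x"
    using projection_with_kernel[OF W] by metis
  have diff: "x - Q x \<in> W" for x
    by (rule Q(2)[THEN iffD1]) (simp add: lin_diff[OF Q(1)] Q(3))
  have QM: "Q m \<in> M" if "m \<in> M" for m
    using complex_vector.subspace_diff[OF M that subsetD[OF WM diff[of m]]] by simp
  have E: "csubspace (Q ` M)" by (rule subspace_lin_image[OF Q(1) M])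
  have EM: "Q ` M \<subseteq> M" using QM by blast
  have "M = {w + e | w e. w \<in> W \<and> e \<in> Q ` M}"
  proof (intro equalityI subsetI)
    fix m assume m: "m \<in> M"
    have "m = (m - Q m) + Q m" by simp
    then show "m \<in> {w + e | w e. w \<in> W \<and> e \<in> Q ` M}" using diff m by blast
  next
    fix m assume "m \<in> {w + e | w e. w \<in> W \<and> e \<in> Q ` M}"
    then obtain w e where we: "w \<in> W" "e \<in> Q ` M" and m: "m = w + e" by blast
    show "m \<in> M" unfolding m
      by (rule complex_vector.subspace_add[OF M subsetD[OF WM we(1)] subsetD[OF EM we(2)]])
  qed
  moreover have "W \<inter> Q ` M = {0}"
  proof (intro equalityI subsetI)
    fix x assume x: "x \<in> W \<inter> Q ` M"
    then have "Q x = x" using Q(3) by auto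
    then show "x \<in> {0}" using Q(2)[of x] x by simp
  qed (use complex_vector.subspace_0[OF W] complex_vector.subspace_0[OF E] in auto)
  ultimately have "direct_sum M W (Q ` M)" unfolding direct_sum_def by blast
  then show thesis using that E EM by blast
qed

lemma upper_semi_WeylD:
  assumes "upper_semi_Weyl_on M T"
  shows "closed (range_on M T)" "finite_cdim (null_space_on M T)" "nullity_on M T \<le> deficiency_on M T"
proof -
  have u: "closed (range_on M T)" "nullity_on M T < \<infinity>" "index_on M T \<le> 0"
    using assms by (auto simp: upper_semi_Weyl_on_def upper_semi_Fredholm_on_def)
  show "closed (range_on M T)" by (rule u(1))
  show "finite_cdim (null_space_on M T)"
    using u(2) by (auto simp: nullity_on_def ecdim_def split: if_splits)
  show "nullity_on M T \<le> deficiency_on M T"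
    using u(2,3) by (cases "nullity_on M T"; cases "deficiency_on M T") (auto simp: index_on_def)
qed

lemma lower_semi_WeylD:
  assumes "lower_semi_Weyl_on M T"
  shows "deficiency_on M T < \<infinity>" "deficiency_on M T \<le> nullity_on M T"
proof -
  have u: "deficiency_on M T < \<infinity>" "index_on M T \<ge> 0"
    using assms by (auto simp: lower_semi_Weyl_on_def lower_semi_Fredholm_on_def)
  show "deficiency_on M T < \<infinity>" by (rule u(1))
  show "deficiency_on M T \<le> nullity_on M T"
    using u by (cases "nullity_on M T"; cases "deficiency_on M T") (auto simp: index_on_def)
qed

text \<open>Map the finite-dimensional kernel injectively into a complement of the range, which has room for it
  by the inequality of dimensions. The range of the corrected operator is \<open>R(S)\<close> plus a
  finite-dimensional space, hence closed.\<close>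

lemma finite_rank_correction_injective:
  fixes S :: "'a :: complex_banach \<Rightarrow> 'a"
  assumes S: "bounded_clinear S" and cl: "closed (range S)"
    and fin: "finite_cdim {x. S x = 0}" and le: "ecdim {x. S x = 0} \<le> ecodim UNIV (range S)"
  obtains F where "bounded_clinear F" "fin_rank F" "inj (\<lambda>x. S x + F x)" "closed (range (\<lambda>x. S x + F x))"
proof -
  note lS = bounded_clinear_lin[OF S]
  let ?N = "{x. S x = 0}"
  have N: "csubspace ?N" by (rule subspace_kernel[OF lS])
  have R: "csubspace (range S)" by (rule subspace_lin_image[OF lS]) simp
  obtain E where E: "csubspace E" "direct_sum UNIV (range S) E"
    using algebraic_complement[OF R complex_vector.subspace_UNIV] by blast
  obtain B where B: "finite B" "B \<subseteq> ?N" "complex_vector.independent B" "?N \<subseteq> cspan B" "card B = cdim ?N"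
    using fin_dim_basis[OF fin] by metis
  have "enat (card B) \<le> ecdim E"
    using le unfolding ecodim_eq[OF R E] by (simp add: ecdim_def[of ?N] fin B(5))
  then obtain C where C: "C \<subseteq> E" "finite C" "complex_vector.independent C" "card C = card B"
    by (rule independent_subset_of_card)
  have spanB: "cspan B = ?N" using B(2,4) N by (intro antisym complex_vector.span_minimal)
  have spanC: "cspan C \<subseteq> E" by (rule complex_vector.span_minimal[OF C(1) E(1)])
  obtain F G where F: "bounded_clinear F" "fin_rank F" "\<And>x. F x \<in> cspan C"
    "\<And>x. x \<in> cspan B \<Longrightarrow> G (F x) = x" and G: "\<And>y. G y \<in> cspan B" "\<And>y. y \<in> cspan C \<Longrightarrow> F (G y) = y"
    by (rule bounded_finite_rank_matching[OF B(1,3) C(2,3) C(4)[symmetric]], rule that)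
  note lF = bounded_clinear_lin[OF F(1)]
  have disj: "range S \<inter> E \<subseteq> {0}" using E(2) by (simp add: direct_sum_def)
  let ?A = "\<lambda>x. S x + F x"
  have lA: "lin ?A" by (rule lin_plus[OF lS lF])
  have "x = 0" if "?A x = 0" for x
  proof -
    have "F (- x) = - F x" using lin_diff[OF lF, of 0 x] by (simp add: lin_zero[OF lF])
    moreover have "S x = - F x" using that by (rule eq_neg_iff_add_eq_0[THEN iffD2])
    ultimately have "S x = F (- x)" by (simp only:)
    then have "S x \<in> E" using subsetD[OF spanC F(3)[of "- x"]] by (simp only:)
    then have S0: "S x = 0" using disj by blast
    then have "G (F x) = x" using F(4) spanB by simp
    moreover have "G (F 0) = 0" by (rule F(4)[OF complex_vector.span_zero])
    moreover have "F x = 0" using that S0 by simp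
    ultimately show "x = 0" by (simp add: lin_zero[OF lF])
  qed
  then have "inj ?A" by (intro injI) (metis (no_types, lifting) lin_diff[OF lA] right_minus_eq)
  moreover have "range ?A = {w + e | w e. w \<in> range S \<and> e \<in> cspan C}"
  proof (intro equalityI subsetI)
    fix y assume "y \<in> range ?A"
    then show "y \<in> {w + e | w e. w \<in> range S \<and> e \<in> cspan C}" using F(3) by blast
  next
    fix y assume "y \<in> {w + e | w e. w \<in> range S \<and> e \<in> cspan C}"
    then obtain x e where xe: "e \<in> cspan C" "y = S x + e" by blast
    let ?n = "G (e - F x)"
    have Sn: "S ?n = 0" using G(1)[of "e - F x"] spanB by simp
    have Fn: "F ?n = e - F x" by (rule G(2)[OF complex_vector.span_diff[OF xe(1) F(3)]])
    have "?A (x + ?n) = y" unfolding lin_add[OF lS] lin_add[OF lF] Sn Fn xe(2) by simp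
    then show "y \<in> range ?A" by (rule range_eqI[OF sym])
  qed
  ultimately show thesis
    using that[OF F(1,2)] closed_sum_span[OF R cl C(2)] by simp
qed

text \<open>Map a subspace of the kernel onto a finite-dimensional complement of the range.\<close>

lemma finite_rank_correction_surjective:
  fixes S :: "'a :: complex_banach \<Rightarrow> 'a"
  assumes S: "bounded_clinear S"
    and fin: "ecodim UNIV (range S) < \<infinity>" and le: "ecodim UNIV (range S) \<le> ecdim {x. S x = 0}"
  obtains F where "bounded_clinear F" "fin_rank F" "surj (\<lambda>x. S x + F x)"
proof -
  note lS = bounded_clinear_lin[OF S]
  let ?N = "{x. S x = 0}"
  have N: "csubspace ?N" by (rule subspace_kernel[OF lS])
  have R: "csubspace (range S)" by (rule subspace_lin_image[OF lS]) simp
  obtain E where E: "csubspace E" "direct_sum UNIV (range S) E"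
    using algebraic_complement[OF R complex_vector.subspace_UNIV] by blast
  have finE: "finite_cdim E"
    using fin unfolding ecodim_eq[OF R E] by (auto simp: ecdim_def split: if_splits)
  obtain C where C: "finite C" "C \<subseteq> E" "complex_vector.independent C" "E \<subseteq> cspan C" "card C = cdim E"
    using fin_dim_basis[OF finE] by metis
  have "enat (card C) \<le> ecdim ?N"
    using le unfolding ecodim_eq[OF R E] by (simp add: ecdim_def[of E] finE C(5))
  then obtain B where B: "B \<subseteq> ?N" "finite B" "complex_vector.independent B" "card B = card C"
    by (rule independent_subset_of_card)
  have spanB: "cspan B \<subseteq> ?N" by (rule complex_vector.span_minimal[OF B(1) N])
  obtain F G where F: "bounded_clinear F" "fin_rank F" "\<And>x. F x \<in> cspan C"
    "\<And>x. x \<in> cspan B \<Longrightarrow> G (F x) = x" and G: "\<And>y. G y \<in> cspan B" "\<And>y. y \<in> cspan C \<Longrightarrow> F (G y) = y"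
    by (rule bounded_finite_rank_matching[OF B(2,3) C(1,3) B(4)], rule that)
  note lF = bounded_clinear_lin[OF F(1)]
  have "\<exists>x. S x + F x = y" for y
  proof -
    have "y \<in> {w + e | w e. w \<in> range S \<and> e \<in> E}" using E(2) by (simp add: direct_sum_def)
    then obtain x e where xe: "e \<in> E" "y = S x + e" by blast
    let ?n = "G (e - F x)"
    have Sn: "S ?n = 0" using G(1)[of "e - F x"] spanB by blast
    have "e \<in> cspan C" using xe(1) C(4) by blast
    then have Fn: "F ?n = e - F x" by (intro G(2) complex_vector.span_diff F(3))
    have "S (x + ?n) + F (x + ?n) = y" unfolding lin_add[OF lS] lin_add[OF lF] Sn Fn xe(2) by simp
    then show ?thesis by blast
  qed
  then have "surj (\<lambda>x. S x + F x)" unfolding surj_def by metis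
  then show thesis by (rule that[OF F(1,2)])
qed

text \<open>The lower bound \<open>c\<close> of \<open>A\<close> is what makes the passage from \<open>A - \<mu>\<close> to \<open>A\<close> possible: it fixes the required
  size of \<open>\<mu>\<close> before \<open>\<mu>\<close> is chosen.\<close>

lemma upper_semi_Weyl_Drazin:
  fixes S :: "'a :: complex_banach \<Rightarrow> 'a"
  assumes S: "bounded_clinear S" and W: "upper_semi_Weyl_on UNIV S"
    and near: "\<And>\<epsilon>. \<epsilon> > 0 \<Longrightarrow> \<exists>\<mu> q. cmod \<mu> < \<epsilon> \<and> range_stable (\<lambda>x. S x - \<mu> *\<^sub>C x) q"
  obtains k where "kernel_stable S k" "range_stable S k"
proof -
  note u = upper_semi_WeylD[OF W, unfolded nullity_on_def deficiency_on_def null_space_on_def range_on_def, simplified]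
  obtain F where F: "bounded_clinear F" "fin_rank F" "inj (\<lambda>x. S x + F x)" "closed (range (\<lambda>x. S x + F x))"
    using finite_rank_correction_injective[OF S u] by metis
  let ?A = "\<lambda>x. S x + F x"
  have A: "bounded_clinear ?A" by (rule bounded_clinear_plus[OF S F(1)])
  obtain c where c: "c > 0" "\<And>x. c * norm x \<le> norm (?A x)"
    using injective_bounded_below[OF A F(3,4)] by metis
  have F': "bounded_clinear (\<lambda>x. - F x)" "fin_rank (\<lambda>x. - F x)"
    using bounded_clinear_compose[OF bounded_clinear_scaleC[of "-1"] F(1)] fin_rank_neg[OF F(2)]
    by (simp_all add: complex_vector.scale_minus_left scaleC_one)
  have AF: "?A x + - F x = S x" for x by simp
  have "surj ?A"
  proof -
    from near[of "c / 2"] c(1) obtain \<mu> q where \<mu>: "cmod \<mu> < c / 2" "range_stable (\<lambda>x. S x - \<mu> *\<^sub>C x) q" by auto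
    let ?B = "\<lambda>x. ?A x - \<mu> *\<^sub>C x"
    have lB: "lin ?B" by (rule bounded_clinear_lin[OF bounded_clinear_shift[OF A]])
    have pos: "c - cmod \<mu> > 0" using \<mu>(1) norm_ge_zero[of \<mu>] by linarith
    have injB: "inj ?B" by (rule inj_if_bounded_below[OF lB pos bounded_below_shift[OF c(2)]])
    have "(\<lambda>x. ?B x + - F x) = (\<lambda>x. S x - \<mu> *\<^sub>C x)" by (simp add: fun_eq_iff)
    then have "surj ?B" using perturb_injective_range_stable(1)[OF lB injB F'(2), of q] \<mu>(2) by simp
    then show ?thesis by (rule surj_if_shift_surj[OF A c(2) \<mu>(1)])
  qed
  note surjA = this
  have lim: "\<exists>\<mu> k. cmod \<mu> < \<epsilon> \<and> (kernel_stable (\<lambda>x. ?A x + - F x - \<mu> *\<^sub>C x) k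
      \<or> range_stable (\<lambda>x. ?A x + - F x - \<mu> *\<^sub>C x) k)" if "\<epsilon> > 0" for \<epsilon>
    unfolding AF using near[OF that] by blast
  show thesis
    by (rule Drazin_at_limit[OF A F(3) surjA F' lim]) (use that AF in simp_all)
qed

lemma lower_semi_Weyl_Drazin:
  fixes S :: "'a :: complex_banach \<Rightarrow> 'a"
  assumes S: "bounded_clinear S" and W: "lower_semi_Weyl_on UNIV S"
    and near: "\<And>\<epsilon>. \<epsilon> > 0 \<Longrightarrow> \<exists>\<mu> p. cmod \<mu> < \<epsilon> \<and> kernel_stable (\<lambda>x. S x - \<mu> *\<^sub>C x) p"
  obtains k where "kernel_stable S k" "range_stable S k"
proof -
  note u = lower_semi_WeylD[OF W, unfolded nullity_on_def deficiency_on_def null_space_on_def range_on_def, simplified]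
  obtain F where F: "bounded_clinear F" "fin_rank F" "surj (\<lambda>x. S x + F x)"
    using finite_rank_correction_surjective[OF S _ u(2)] u(1) by auto
  let ?A = "\<lambda>x. S x + F x"
  have A: "bounded_clinear ?A" by (rule bounded_clinear_plus[OF S F(1)])
  note lA = bounded_clinear_lin[OF A]
  have F': "bounded_clinear (\<lambda>x. - F x)" "fin_rank (\<lambda>x. - F x)"
    using bounded_clinear_compose[OF bounded_clinear_scaleC[of "-1"] F(1)] fin_rank_neg[OF F(2)]
    by (simp_all add: complex_vector.scale_minus_left scaleC_one)
  have AF: "?A x + - F x = S x" for x by simp
  obtain d where d: "d > 0" "\<And>\<mu>. cmod \<mu> < d \<Longrightarrow> surj (\<lambda>x. ?A x - \<mu> *\<^sub>C x)"
    using surj_near_zero[OF A F(3)] by metis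
  have injA: "inj ?A"
  proof (rule ccontr)
    assume "\<not> inj ?A"
    then obtain x y where "?A x = ?A y" "x \<noteq> y" unfolding inj_def by blast
    then have a: "?A (x - y) = 0" "x - y \<noteq> 0" unfolding lin_diff[OF lA] by simp_all
    obtain e where e: "e > 0" "\<And>\<mu>. cmod \<mu> < e \<Longrightarrow> \<not> inj (\<lambda>x. ?A x - \<mu> *\<^sub>C x)"
      by (rule kernel_persists[OF A complex_vector.subspace_UNIV closed_UNIV F(3) UNIV_I a(2,1)], rule that)
    have "min d e > 0" using d(1) e(1) by simp
    from near[OF this] obtain \<mu> p
      where \<mu>: "cmod \<mu> < min d e" "kernel_stable (\<lambda>x. S x - \<mu> *\<^sub>C x) p" by (elim exE conjE)
    let ?B = "\<lambda>x. ?A x - \<mu> *\<^sub>C x"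
    have lB: "lin ?B" by (rule bounded_clinear_lin[OF bounded_clinear_shift[OF A]])
    have surjB: "surj ?B" using \<mu>(1) by (intro d(2)) simp
    have "(\<lambda>x. ?B x + - F x) = (\<lambda>x. S x - \<mu> *\<^sub>C x)" by (simp add: fun_eq_iff)
    then have "inj ?B" using perturb_surjective_kernel_stable(1)[OF lB surjB F'(2), of p] \<mu>(2) by simp
    moreover have "\<not> inj ?B" using \<mu>(1) by (intro e(2)) simp
    ultimately show False by blast
  qed
  have lim: "\<exists>\<mu> k. cmod \<mu> < \<epsilon> \<and> (kernel_stable (\<lambda>x. ?A x + - F x - \<mu> *\<^sub>C x) k
      \<or> range_stable (\<lambda>x. ?A x + - F x - \<mu> *\<^sub>C x) k)" if "\<epsilon> > 0" for \<epsilon>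
    unfolding AF using near[OF that] by blast
  show thesis
    by (rule Drazin_at_limit[OF A injA F(3) F' lim]) (use that AF in simp_all)
qed

section \<open>Extending the restriction to a summand to the whole space\<close>

definition commuting_projection :: "('a :: complex_normed_vector \<Rightarrow> 'a) \<Rightarrow> ('a \<Rightarrow> 'a) \<Rightarrow> bool" where
  "commuting_projection P T \<longleftrightarrow> lin P \<and> (\<forall>x. P (P x) = P x) \<and> (\<forall>x. P (T x) = T (P x))"

lemma commuting_projectionD:
  assumes "commuting_projection P T"
  shows "lin P" "P (P x) = P x" "P (T x) = T (P x)"
  using assms by (simp_all add: commuting_projection_def)

text \<open>On \<open>R(P)\<close> the shifted padded operator acts as \<open>T - \<mu>\<close>, on \<open>N(P)\<close> as multiplication by \<open>1 - \<mu>\<close>. The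
  latter is invertible for \<open>\<mu> \<noteq> 1\<close>, so ascent and descent are determined by \<open>R(P)\<close>.\<close>

lemma padded_shift_funpow:
  assumes T: "lin T" and cp: "commuting_projection P T"
  shows "((\<lambda>x. padded P T x - \<mu> *\<^sub>C x) ^^ k) x
    = ((\<lambda>x. T x - \<mu> *\<^sub>C x) ^^ k) (P x) + (1 - \<mu>) ^ k *\<^sub>C (x - P x)"
proof (induction k)
  case (Suc k)
  note P = commuting_projectionD(1)[OF cp] and PP = commuting_projectionD(2)[OF cp]
    and PT = commuting_projectionD(3)[OF cp]
  let ?m = "((\<lambda>x. T x - \<mu> *\<^sub>C x) ^^ k) (P x)" and ?n = "(1 - \<mu>) ^ k *\<^sub>C (x - P x)"
  have Pm: "P ?m = ?m"
    by (induction k) (simp_all add: PP lin_diff[OF P] lin_scale[OF P] PT)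
  have Pn: "P ?n = 0" by (simp add: lin_scale[OF P] lin_diff[OF P] PP)
  have "padded P T (?m + ?n) - \<mu> *\<^sub>C (?m + ?n) = (T ?m - \<mu> *\<^sub>C ?m) + (?n - \<mu> *\<^sub>C ?n)"
    unfolding padded_def lin_add[OF P] Pm Pn by (simp add: scaleC_add_right)
  also have "?n - \<mu> *\<^sub>C ?n = (1 - \<mu>) ^ Suc k *\<^sub>C (x - P x)"
    by (simp add: scaleC_scaleC left_diff_distrib complex_vector.scale_left_diff_distrib)
  finally show ?case by (simp add: Suc)
qed (simp add: scaleC_one)

lemma shift_funpow_projection:
  assumes cp: "commuting_projection P T"
  shows "P (((\<lambda>x. T x - \<mu> *\<^sub>C x) ^^ k) x) = ((\<lambda>x. T x - \<mu> *\<^sub>C x) ^^ k) (P x)"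
proof -
  note P = commuting_projectionD(1)[OF cp] and PT = commuting_projectionD(3)[OF cp]
  show ?thesis by (induction k) (simp_all add: lin_diff[OF P] lin_scale[OF P] PT)
qed

lemma padded_range_stable:
  assumes T: "lin T" and cp: "commuting_projection P T"
    and \<mu>: "\<mu> \<noteq> 1" and q: "range_stable (\<lambda>x. T x - \<mu> *\<^sub>C x) q"
  shows "range_stable (\<lambda>x. padded P T x - \<mu> *\<^sub>C x) q"
  unfolding range_stable_def
proof
  fix x
  note P = commuting_projectionD(1)[OF cp] and PP = commuting_projectionD(2)[OF cp]
    and PT = commuting_projectionD(3)[OF cp]
  let ?V = "\<lambda>x. T x - \<mu> *\<^sub>C x"
  obtain u where u: "(?V ^^ q) (P x) = (?V ^^ Suc q) u" using q unfolding range_stable_def by blast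
  have "(?V ^^ q) (P x) = P ((?V ^^ q) (P x))" by (simp only: shift_funpow_projection[OF cp] PP)
  also have "\<dots> = (?V ^^ Suc q) (P u)" unfolding u by (rule shift_funpow_projection[OF cp])
  finally have Pu: "(?V ^^ q) (P x) = (?V ^^ Suc q) (P u)" .
  let ?w = "P u + (1 / (1 - \<mu>)) *\<^sub>C (x - P x)"
  have Pw: "P ?w = P u" by (simp add: lin_add[OF P] lin_scale[OF P] lin_diff[OF P] PP)
  have "(1 - \<mu>) ^ Suc q *\<^sub>C (?w - P ?w) = (1 - \<mu>) ^ q *\<^sub>C (x - P x)"
    unfolding Pw using \<mu> by (simp add: scaleC_scaleC)
  then have "((\<lambda>x. padded P T x - \<mu> *\<^sub>C x) ^^ q) x = ((\<lambda>x. padded P T x - \<mu> *\<^sub>C x) ^^ Suc q) ?w"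
    unfolding padded_shift_funpow[OF T cp] Pu Pw by (simp only:)
  then show "\<exists>u. ((\<lambda>x. padded P T x - \<mu> *\<^sub>C x) ^^ q) x = ((\<lambda>x. padded P T x - \<mu> *\<^sub>C x) ^^ Suc q) u"
    by (rule exI)
qed

lemma padded_kernel_stable:
  assumes T: "lin T" and cp: "commuting_projection P T"
    and \<mu>: "\<mu> \<noteq> 1" and p: "kernel_stable (\<lambda>x. T x - \<mu> *\<^sub>C x) p"
  shows "kernel_stable (\<lambda>x. padded P T x - \<mu> *\<^sub>C x) p"
  unfolding kernel_stable_def
proof (intro allI impI)
  fix x assume x: "((\<lambda>x. padded P T x - \<mu> *\<^sub>C x) ^^ Suc p) x = 0"
  note P = commuting_projectionD(1)[OF cp] and PP = commuting_projectionD(2)[OF cp]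
    and PT = commuting_projectionD(3)[OF cp]
  let ?V = "\<lambda>x. T x - \<mu> *\<^sub>C x"
  let ?n = "(1 - \<mu>) ^ Suc p *\<^sub>C (x - P x)"
  have eq: "(?V ^^ Suc p) (P x) + ?n = 0" using x unfolding padded_shift_funpow[OF T cp] .
  have Pn: "P ?n = 0" by (simp add: lin_scale[OF P] lin_diff[OF P] PP)
  have "P ((?V ^^ Suc p) (P x) + ?n) = (?V ^^ Suc p) (P x)"
    unfolding lin_add[OF P] Pn shift_funpow_projection[OF cp] PP by (rule add_0_right)
  then have 1: "(?V ^^ Suc p) (P x) = 0" unfolding eq lin_zero[OF P] by (rule sym)
  then have "?n = 0" using eq by (simp only: add_0_left)
  then have "x - P x = 0" using \<mu> by simp
  moreover have "(?V ^^ p) (P x) = 0" using p 1 unfolding kernel_stable_def by blast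
  ultimately show "((\<lambda>x. padded P T x - \<mu> *\<^sub>C x) ^^ p) x = 0"
    unfolding padded_shift_funpow[OF T cp] by simp
qed

text \<open>On \<open>N(P)\<close> the operator \<open>T\<close> is nilpotent, so beyond the exponent \<open>n\<close> its powers only see \<open>R(P)\<close>, where
  \<open>T\<close> and the padded operator agree.\<close>

lemma stable_if_padded_stable:
  assumes T: "lin T" and cp: "commuting_projection P T"
    and nil: "\<And>x. (T ^^ n) (x - P x) = 0"
    and k: "kernel_stable (padded P T) k" "range_stable (padded P T) k"
  shows "kernel_stable T (max k n)" "range_stable T (max k n)"
proof -
  note P = commuting_projectionD(1)[OF cp] and PP = commuting_projectionD(2)[OF cp]
    and PT = commuting_projectionD(3)[OF cp]
  let ?K = "max k n"
  have pow: "(padded P T ^^ j) x = (T ^^ j) (P x) + (x - P x)" for j x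
  proof -
    have "((\<lambda>x. padded P T x - 0 *\<^sub>C x) ^^ j) x
        = ((\<lambda>x. T x - 0 *\<^sub>C x) ^^ j) (P x) + (1 - 0) ^ j *\<^sub>C (x - P x)"
      by (rule padded_shift_funpow[OF T cp])
    then show ?thesis by (simp only: complex_vector.scale_zero_left diff_zero power_one scaleC_one)
  qed
  have com: "P ((T ^^ j) x) = (T ^^ j) (P x)" for j x
    by (induction j) (simp_all add: PT)
  have lK: "lin (T ^^ j)" for j by (rule lin_funpow[OF T])
  have nilK: "(T ^^ ?K) (x - P x) = 0" for x
  proof -
    have "?K = (?K - n) + n" by simp
    then have "(T ^^ ?K) (x - P x) = (T ^^ (?K - n)) ((T ^^ n) (x - P x))"
      by (metis comp_apply funpow_add)
    then show ?thesis by (simp add: nil lin_zero[OF lK])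
  qed
  then have TK: "(T ^^ ?K) x = (T ^^ ?K) (P x)" for x
    using nilK[of x] by (simp add: lin_diff[OF lK])
  have kK: "kernel_stable (padded P T) ?K" "range_stable (padded P T) ?K"
    using kernel_stable_mono[OF k(1)] range_stable_mono[OF k(2)] by simp_all
  show "kernel_stable T ?K" unfolding kernel_stable_def
  proof (intro allI impI)
    fix x assume "(T ^^ Suc ?K) x = 0"
    then have "(T ^^ Suc ?K) (P x) = 0" using com[of "Suc ?K" x] by (simp add: lin_zero[OF P])
    then have "(padded P T ^^ Suc ?K) (P x) = 0" unfolding pow PP by simp
    then have "(padded P T ^^ ?K) (P x) = 0" using kK(1) unfolding kernel_stable_def by blast
    then show "(T ^^ ?K) x = 0" unfolding pow PP TK[of x] by simp
  qed
  show "range_stable T ?K" unfolding range_stable_def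
  proof
    fix x
    obtain u where u: "(padded P T ^^ ?K) (P x) = (padded P T ^^ Suc ?K) u"
      using kK(2) unfolding range_stable_def by blast
    then have "(T ^^ ?K) (P x) = (T ^^ Suc ?K) (P u) + (u - P u)" unfolding pow PP by simp
    then have "P ((T ^^ ?K) (P x)) = P ((T ^^ Suc ?K) (P u) + (u - P u))" by (rule arg_cong)
    then have "(T ^^ ?K) (P x) = (T ^^ Suc ?K) (P u)"
      unfolding lin_add[OF P] lin_diff[OF P] com PP by simp
    then show "\<exists>u. (T ^^ ?K) x = (T ^^ Suc ?K) u" unfolding TK[of x] by (rule exI)
  qed
qed

lemma padded_nullity:
  assumes T: "lin T" and cp: "commuting_projection P T"
  shows "nullity_on UNIV (padded P T) = nullity_on (range P) T"
proof -
  note P = commuting_projectionD(1)[OF cp] and PP = commuting_projectionD(2)[OF cp]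
    and PT = commuting_projectionD(3)[OF cp]
  have "null_space_on UNIV (padded P T) = null_space_on (range P) T"
  proof (intro equalityI subsetI)
    fix x assume "x \<in> null_space_on UNIV (padded P T)"
    then have x: "T (P x) + (x - P x) = 0" by (simp add: null_space_on_def padded_def)
    have "P (T (P x) + (x - P x)) = T (P x)"
      by (simp add: lin_add[OF P] lin_diff[OF P] PT PP)
    then have 1: "T (P x) = 0" unfolding x by (simp add: lin_zero[OF P])
    then have xP: "x = P x" using x by simp
    then have "x \<in> range P" by (rule range_eqI)
    moreover have "T x = 0" using 1 unfolding xP[symmetric] .
    ultimately show "x \<in> null_space_on (range P) T" by (simp add: null_space_on_def)
  next
    fix x assume "x \<in> null_space_on (range P) T"
    then have "P x = x" "T x = 0" using PP by (auto simp: null_space_on_def)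
    then show "x \<in> null_space_on UNIV (padded P T)" by (simp add: null_space_on_def padded_def)
  qed
  then show ?thesis by (simp add: nullity_on_def)
qed

lemma range_padded:
  assumes T: "lin T" and cp: "commuting_projection P T"
  shows "range (padded P T) = {x. P x \<in> T ` range P}"
proof (intro equalityI subsetI)
  note P = commuting_projectionD(1)[OF cp] and PP = commuting_projectionD(2)[OF cp]
    and PT = commuting_projectionD(3)[OF cp]
  fix y assume "y \<in> range (padded P T)"
  then obtain x where y: "y = T (P x) + (x - P x)" by (auto simp: padded_def)
  have "P y = T (P x)" unfolding y by (simp add: lin_add[OF P] lin_diff[OF P] PT PP)
  then show "y \<in> {x. P x \<in> T ` range P}" by simp
next
  note P = commuting_projectionD(1)[OF cp] and PP = commuting_projectionD(2)[OF cp]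
    and PT = commuting_projectionD(3)[OF cp]
  fix y assume "y \<in> {x. P x \<in> T ` range P}"
  then obtain x where x: "P y = T (P x)" by blast
  have Pu: "P (P x + (y - P y)) = P x" by (simp add: lin_add[OF P] lin_diff[OF P] PP)
  have "padded P T (P x + (y - P y)) = y" unfolding padded_def Pu by (simp add: x)
  then show "y \<in> range (padded P T)" by (rule range_eqI[OF sym])
qed

text \<open>A complement of \<open>T R(P)\<close> in \<open>R(P)\<close> is also a complement of the range of the padded operator, which
  contains \<open>N(P)\<close>.\<close>

lemma padded_deficiency:
  assumes T: "lin T" and cp: "commuting_projection P T"
  shows "deficiency_on UNIV (padded P T) = deficiency_on (range P) T"
proof -
  note P = commuting_projectionD(1)[OF cp] and PP = commuting_projectionD(2)[OF cp]
    and PT = commuting_projectionD(3)[OF cp]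
  note rng = range_padded[OF T cp]
  have M: "csubspace (range P)" by (rule subspace_lin_image[OF P]) simp
  have TM: "T ` range P \<subseteq> range P" by (auto simp flip: PT)
  have W: "csubspace (T ` range P)" by (rule subspace_lin_image[OF T M])
  obtain E where E: "csubspace E" "E \<subseteq> range P" "direct_sum (range P) (T ` range P) E"
    using algebraic_complement[OF W M TM] by blast
  have PE: "P e = e" if "e \<in> E" for e using subsetD[OF E(2) that] PP by auto
  have lS: "lin (padded P T)" unfolding padded_def
    by (intro lin_plus lin_minus lin_id P lin_compose[OF T P])
  have R: "csubspace (range (padded P T))" by (rule subspace_lin_image[OF lS]) simp
  have "direct_sum UNIV (range (padded P T)) E"
    unfolding direct_sum_def
  proof (intro conjI equalityI subsetI)
    fix x :: 'a
    have "P x \<in> {w + e | w e. w \<in> T ` range P \<and> e \<in> E}"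
      using E(3) rangeI[of P x] unfolding direct_sum_def by (elim conjE) (simp only:)
    then obtain w e where we: "w \<in> T ` range P" "e \<in> E" "P x = w + e" by blast
    have "P (x - e) = w" unfolding lin_diff[OF P] we(3) PE[OF we(2)] by simp
    then have "x - e \<in> range (padded P T)" unfolding rng mem_Collect_eq using we(1) by (simp only:)
    moreover have "x = (x - e) + e" by simp
    ultimately show "x \<in> {w + e | w e. w \<in> range (padded P T) \<and> e \<in> E}" using we(2) by blast
  next
    fix x assume x: "x \<in> range (padded P T) \<inter> E"
    then have "P x \<in> T ` range P" unfolding rng by blast
    moreover have "P x = x" using x PE by blast
    ultimately have "x \<in> T ` range P \<inter> E" using x by simp
    then show "x \<in> {0}" using E(3) unfolding direct_sum_def by blast
  qed (use complex_vector.subspace_0[OF R] complex_vector.subspace_0[OF E(1)] in auto)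
  from ecodim_eq[OF R E(1) this] ecodim_eq[OF W E(1) E(3)] show ?thesis
    by (simp add: deficiency_on_def range_on_def)
qed

lemma Red_padding:
  fixes T :: "'a :: complex_banach \<Rightarrow> 'a"
  assumes T: "bounded_clinear T" and red: "(M, N) \<in> Red T" and nil: "nilpotent_on N T"
  obtains P n where "bounded_clinear P" "commuting_projection P T" "range P = M"
    "\<And>x. (T ^^ n) (x - P x) = 0"
proof -
  note lT = bounded_clinear_lin[OF T]
  have MN: "csubspace M" "closed M" "csubspace N" "closed N" "direct_sum UNIV M N" "T ` M \<subseteq> M" "T ` N \<subseteq> N"
    using red by (auto simp: Red_def invariant_subspace_def)
  obtain P where P: "bounded_clinear P" "\<And>x. P x \<in> M" "\<And>x. x - P x \<in> N"
    "\<And>x. x \<in> M \<Longrightarrow> P x = x" "\<And>x. x \<in> N \<Longrightarrow> P x = 0"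
    by (rule bounded_projection[OF MN(1-5)], rule that)
  note lP = bounded_clinear_lin[OF P(1)]
  have PP: "P (P x) = P x" for x by (rule P(4)[OF P(2)])
  have PT: "P (T x) = T (P x)" for x
  proof -
    have "T (P x) \<in> M" using P(2) MN(6) by blast
    moreover have "T (x - P x) \<in> N" using P(3) MN(7) by blast
    ultimately have "P (T (P x) + T (x - P x)) = T (P x)" by (simp add: lin_add[OF lP] P(4,5))
    then show ?thesis by (simp add: lin_diff[OF lT])
  qed
  have cp: "commuting_projection P T" unfolding commuting_projection_def using lP PP PT by simp
  have "M \<subseteq> range P" using P(4) by (metis rangeI subsetI)
  then have "range P = M" using P(2) by blast
  moreover obtain n where "\<And>x. x \<in> N \<Longrightarrow> (T ^^ n) x = 0" using nil by (auto simp: nilpotent_on_def)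
  ultimately show thesis using that[OF P(1) cp] P(3) by metis
qed

lemma padded_closed_range:
  fixes T :: "'a :: complex_banach \<Rightarrow> 'a"
  assumes T: "lin T" and P: "bounded_clinear P" and cp: "commuting_projection P T"
    and cl: "closed (range_on (range P) T)"
  shows "closed (range_on UNIV (padded P T))"
proof -
  have "closed (P -` (T ` range P))"
    using cl bounded_clinear_bounded_linear[OF P]
    by (intro continuous_closed_vimage) (auto simp: range_on_def linear_continuous_at)
  then show ?thesis unfolding range_on_def range_padded[OF T cp] by (simp add: vimage_def)
qed

section \<open>Spectral conditions at zero\<close>

lemma null_space_stable_iff:
  "lin T \<Longrightarrow> null_space_on UNIV (T ^^ p) = null_space_on UNIV (T ^^ (p + 1)) \<longleftrightarrow> kernel_stable T p"
  unfolding null_space_on_def kernel_stable_def by (auto simp: lin_zero)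

lemma range_stable_iff:
  "range_on UNIV (T ^^ q) = range_on UNIV (T ^^ (q + 1)) \<longleftrightarrow> range_stable T q"
proof -
  have "range (T ^^ Suc q) \<subseteq> range (T ^^ q)"
    unfolding funpow_Suc_right by (rule image_subsetI) (simp only: o_apply rangeI)
  then have "range (T ^^ q) = range (T ^^ Suc q) \<longleftrightarrow> (\<forall>x. (T ^^ q) x \<in> range (T ^^ Suc q))" by blast
  then show ?thesis unfolding range_on_def range_stable_def by (simp add: image_iff)
qed

lemma ascent_eq: "lin T \<Longrightarrow> ascent T = Inf {enat p | p. kernel_stable T p}"
  unfolding ascent_def by (simp only: null_space_stable_iff)

lemma descent_eq: "descent T = Inf {enat q | q. range_stable T q}"
  unfolding descent_def by (simp only: range_stable_iff)

lemma Inf_enat_finite: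
  assumes "Inf {enat n | n. Q n} = enat m" shows "Q m"
proof -
  let ?A = "{enat n | n. Q n}"
  have ne: "?A \<noteq> {}" using assms by (auto simp: Inf_enat_def split: if_splits)
  then have "Inf ?A \<in> ?A" unfolding Inf_enat_def by (auto intro: LeastI)
  then show "Q m" using assms by auto
qed

lemma Drazin_invertible_iff:
  assumes T: "lin T"
  shows "Drazin_invertible T \<longleftrightarrow> (\<exists>k. kernel_stable T k \<and> range_stable T k)"
proof
  assume D: "Drazin_invertible T"
  then obtain k where k: "descent T = enat k" "ascent T = enat k"
    by (cases "descent T") (auto simp: Drazin_invertible_def)
  then show "\<exists>k. kernel_stable T k \<and> range_stable T k"
    using Inf_enat_finite[of "kernel_stable T"] Inf_enat_finite[of "range_stable T"]
    unfolding ascent_eq[OF T] descent_eq by blast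
next
  assume "\<exists>k. kernel_stable T k \<and> range_stable T k"
  then obtain k where k: "kernel_stable T k" "range_stable T k" by blast
  have "kernel_stable T n \<longleftrightarrow> range_stable T n" for n
    using kernel_stable_if_range_stable[OF T k(1)] range_stable_if_kernel_stable[OF T _ k(2)] by blast
  then have "ascent T = descent T" unfolding ascent_eq[OF T] descent_eq by simp
  moreover have "descent T \<le> enat k" unfolding descent_eq using k(2) by (intro Inf_lower) blast
  then have "descent T < \<infinity>" using enat_ord_simps(4) le_less_trans by blast
  ultimately show "Drazin_invertible T" by (simp add: Drazin_invertible_def)
qed

text \<open>The point \<open>\<mu>\<close> may be \<open>0\<close> itself; all later arguments allow this.\<close>

lemma near_zero_outside:
  assumes "(0 :: complex) \<notin> interior \<sigma>" "\<epsilon> > 0"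
  obtains \<mu> where "cmod \<mu> < \<epsilon>" "\<mu> \<notin> \<sigma>"
proof -
  have "\<not> ball 0 \<epsilon> \<subseteq> \<sigma>" using assms by (metis centre_in_ball interior_maximal open_ball subsetD)
  then obtain \<mu> where "\<mu> \<in> ball 0 \<epsilon>" "\<mu> \<notin> \<sigma>" by blast
  then show thesis using that by simp
qed

lemma range_stable_near_zero:
  assumes "0 \<notin> interior (descent_spectrum T)" "\<epsilon> > 0"
  shows "\<exists>\<mu> q. cmod \<mu> < \<epsilon> \<and> range_stable (\<lambda>x. T x - \<mu> *\<^sub>C x) q"
proof -
  obtain \<mu> where \<mu>: "cmod \<mu> < \<epsilon>" "\<mu> \<notin> descent_spectrum T" by (rule near_zero_outside[OF assms])
  then obtain q where "descent (\<lambda>x. T x - \<mu> *\<^sub>C x) = enat q" by (auto simp: descent_spectrum_def)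
  then have "range_stable (\<lambda>x. T x - \<mu> *\<^sub>C x) q" unfolding descent_eq by (rule Inf_enat_finite)
  then show ?thesis using \<mu>(1) by blast
qed

lemma kernel_stable_near_zero:
  assumes T: "bounded_clinear T" and "0 \<notin> interior (left_Drazin_spectrum T)" "\<epsilon> > 0"
  shows "\<exists>\<mu> p. cmod \<mu> < \<epsilon> \<and> kernel_stable (\<lambda>x. T x - \<mu> *\<^sub>C x) p"
proof -
  obtain \<mu> where \<mu>: "cmod \<mu> < \<epsilon>" "\<mu> \<notin> left_Drazin_spectrum T" by (rule near_zero_outside[OF assms(2,3)])
  then obtain p where "ascent (\<lambda>x. T x - \<mu> *\<^sub>C x) = enat p"
    by (auto simp: left_Drazin_spectrum_def left_Drazin_invertible_def)
  then have "kernel_stable (\<lambda>x. T x - \<mu> *\<^sub>C x) p"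
    unfolding ascent_eq[OF bounded_clinear_lin[OF bounded_clinear_shift[OF T]]] by (rule Inf_enat_finite)
  then show ?thesis using \<mu>(1) by blast
qed

text \<open>An injective and surjective shift has ascent and descent \<open>0\<close> and closed range.\<close>

lemma Drazin_imp_not_interior:
  fixes T :: "'a :: complex_banach \<Rightarrow> 'a"
  assumes T: "bounded_clinear T" and k: "kernel_stable T p" "range_stable T p"
  shows "0 \<notin> interior (descent_spectrum T)" "0 \<notin> interior (left_Drazin_spectrum T)"
proof -
  obtain \<delta> where \<delta>: "\<delta> > 0"
    "\<And>\<mu>. \<mu> \<noteq> 0 \<Longrightarrow> cmod \<mu> < \<delta> \<Longrightarrow> inj (\<lambda>x. T x - \<mu> *\<^sub>C x) \<and> surj (\<lambda>x. T x - \<mu> *\<^sub>C x)"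
    by (rule Drazin_punctured_neighbourhood[OF T k], rule that)
  have out: "\<mu> \<notin> descent_spectrum T \<and> \<mu> \<notin> left_Drazin_spectrum T" if \<mu>: "\<mu> \<noteq> 0" "cmod \<mu> < \<delta>" for \<mu>
  proof -
    let ?V = "\<lambda>x. T x - \<mu> *\<^sub>C x"
    have lV: "lin ?V" by (rule bounded_clinear_lin[OF bounded_clinear_shift[OF T]])
    have V: "inj ?V" "surj ?V" using \<delta>(2)[OF \<mu>] by blast+
    have r0: "range_stable ?V 0"
      using surjD[OF V(2)] by (simp add: range_stable_def)
    have k0: "kernel_stable ?V 0"
      using injD[OF V(1), of _ 0] lin_zero[OF lV] by (simp add: kernel_stable_def)
    have "descent ?V \<le> enat 0" unfolding descent_eq using r0 by (intro Inf_lower) blast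
    then have 1: "\<mu> \<notin> descent_spectrum T" by (auto simp: descent_spectrum_def enat_0)
    have "ascent ?V \<le> enat 0" unfolding ascent_eq[OF lV] using k0 by (intro Inf_lower) blast
    then have "ascent ?V = enat 0" by (simp add: enat_0)
    moreover have "range_on UNIV (?V ^^ (0 + 1)) = UNIV" using V(2) by (simp add: range_on_def)
    ultimately have "left_Drazin_invertible ?V" unfolding left_Drazin_invertible_def by (metis closed_UNIV)
    then show ?thesis using 1 by (simp add: left_Drazin_spectrum_def)
  qed
  have no: "0 \<notin> interior \<sigma>" if \<sigma>: "\<And>\<mu>. \<mu> \<noteq> 0 \<Longrightarrow> cmod \<mu> < \<delta> \<Longrightarrow> \<mu> \<notin> \<sigma>" for \<sigma> :: "complex set"
  proof
    assume "0 \<in> interior \<sigma>"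
    then obtain e where e: "e > 0" "ball 0 e \<subseteq> \<sigma>" by (auto simp: mem_interior)
    let ?\<mu> = "complex_of_real (min \<delta> e / 2)"
    have "?\<mu> \<in> ball 0 e" "?\<mu> \<noteq> 0" "cmod ?\<mu> < \<delta>" using e(1) \<delta>(1) by (auto simp: min_def)
    then show False using \<sigma> e(2) by blast
  qed
  show "0 \<notin> interior (descent_spectrum T)" by (rule no) (use out in blast)
  show "0 \<notin> interior (left_Drazin_spectrum T)" by (rule no) (use out in blast)
qed

lemma ecdim_zero: "ecdim {0 :: 'a :: complex_normed_vector} = 0"
proof -
  have "finite_cdim {0 :: 'a}" unfolding finite_cdim_def by (rule exI[of _ "{}"]) simp
  moreover have "cdim {0 :: 'a} \<le> 0"
    using complex_vector.dim_le_card[of "{0 :: 'a}" "{}"] by simp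
  ultimately show ?thesis by (simp add: ecdim_def zero_enat_def)
qed

lemma bounded_below_imp_upper_semi_Weyl:
  assumes T: "lin T" and M: "csubspace M" and b: "bounded_below_on M T"
  shows "upper_semi_Weyl_on M T"
proof -
  have "x = 0" if "x \<in> M" "T x = 0" for x
    using b that complex_vector.subspace_0[OF M] lin_zero[OF T]
    by (auto simp: bounded_below_on_def inj_on_def)
  then have "null_space_on M T = {0}"
    using complex_vector.subspace_0[OF M] lin_zero[OF T] by (auto simp: null_space_on_def)
  then have "nullity_on M T = 0" by (simp add: nullity_on_def ecdim_zero)
  then show ?thesis using b
    by (cases "deficiency_on M T")
      (auto simp: upper_semi_Weyl_on_def upper_semi_Fredholm_on_def index_on_def bounded_below_on_def)
qed

lemma surjective_imp_lower_semi_Weyl: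
  assumes M: "csubspace M" "closed M" and s: "surjective_on M T"
  shows "lower_semi_Weyl_on M T"
proof -
  have "direct_sum M M {0}" using complex_vector.subspace_0[OF M(1)] by (auto simp: direct_sum_def)
  then have "ecodim M M = ecdim {0 :: 'a}"
    by (intro ecodim_eq[OF M(1) complex_vector.subspace_single_0])
  then have "deficiency_on M T = 0" using s by (simp add: deficiency_on_def surjective_on_def ecdim_zero)
  then show ?thesis using s M(2)
    by (cases "nullity_on M T")
      (auto simp: lower_semi_Weyl_on_def lower_semi_Fredholm_on_def index_on_def surjective_on_def)
qed

lemma Drazin_imp_Red:
  fixes T :: "'a :: complex_banach \<Rightarrow> 'a"
  assumes T: "bounded_clinear T" and k: "kernel_stable T p" "range_stable T p"
  shows "\<exists>(M, N) \<in> Red T. bounded_below_on M T \<and> surjective_on M T \<and> nilpotent_on N T"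
proof -
  let ?M = "range (T ^^ p)" and ?N = "{x. (T ^^ p) x = 0}"
  note dec = Drazin_decomposition[OF T k]
  have "(?M, ?N) \<in> Red T" using dec by (simp add: Red_def invariant_subspace_def)
  moreover have "bounded_below_on ?M T" "surjective_on ?M T"
    using dec by (simp_all add: bounded_below_on_def surjective_on_def range_on_def)
  moreover have "nilpotent_on ?N T" by (auto simp: nilpotent_on_def)
  ultimately show ?thesis by blast
qed

lemma upper_semi_Weyl_Red_imp_Drazin:
  fixes T :: "'a :: complex_banach \<Rightarrow> 'a"
  assumes T: "bounded_clinear T" and near: "0 \<notin> interior (descent_spectrum T)"
    and red: "(M, N) \<in> Red T" and W: "upper_semi_Weyl_on M T" and nil: "nilpotent_on N T"
  shows "Drazin_invertible T"
proof -
  note lT = bounded_clinear_lin[OF T]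
  obtain P n where P: "bounded_clinear P" "commuting_projection P T" "range P = M"
    "\<And>x. (T ^^ n) (x - P x) = 0"
    by (rule Red_padding[OF T red nil], rule that)
  note dims = padded_nullity[OF lT P(2)] padded_deficiency[OF lT P(2)] padded_closed_range[OF lT P(1,2)]
  have W': "upper_semi_Weyl_on UNIV (padded P T)"
    using W dims unfolding P(3) by (simp add: upper_semi_Weyl_on_def upper_semi_Fredholm_on_def index_on_def)
  have near': "\<exists>\<mu> q. cmod \<mu> < \<epsilon> \<and> range_stable (\<lambda>x. padded P T x - \<mu> *\<^sub>C x) q" if "\<epsilon> > 0" for \<epsilon>
  proof -
    have "min \<epsilon> 1 > 0" using that by simp
    from range_stable_near_zero[OF near this] obtain \<mu> q
      where \<mu>: "cmod \<mu> < min \<epsilon> 1" "range_stable (\<lambda>x. T x - \<mu> *\<^sub>C x) q" by (elim exE conjE)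
    have "\<mu> \<noteq> 1" using \<mu>(1) by auto
    from padded_range_stable[OF lT P(2) this \<mu>(2)] show ?thesis using \<mu>(1) by auto
  qed
  obtain k where "kernel_stable (padded P T) k" "range_stable (padded P T) k"
    by (rule upper_semi_Weyl_Drazin[OF bounded_clinear_padded[OF P(1) T] W' near'], assumption, rule that)
  from stable_if_padded_stable[OF lT P(2,4) this] show ?thesis
    unfolding Drazin_invertible_iff[OF lT] by blast
qed

lemma lower_semi_Weyl_Red_imp_Drazin:
  fixes T :: "'a :: complex_banach \<Rightarrow> 'a"
  assumes T: "bounded_clinear T" and near: "0 \<notin> interior (left_Drazin_spectrum T)"
    and red: "(M, N) \<in> Red T" and W: "lower_semi_Weyl_on M T" and nil: "nilpotent_on N T"
  shows "Drazin_invertible T"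
proof -
  note lT = bounded_clinear_lin[OF T]
  obtain P n where P: "bounded_clinear P" "commuting_projection P T" "range P = M"
    "\<And>x. (T ^^ n) (x - P x) = 0"
    by (rule Red_padding[OF T red nil], rule that)
  note dims = padded_nullity[OF lT P(2)] padded_deficiency[OF lT P(2)] padded_closed_range[OF lT P(1,2)]
  have W': "lower_semi_Weyl_on UNIV (padded P T)"
    using W dims unfolding P(3) by (simp add: lower_semi_Weyl_on_def lower_semi_Fredholm_on_def index_on_def)
  have near': "\<exists>\<mu> p. cmod \<mu> < \<epsilon> \<and> kernel_stable (\<lambda>x. padded P T x - \<mu> *\<^sub>C x) p" if "\<epsilon> > 0" for \<epsilon>
  proof -
    have "min \<epsilon> 1 > 0" using that by simp
    from kernel_stable_near_zero[OF T near this] obtain \<mu> p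
      where \<mu>: "cmod \<mu> < min \<epsilon> 1" "kernel_stable (\<lambda>x. T x - \<mu> *\<^sub>C x) p" by (elim exE conjE)
    have "\<mu> \<noteq> 1" using \<mu>(1) by auto
    from padded_kernel_stable[OF lT P(2) this \<mu>(2)] show ?thesis using \<mu>(1) by auto
  qed
  obtain k where "kernel_stable (padded P T) k" "range_stable (padded P T) k"
    by (rule lower_semi_Weyl_Drazin[OF bounded_clinear_padded[OF P(1) T] W' near'], assumption, rule that)
  from stable_if_padded_stable[OF lT P(2,4) this] show ?thesis
    unfolding Drazin_invertible_iff[OF lT] by blast
qed

theorem theorem2p6:
  fixes T :: "'a :: complex_banach \<Rightarrow> 'a"
  assumes inf_dim: "\<not> finite_cdim (UNIV :: 'a set)"
    and T: "bounded_clinear T"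
  shows
    "(Drazin_invertible T \<longleftrightarrow>
        0 \<notin> interior (descent_spectrum T) \<and>
        (\<exists>(M, N) \<in> Red T. bounded_below_on M T \<and> nilpotent_on N T))
   \<and> (Drazin_invertible T \<longleftrightarrow>
        0 \<notin> interior (descent_spectrum T) \<and>
        (\<exists>(M, N) \<in> Red T. upper_semi_Weyl_on M T \<and> nilpotent_on N T))
   \<and> (Drazin_invertible T \<longleftrightarrow>
        0 \<notin> interior (left_Drazin_spectrum T) \<and>
        (\<exists>(M, N) \<in> Red T. surjective_on M T \<and> nilpotent_on N T))
   \<and> (Drazin_invertible T \<longleftrightarrow>
        0 \<notin> interior (left_Drazin_spectrum T) \<and>
        (\<exists>(M, N) \<in> Red T. lower_semi_Weyl_on M T \<and> nilpotent_on N T))"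
proof -
  note lT = bounded_clinear_lin[OF T]
  have sub: "csubspace M \<and> closed M" if "(M, N) \<in> Red T" for M N
    using that by (simp add: Red_def invariant_subspace_def)
  have bw: "upper_semi_Weyl_on M T" if "(M, N) \<in> Red T" "bounded_below_on M T" for M N
    using bounded_below_imp_upper_semi_Weyl[OF lT] sub[OF that(1)] that(2) by blast
  have sw: "lower_semi_Weyl_on M T" if "(M, N) \<in> Red T" "surjective_on M T" for M N
    using surjective_imp_lower_semi_Weyl sub[OF that(1)] that(2) by blast
  have up: "Drazin_invertible T" if "0 \<notin> interior (descent_spectrum T)"
    "\<exists>(M, N) \<in> Red T. upper_semi_Weyl_on M T \<and> nilpotent_on N T"
    using that(2) upper_semi_Weyl_Red_imp_Drazin[OF T that(1)] by blast
  have low: "Drazin_invertible T" if "0 \<notin> interior (left_Drazin_spectrum T)"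
    "\<exists>(M, N) \<in> Red T. lower_semi_Weyl_on M T \<and> nilpotent_on N T"
    using that(2) lower_semi_Weyl_Red_imp_Drazin[OF T that(1)] by blast
  have fwd: "0 \<notin> interior (descent_spectrum T) \<and> 0 \<notin> interior (left_Drazin_spectrum T) \<and>
      (\<exists>(M, N) \<in> Red T. bounded_below_on M T \<and> surjective_on M T \<and> nilpotent_on N T)"
    if D: "Drazin_invertible T"
  proof -
    obtain p where p: "kernel_stable T p" "range_stable T p"
      using D unfolding Drazin_invertible_iff[OF lT] by blast
    show ?thesis using Drazin_imp_not_interior[OF T p] Drazin_imp_Red[OF T p] by blast
  qed
  show ?thesis
  proof (intro conjI iffI)
    assume "Drazin_invertible T"
    note f = fwd[OF this]
    show "0 \<notin> interior (descent_spectrum T)" "0 \<notin> interior (descent_spectrum T)"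
      "0 \<notin> interior (left_Drazin_spectrum T)" "0 \<notin> interior (left_Drazin_spectrum T)"
      using f by blast+
    show "\<exists>(M, N) \<in> Red T. bounded_below_on M T \<and> nilpotent_on N T"
      "\<exists>(M, N) \<in> Red T. upper_semi_Weyl_on M T \<and> nilpotent_on N T"
      "\<exists>(M, N) \<in> Red T. surjective_on M T \<and> nilpotent_on N T"
      "\<exists>(M, N) \<in> Red T. lower_semi_Weyl_on M T \<and> nilpotent_on N T"
      using f bw sw by blast+
  qed (use up low bw sw in blast)+
qed

end
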